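(* Let $Q$ be a connected quiver and $\Lambda=kQ/\langle Z\rangle$ a finite dimensional monomial algebra such that $L_{-1}=k(Q_1//Q_0)\cap\operatorname{Ker}\psi_1=0$. The following are equivalent: (i) the Lie algebra $\operatorname{H}^1(\Lambda,\Lambda)$ is semisimple; (ii) the quiver $\bar Q$ is a tree, $Q$ has at least one class of parallel arrows with at least two arrows, the ideal $\langle Z\rangle$ is completely saturated, and, if $\operatorname{char}k=2$, $Q$ has no class of parallel arrows containing exactly two arrows; (iii) $\operatorname{H}^1(\Lambda,\Lambda)$ is nonzero and isomorphic to $\prod_{\bar\alpha}\mathfrak{pgl}(|\bar\alpha|,k)$, the product over all classes of parallel arrows $\bar\alpha$, where $|\bar\alpha|\neq2$ for all $\bar\alpha$ if $\operatorname{char}k=2$.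
   Context: $k$ is an algebraically closed field, $Q$ a finite quiver; $Q_n$ = paths of length $n$ ($Q_0$ vertices, $Q_1$ arrows). $Z$ is a minimal set of paths of length $\ge2$ (no proper subpath of an element of $Z$ lies in $Z$), $\Lambda=kQ/\langle Z\rangle$ finite dimensional; $B$ = paths (vertices included) containing no element of $Z$ as subpath. Paths are parallel if they have the same source and terminus; $X//Y$ = pairs of parallel paths in $X\times Y$; $k(X//Y)$ the vector space with that basis. For a path $\varepsilon$ and $(a,\gamma)\in Q_1//B$, $\varepsilon^{(a,\gamma)}$ = sum of all paths in $B$ obtained by replacing one occurrence of $a$ in $\varepsilon$ by $\gamma$ ($0$ if none); $(\eta,\varepsilon^{(a,\gamma)})=\sum_i(\eta,\varepsilon_i)$ if $\varepsilon^{(a,\gamma)}=\sum_i\varepsilon_i$. $\psi_1:k(Q_1//B)\to k(Z//B)$, $(a,\gamma)\mapsto\sum_{p\in Z}(p,p^{(a,\gamma)})$. $\operatorname{H}^1(\Lambda,\Lambda)$ = derivations modulo inner derivations, commutator bracket. Classes of parallel arrows are the equivalence classes of parallelism on $Q_1$. $\bar Q$ is the subquiver of $Q$ with all vertices and one chosen representative arrow of every class of parallel arrows (a tree = underlying unoriented graph is a tree). The ideal $\langle Z\rangle$ is completely saturated if for every pair of parallel arrows $(a,b)$ and every $p\in Z$ one has $p^{(b,a)}=0$. $\mathfrak{pgl}(n,k)=\mathfrak{gl}(n,k)/k\cdot1$. *)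

theory Defs
  imports "HOL-Computational_Algebra.Polynomial" "HOL-Library.Sublist" "HOL-Library.FuncSet"
begin

section \<open>Quivers and paths\<close>

text \<open>A finite quiver is given by a vertex set Q0, an arrow set Q1 and source/terminus
maps s t.  A path is a pair (v, as): its source vertex v and its list of arrows
(empty list = trivial path e_v).  Concatenation is written left to right.\<close>

type_synonym ('v,'a) qpath = "'v \<times> 'a list"

definition finite_quiver :: "'v set \<Rightarrow> 'a set \<Rightarrow> ('a \<Rightarrow> 'v) \<Rightarrow> ('a \<Rightarrow> 'v) \<Rightarrow> bool" where
  "finite_quiver Q0 Q1 s t \<longleftrightarrow> finite Q0 \<and> finite Q1 \<and> (\<forall>a\<in>Q1. s a \<in> Q0 \<and> t a \<in> Q0)"

definition is_path :: "'v set \<Rightarrow> 'a set \<Rightarrow> ('a \<Rightarrow> 'v) \<Rightarrow> ('a \<Rightarrow> 'v) \<Rightarrow> ('v,'a) qpath \<Rightarrow> bool" where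
  "is_path Q0 Q1 s t p \<longleftrightarrow> fst p \<in> Q0 \<and> set (snd p) \<subseteq> Q1
     \<and> (snd p \<noteq> [] \<longrightarrow> s (hd (snd p)) = fst p)
     \<and> (\<forall>i. Suc i < length (snd p) \<longrightarrow> t (snd p ! i) = s (snd p ! Suc i))"

definition psrc :: "('v,'a) qpath \<Rightarrow> 'v" where
  "psrc p = fst p"

definition ptgt :: "('a \<Rightarrow> 'v) \<Rightarrow> ('v,'a) qpath \<Rightarrow> 'v" where
  "ptgt t p = (if snd p = [] then fst p else t (last (snd p)))"

definition plen :: "('v,'a) qpath \<Rightarrow> nat" where
  "plen p = length (snd p)"

text \<open>The path consisting of a single arrow.\<close>
definition arrow_path :: "('a \<Rightarrow> 'v) \<Rightarrow> 'a \<Rightarrow> ('v,'a) qpath" where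
  "arrow_path s a = (s a, [a])"

text \<open>p is a subpath of q.\<close>
definition subpath :: "('a \<Rightarrow> 'v) \<Rightarrow> ('v,'a) qpath \<Rightarrow> ('v,'a) qpath \<Rightarrow> bool" where
  "subpath t p q \<longleftrightarrow>
     (snd p \<noteq> [] \<and> sublist (snd p) (snd q))
   \<or> (snd p = [] \<and> fst p \<in> insert (fst q) (t ` set (snd q)))"

definition parallel :: "('a \<Rightarrow> 'v) \<Rightarrow> ('v,'a) qpath \<Rightarrow> ('v,'a) qpath \<Rightarrow> bool" where
  "parallel t p q \<longleftrightarrow> psrc p = psrc q \<and> ptgt t p = ptgt t q"

text \<open>Z is a minimal set of paths of length at least 2.\<close>
definition minimal_relations :: "'v set \<Rightarrow> 'a set \<Rightarrow> ('a \<Rightarrow> 'v) \<Rightarrow> ('a \<Rightarrow> 'v)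
    \<Rightarrow> ('v,'a) qpath set \<Rightarrow> bool" where
  "minimal_relations Q0 Q1 s t Z \<longleftrightarrow>
     (\<forall>z\<in>Z. is_path Q0 Q1 s t z \<and> plen z \<ge> 2)
   \<and> (\<forall>z\<in>Z. \<forall>z'\<in>Z. subpath t z' z \<longrightarrow> z' = z)"

text \<open>B: paths (vertices included) containing no element of Z as a subpath.\<close>
definition Bpaths :: "'v set \<Rightarrow> 'a set \<Rightarrow> ('a \<Rightarrow> 'v) \<Rightarrow> ('a \<Rightarrow> 'v)
    \<Rightarrow> ('v,'a) qpath set \<Rightarrow> ('v,'a) qpath set" where
  "Bpaths Q0 Q1 s t Z = {p. is_path Q0 Q1 s t p \<and> \<not> (\<exists>z\<in>Z. subpath t z p)}"

text \<open>Connected quiver: nonempty, and the underlying unoriented graph is connected.\<close>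
definition quiver_connected :: "'v set \<Rightarrow> 'a set \<Rightarrow> ('a \<Rightarrow> 'v) \<Rightarrow> ('a \<Rightarrow> 'v) \<Rightarrow> bool" where
  "quiver_connected Q0 Q1 s t \<longleftrightarrow> Q0 \<noteq> {} \<and>
     (\<forall>u\<in>Q0. \<forall>v\<in>Q0. (u, v) \<in> ({(s a, t a) | a. a \<in> Q1} \<union> {(t a, s a) | a. a \<in> Q1})\<^sup>*)"

text \<open>A cycle in the underlying unoriented multigraph: a nonempty list of distinct
edges es and distinct vertices vs such that the i-th edge joins vs!i and vs!(i+1 mod n).
(A loop is a cycle of length 1, two edges joining the same two vertices form a cycle of length 2.)\<close>
definition unoriented_cycle :: "'v set \<Rightarrow> 'a set \<Rightarrow> ('a \<Rightarrow> 'v) \<Rightarrow> ('a \<Rightarrow> 'v)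
    \<Rightarrow> 'a list \<Rightarrow> 'v list \<Rightarrow> bool" where
  "unoriented_cycle Q0 Q1 s t es vs \<longleftrightarrow>
     es \<noteq> [] \<and> distinct es \<and> set es \<subseteq> Q1 \<and> length vs = length es \<and> distinct vs \<and> set vs \<subseteq> Q0
   \<and> (\<forall>i < length es. {s (es ! i), t (es ! i)} = {vs ! i, vs ! (Suc i mod length es)})"

text \<open>The underlying unoriented graph is a tree: connected and without cycles.\<close>
definition quiver_is_tree :: "'v set \<Rightarrow> 'a set \<Rightarrow> ('a \<Rightarrow> 'v) \<Rightarrow> ('a \<Rightarrow> 'v) \<Rightarrow> bool" where
  "quiver_is_tree Q0 Q1 s t \<longleftrightarrow> quiver_connected Q0 Q1 s t
     \<and> \<not> (\<exists>es vs. unoriented_cycle Q0 Q1 s t es vs)"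

text \<open>Parallelism on arrows and its classes.\<close>
definition arrow_par :: "'a set \<Rightarrow> ('a \<Rightarrow> 'v) \<Rightarrow> ('a \<Rightarrow> 'v) \<Rightarrow> ('a \<times> 'a) set" where
  "arrow_par Q1 s t = {(a, b). a \<in> Q1 \<and> b \<in> Q1 \<and> s a = s b \<and> t a = t b}"

definition par_classes :: "'a set \<Rightarrow> ('a \<Rightarrow> 'v) \<Rightarrow> ('a \<Rightarrow> 'v) \<Rightarrow> 'a set set" where
  "par_classes Q1 s t = Q1 // arrow_par Q1 s t"

text \<open>Q-bar (all vertices, one chosen representative arrow from each class) is a tree.
Whether the resulting unoriented graph is a tree does not depend on the choice.\<close>
definition Qbar_is_tree :: "'v set \<Rightarrow> 'a set \<Rightarrow> ('a \<Rightarrow> 'v) \<Rightarrow> ('a \<Rightarrow> 'v) \<Rightarrow> bool" where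
  "Qbar_is_tree Q0 Q1 s t \<longleftrightarrow>
     (\<exists>R. R \<subseteq> Q1 \<and> (\<forall>C\<in>par_classes Q1 s t. card (C \<inter> R) = 1) \<and> quiver_is_tree Q0 R s t)"

section \<open>Replacing an arrow by a parallel path\<close>

text \<open>Coefficient of the path e in p^(a,gamma): the number of occurrences of a in p
whose replacement by gamma yields e, counted only when e lies in B.\<close>
definition repl_count :: "('v,'a) qpath set \<Rightarrow> 'a \<Rightarrow> ('v,'a) qpath \<Rightarrow> ('v,'a) qpath
    \<Rightarrow> ('v,'a) qpath \<Rightarrow> nat" where
  "repl_count B a \<gamma> p e = card {i. i < length (snd p) \<and> snd p ! i = a \<and> e \<in> B
      \<and> e = (fst p, take i (snd p) @ snd \<gamma> @ drop (Suc i) (snd p))}"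

text \<open>p^(a,gamma) as an element of the vector space kB (functions supported on B).\<close>
definition repl :: "('v,'a) qpath set \<Rightarrow> 'a \<Rightarrow> ('v,'a) qpath \<Rightarrow> ('v,'a) qpath
    \<Rightarrow> ('v,'a) qpath \<Rightarrow> 'k::field" where
  "repl B a \<gamma> p = (\<lambda>e. of_nat (repl_count B a \<gamma> p e))"

text \<open>X//Y: parallel pairs.\<close>
definition par_pairs :: "('a \<Rightarrow> 'v) \<Rightarrow> ('v,'a) qpath set \<Rightarrow> ('v,'a) qpath set
    \<Rightarrow> (('v,'a) qpath \<times> ('v,'a) qpath) set" where
  "par_pairs t X Y = {(x, y). x \<in> X \<and> y \<in> Y \<and> parallel t x y}"

text \<open>Elements of k(Q1//B) are functions on Q1 \<times> paths supported on Q1//B, elements of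
k(Z//B) are functions on pairs of paths supported on Z//B.\<close>
definition kQ1B :: "'a set \<Rightarrow> ('a \<Rightarrow> 'v) \<Rightarrow> ('a \<Rightarrow> 'v) \<Rightarrow> ('v,'a) qpath set
    \<Rightarrow> ('a \<times> ('v,'a) qpath \<Rightarrow> 'k::field) set" where
  "kQ1B Q1 s t X = {f. \<forall>a \<gamma>. (a, \<gamma>) \<notin> {(a, \<gamma>). a \<in> Q1 \<and> (arrow_path s a, \<gamma>) \<in> par_pairs t {arrow_path s a} X}
       \<longrightarrow> f (a, \<gamma>) = 0}"

definition psi1 :: "'a set \<Rightarrow> ('a \<Rightarrow> 'v) \<Rightarrow> ('a \<Rightarrow> 'v) \<Rightarrow> ('v,'a) qpath set \<Rightarrow> ('v,'a) qpath set
    \<Rightarrow> ('a \<times> ('v,'a) qpath \<Rightarrow> 'k::field) \<Rightarrow> (('v,'a) qpath \<times> ('v,'a) qpath \<Rightarrow> 'k)" where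
  "psi1 Q1 s t B Z f = (\<lambda>(p, e). if p \<in> Z then
      (\<Sum>(a, \<gamma>) \<in> {(a, \<gamma>). a \<in> Q1 \<and> \<gamma> \<in> B \<and> parallel t (arrow_path s a) \<gamma>}.
          f (a, \<gamma>) * repl B a \<gamma> p e)
    else 0)"

text \<open>L_{-1} = k(Q1//Q0) \<inter> Ker psi1 (Q0 identified with the trivial paths).\<close>
definition L_minus1 :: "'v set \<Rightarrow> 'a set \<Rightarrow> ('a \<Rightarrow> 'v) \<Rightarrow> ('a \<Rightarrow> 'v) \<Rightarrow> ('v,'a) qpath set
    \<Rightarrow> ('a \<times> ('v,'a) qpath \<Rightarrow> 'k::field) set" where
  "L_minus1 Q0 Q1 s t Z = {f \<in> kQ1B Q1 s t {(v, []) | v. v \<in> Q0}.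
      psi1 Q1 s t (Bpaths Q0 Q1 s t Z) Z f = (\<lambda>_. 0)}"

text \<open>Complete saturation: p^(b,a) = 0 for every pair of parallel arrows and every p in Z.\<close>
definition completely_saturated :: "'v set \<Rightarrow> 'a set \<Rightarrow> ('a \<Rightarrow> 'v) \<Rightarrow> ('a \<Rightarrow> 'v)
    \<Rightarrow> ('v,'a) qpath set \<Rightarrow> 'k::field itself \<Rightarrow> bool" where
  "completely_saturated Q0 Q1 s t Z _ \<longleftrightarrow>
     (\<forall>(a, b) \<in> arrow_par Q1 s t. \<forall>p\<in>Z.
        (repl (Bpaths Q0 Q1 s t Z) b (arrow_path s a) p :: _ \<Rightarrow> 'k) = (\<lambda>_. 0))"

section \<open>The monomial algebra \<Lambda> = kQ/<Z> with basis B\<close>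

text \<open>Elements of \<Lambda>: k-valued functions on paths supported on B.\<close>
definition Lam :: "('v,'a) qpath set \<Rightarrow> (('v,'a) qpath \<Rightarrow> 'k::field) set" where
  "Lam B = {x. \<forall>p. p \<notin> B \<longrightarrow> x p = 0}"

definition lam_mult :: "('a \<Rightarrow> 'v) \<Rightarrow> ('v,'a) qpath set \<Rightarrow> (('v,'a) qpath \<Rightarrow> 'k::field)
    \<Rightarrow> (('v,'a) qpath \<Rightarrow> 'k) \<Rightarrow> (('v,'a) qpath \<Rightarrow> 'k)" where
  "lam_mult t B x y = (\<lambda>r. if r \<in> B then
      (\<Sum>(p, q) \<in> {(p, q). p \<in> B \<and> q \<in> B \<and> ptgt t p = psrc q \<and> (fst p, snd p @ snd q) = r}.
         x p * y q)
    else 0)"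

section \<open>Lie algebras (given by carrier and operations)\<close>

record ('x,'k) liealg =
  lcar :: "'x set"
  lzero :: 'x
  ladd :: "'x \<Rightarrow> 'x \<Rightarrow> 'x"
  lsmult :: "'k \<Rightarrow> 'x \<Rightarrow> 'x"
  lbr :: "'x \<Rightarrow> 'x \<Rightarrow> 'x"

definition lie_subspace :: "('x,'k) liealg \<Rightarrow> 'x set \<Rightarrow> bool" where
  "lie_subspace L I \<longleftrightarrow> I \<subseteq> lcar L \<and> lzero L \<in> I
     \<and> (\<forall>x\<in>I. \<forall>y\<in>I. ladd L x y \<in> I) \<and> (\<forall>c. \<forall>x\<in>I. lsmult L c x \<in> I)"

definition lie_ideal :: "('x,'k) liealg \<Rightarrow> 'x set \<Rightarrow> bool" where
  "lie_ideal L I \<longleftrightarrow> lie_subspace L I \<and> (\<forall>x\<in>lcar L. \<forall>y\<in>I. lbr L x y \<in> I)"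

text \<open>[I,I]: the subspace spanned by brackets of elements of I.\<close>
definition lie_commutator :: "('x,'k) liealg \<Rightarrow> 'x set \<Rightarrow> 'x set" where
  "lie_commutator L I = \<Inter> {J. lie_subspace L J \<and> {lbr L x y | x y. x \<in> I \<and> y \<in> I} \<subseteq> J}"

primrec derived_series :: "('x,'k) liealg \<Rightarrow> 'x set \<Rightarrow> nat \<Rightarrow> 'x set" where
  "derived_series L I 0 = I"
| "derived_series L I (Suc n) = lie_commutator L (derived_series L I n)"

definition lie_solvable_set :: "('x,'k) liealg \<Rightarrow> 'x set \<Rightarrow> bool" where
  "lie_solvable_set L I \<longleftrightarrow> (\<exists>n. derived_series L I n = {lzero L})"

text \<open>Semisimple: nonzero, and no nonzero solvable ideal (the radical is zero).\<close>
definition lie_semisimple :: "('x,'k) liealg \<Rightarrow> bool" where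
  "lie_semisimple L \<longleftrightarrow> lcar L \<noteq> {lzero L} \<and> (\<forall>I. lie_ideal L I \<and> lie_solvable_set L I \<longrightarrow> I = {lzero L})"

definition lie_iso :: "('x,'k) liealg \<Rightarrow> ('y,'k) liealg \<Rightarrow> bool" where
  "lie_iso L M \<longleftrightarrow> (\<exists>f. bij_betw f (lcar L) (lcar M)
     \<and> (\<forall>x\<in>lcar L. \<forall>y\<in>lcar L. f (ladd L x y) = ladd M (f x) (f y)
                             \<and> f (lbr L x y) = lbr M (f x) (f y))
     \<and> (\<forall>c. \<forall>x\<in>lcar L. f (lsmult L c x) = lsmult M c (f x)))"

text \<open>Quotient by an ideal: elements are cosets x + I; operations via representatives.\<close>
definition lcoset :: "('x,'k) liealg \<Rightarrow> 'x set \<Rightarrow> 'x \<Rightarrow> 'x set" where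
  "lcoset L I x = {ladd L x i | i. i \<in> I}"

definition lrep :: "'x set \<Rightarrow> 'x" where
  "lrep X = (SOME x. x \<in> X)"

definition lie_quot :: "('x,'k) liealg \<Rightarrow> 'x set \<Rightarrow> ('x set,'k) liealg" where
  "lie_quot L I = \<lparr> lcar = lcoset L I ` lcar L,
                   lzero = lcoset L I (lzero L),
                   ladd = (\<lambda>X Y. lcoset L I (ladd L (lrep X) (lrep Y))),
                   lsmult = (\<lambda>c X. lcoset L I (lsmult L c (lrep X))),
                   lbr = (\<lambda>X Y. lcoset L I (lbr L (lrep X) (lrep Y))) \<rparr>"

text \<open>Direct product of a family of Lie algebras indexed by J.\<close>
definition lie_prod :: "'j set \<Rightarrow> ('j \<Rightarrow> ('x,'k) liealg) \<Rightarrow> ('j \<Rightarrow> 'x,'k) liealg" where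
  "lie_prod J Ls = \<lparr> lcar = PiE J (\<lambda>j. lcar (Ls j)),
                    lzero = restrict (\<lambda>j. lzero (Ls j)) J,
                    ladd = (\<lambda>x y. restrict (\<lambda>j. ladd (Ls j) (x j) (y j)) J),
                    lsmult = (\<lambda>c x. restrict (\<lambda>j. lsmult (Ls j) c (x j)) J),
                    lbr = (\<lambda>x y. restrict (\<lambda>j. lbr (Ls j) (x j) (y j)) J) \<rparr>"

text \<open>gl(n,k): n\<times>n matrices (indices 0..n-1) with commutator bracket; pgl(n,k) = gl(n,k)/k\<cdot>1.\<close>
definition gl :: "nat \<Rightarrow> (nat \<Rightarrow> nat \<Rightarrow> 'k::field, 'k) liealg" where
  "gl n = \<lparr> lcar = {M. \<forall>i j. (n \<le> i \<or> n \<le> j) \<longrightarrow> M i j = 0},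
            lzero = (\<lambda>i j. 0),
            ladd = (\<lambda>M N i j. M i j + N i j),
            lsmult = (\<lambda>c M i j. c * M i j),
            lbr = (\<lambda>M N i j. (\<Sum>l<n. M i l * N l j) - (\<Sum>l<n. N i l * M l j)) \<rparr>"

definition scalar_matrices :: "nat \<Rightarrow> (nat \<Rightarrow> nat \<Rightarrow> 'k::field) set" where
  "scalar_matrices n = {(\<lambda>i j. if i = j \<and> i < n then c else 0) | c. True}"

definition pgl :: "nat \<Rightarrow> ((nat \<Rightarrow> nat \<Rightarrow> 'k::field) set, 'k) liealg" where
  "pgl n = lie_quot (gl n) (scalar_matrices n)"

section \<open>First Hochschild cohomology HH^1(\<Lambda>) = Der(\<Lambda>)/Inn(\<Lambda>)\<close>

text \<open>Derivations: k-linear maps \<Lambda> \<rightarrow> \<Lambda> satisfying Leibniz, extended by 0 outside \<Lambda>.\<close>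
definition derivations :: "('a \<Rightarrow> 'v) \<Rightarrow> ('v,'a) qpath set
    \<Rightarrow> ((('v,'a) qpath \<Rightarrow> 'k::field) \<Rightarrow> (('v,'a) qpath \<Rightarrow> 'k)) set" where
  "derivations t B = {D.
      (\<forall>x\<in>Lam B. D x \<in> Lam B) \<and> (\<forall>x. x \<notin> Lam B \<longrightarrow> D x = (\<lambda>_. 0))
    \<and> (\<forall>x\<in>Lam B. \<forall>y\<in>Lam B. D (\<lambda>p. x p + y p) = (\<lambda>p. D x p + D y p))
    \<and> (\<forall>c. \<forall>x\<in>Lam B. D (\<lambda>p. c * x p) = (\<lambda>p. c * D x p))
    \<and> (\<forall>x\<in>Lam B. \<forall>y\<in>Lam B.
         D (lam_mult t B x y) = (\<lambda>p. lam_mult t B (D x) y p + lam_mult t B x (D y) p))}"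

definition inner_derivations :: "('a \<Rightarrow> 'v) \<Rightarrow> ('v,'a) qpath set
    \<Rightarrow> ((('v,'a) qpath \<Rightarrow> 'k::field) \<Rightarrow> (('v,'a) qpath \<Rightarrow> 'k)) set" where
  "inner_derivations t B = {(\<lambda>x. if x \<in> Lam B then (\<lambda>p. lam_mult t B a x p - lam_mult t B x a p)
                                 else (\<lambda>_. 0)) | a. a \<in> Lam B}"

definition Der_lie :: "('a \<Rightarrow> 'v) \<Rightarrow> ('v,'a) qpath set
    \<Rightarrow> ((('v,'a) qpath \<Rightarrow> 'k::field) \<Rightarrow> (('v,'a) qpath \<Rightarrow> 'k), 'k) liealg" where
  "Der_lie t B = \<lparr> lcar = derivations t B,
                  lzero = (\<lambda>x p. 0),
                  ladd = (\<lambda>D E x p. D x p + E x p),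
                  lsmult = (\<lambda>c D x p. c * D x p),
                  lbr = (\<lambda>D E x p. D (E x) p - E (D x) p) \<rparr>"

definition HH1 :: "('a \<Rightarrow> 'v) \<Rightarrow> ('v,'a) qpath set
    \<Rightarrow> (((('v,'a) qpath \<Rightarrow> 'k::field) \<Rightarrow> (('v,'a) qpath \<Rightarrow> 'k)) set, 'k) liealg" where
  "HH1 t B = lie_quot (Der_lie t B) (inner_derivations t B)"

end

theory Submission
  imports Defs
begin

text \<open>
  Up to inner derivations a derivation of \<open>\<Lambda>\<close> kills the vertices and is given by its values on the
  arrows, an element of \<open>Ker \<psi>\<^sub>1\<close>. Since \<open>L\<^sub>-\<^sub>1 = 0\<close>, every derivation preserves the powers of the
  radical \<open>r\<close>, so it has a symbol: the matrix it induces on \<open>r/r\<^sup>2\<close>, the span of the arrows. The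
  symbol is a Lie homomorphism whose kernel is nilpotent. Its image is spanned by the matrix units
  replacing \<open>a\<close> by \<open>b\<close> for \<open>a \<le> b\<close>, where \<open>\<le>\<close> is a preorder contained in parallelism, and the symbols
  of inner derivations are the diagonal matrices \<open>a \<mapsto> x(s a) - x(t a)\<close>.

  If the quotient is semisimple, the strictly triangular part of the preorder gives a nilpotent ideal,
  so the preorder is symmetric. The diagonal matrices constant on its classes are then central, hence
  coboundaries \<open>a \<mapsto> x(s a) - x(t a)\<close>; in particular they are constant on parallel classes, which gives
  complete saturation, and all functions on the edges of \<open>Qbar\<close> are coboundaries, so there are no
  cycles. Conversely, on a tree every function on the edges is a coboundary. For the constant function
  \<open>1\<close> with integer values this says that paths parallel to an arrow have length one, so derivations are
  determined by their symbols modulo inner ones, and the symbols modulo coboundaries form the product of the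
  \<open>pgl\<close>. Finally an ideal of \<open>gl(n)\<close> with a nonscalar element contains all off-diagonal
  matrix units, unless \<open>n = 2\<close> in characteristic \<open>2\<close>, and these generate a perfect subalgebra.
\<close>

section \<open>Quotients of Lie algebras\<close>

text \<open>Semisimple means only that the radical is zero, and the characteristic is arbitrary, so
  the Killing form and complete reducibility are no help. Each consequence of semisimplicity is
  therefore drawn from an explicit chain of subspaces of \<open>Der\<close> whose images in the
  quotient form a solvable ideal: the filtration \<open>Fil\<close>, the strictly triangular
  symbols, the central diagonal symbols, and the block of a class of two arrows in characteristic 2,
  where gl(2) is solvable. The kernel of the symbol map has to be treated before the others. Once it
  is known to be inner, a derivation is inner exactly when its symbol is a coboundary, and only
  matrices indexed by arrows remain. On a tree the same criterion comes from path lengths instead.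
  The condition L_{-1} = 0 excludes derivations such as d/dx on k[x]/(x^p) in characteristic p,
  which send an arrow to a vertex and so induce no map on r/r^2.\<close>

locale lie_algebra =
  fixes L :: "('x,'k::field) liealg"
  assumes zero_closed: "lzero L \<in> lcar L"
    and add_closed: "\<lbrakk>x \<in> lcar L; y \<in> lcar L\<rbrakk> \<Longrightarrow> ladd L x y \<in> lcar L"
    and smult_closed: "x \<in> lcar L \<Longrightarrow> lsmult L c x \<in> lcar L"
    and br_closed: "\<lbrakk>x \<in> lcar L; y \<in> lcar L\<rbrakk> \<Longrightarrow> lbr L x y \<in> lcar L"
    and add_assoc: "\<lbrakk>x \<in> lcar L; y \<in> lcar L; z \<in> lcar L\<rbrakk>
      \<Longrightarrow> ladd L (ladd L x y) z = ladd L x (ladd L y z)"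
    and add_commute: "\<lbrakk>x \<in> lcar L; y \<in> lcar L\<rbrakk> \<Longrightarrow> ladd L x y = ladd L y x"
    and add_zero: "x \<in> lcar L \<Longrightarrow> ladd L x (lzero L) = x"
    and smult_zero: "x \<in> lcar L \<Longrightarrow> lsmult L 0 x = lzero L"
    and smult_one: "x \<in> lcar L \<Longrightarrow> lsmult L 1 x = x"
    and smult_add_left: "x \<in> lcar L \<Longrightarrow> lsmult L (c + d) x = ladd L (lsmult L c x) (lsmult L d x)"
    and smult_add_right: "\<lbrakk>x \<in> lcar L; y \<in> lcar L\<rbrakk>
      \<Longrightarrow> lsmult L c (ladd L x y) = ladd L (lsmult L c x) (lsmult L c y)"
    and br_add_left: "\<lbrakk>x \<in> lcar L; y \<in> lcar L; z \<in> lcar L\<rbrakk>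
      \<Longrightarrow> lbr L (ladd L x y) z = ladd L (lbr L x z) (lbr L y z)"
    and br_add_right: "\<lbrakk>x \<in> lcar L; y \<in> lcar L; z \<in> lcar L\<rbrakk>
      \<Longrightarrow> lbr L x (ladd L y z) = ladd L (lbr L x y) (lbr L x z)"
    and br_antisym: "\<lbrakk>x \<in> lcar L; y \<in> lcar L\<rbrakk> \<Longrightarrow> lbr L x y = lsmult L (-1) (lbr L y x)"
begin

lemma subspace_carrier: "lie_subspace L (lcar L)"
  by (simp add: lie_subspace_def zero_closed add_closed smult_closed)

lemma add_neg: "x \<in> lcar L \<Longrightarrow> ladd L x (lsmult L (-1) x) = lzero L"
  using smult_add_left[of x 1 "-1"] by (simp add: smult_one smult_zero)

lemma add_left_commute:
  "\<lbrakk>x \<in> lcar L; y \<in> lcar L; z \<in> lcar L\<rbrakk> \<Longrightarrow> ladd L x (ladd L y z) = ladd L y (ladd L x z)"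
  by (metis add_assoc add_commute)

lemmas add_ac = add_assoc add_commute add_left_commute

end

locale lie_algebra_ideal = lie_algebra L for L :: "('x,'k::field) liealg" +
  fixes I :: "'x set"
  assumes ideal: "lie_ideal L I"
begin

lemma ideal_carrier: "i \<in> I \<Longrightarrow> i \<in> lcar L"
  and ideal_zero: "lzero L \<in> I"
  and ideal_add: "\<lbrakk>i \<in> I; j \<in> I\<rbrakk> \<Longrightarrow> ladd L i j \<in> I"
  and ideal_smult: "i \<in> I \<Longrightarrow> lsmult L c i \<in> I"
  and ideal_br: "\<lbrakk>x \<in> lcar L; i \<in> I\<rbrakk> \<Longrightarrow> lbr L x i \<in> I"
  using ideal by (auto simp: lie_ideal_def lie_subspace_def)

lemma ideal_br_left: "\<lbrakk>x \<in> lcar L; i \<in> I\<rbrakk> \<Longrightarrow> lbr L i x \<in> I"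
  using br_antisym[of i x] ideal_carrier ideal_br ideal_smult by simp

lemma coset_absorb:
  assumes "x \<in> lcar L" "i \<in> I"
  shows "lcoset L I (ladd L x i) = lcoset L I x"
proof -
  have "\<exists>j'\<in>I. ladd L (ladd L x i) j = ladd L x j'" if "j \<in> I" for j
    using that assms ideal_add[OF assms(2) that] by (metis add_assoc ideal_carrier)
  moreover have "\<exists>j'\<in>I. ladd L x j = ladd L (ladd L x i) j'" if "j \<in> I" for j
  proof
    have c: "i \<in> lcar L" "j \<in> lcar L" "lsmult L (-1) i \<in> lcar L"
      using that assms by (auto intro: ideal_carrier smult_closed)
    show "ladd L j (lsmult L (-1) i) \<in> I" using that assms by (intro ideal_add ideal_smult)
    have "ladd L (ladd L x i) (ladd L j (lsmult L (-1) i))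
        = ladd L (ladd L x j) (ladd L i (lsmult L (-1) i))"
      using c assms(1) by (simp add: add_ac add_closed)
    then show "ladd L x j = ladd L (ladd L x i) (ladd L j (lsmult L (-1) i))"
      using c assms(1) by (simp add: add_neg add_zero add_closed)
  qed
  ultimately show ?thesis unfolding lcoset_def by blast
qed

lemma coset_self: "x \<in> lcar L \<Longrightarrow> x \<in> lcoset L I x"
  unfolding lcoset_def using ideal_zero add_zero[of x] by (metis (mono_tags, lifting) mem_Collect_eq)

lemma coset_eq_iff:
  assumes "x \<in> lcar L" "y \<in> lcar L"
  shows "lcoset L I x = lcoset L I y \<longleftrightarrow> (\<exists>i\<in>I. x = ladd L y i)"
proof
  assume "lcoset L I x = lcoset L I y"
  then show "\<exists>i\<in>I. x = ladd L y i" using coset_self[OF assms(1)] by (auto simp: lcoset_def)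
qed (auto simp: coset_absorb assms)

text \<open>The operations of \<open>lie_quot\<close> use a Hilbert choice of representatives. The
  choice differs from the given representative by an element of \<open>I\<close>, and with
  \<open>coset_absorb\<close> this makes every operation computable on arbitrary
  representatives.\<close>

lemma rep_coset:
  assumes "x \<in> lcar L"
  obtains i where "i \<in> I" "lrep (lcoset L I x) = ladd L x i"
proof -
  have "lrep (lcoset L I x) \<in> lcoset L I x"
    unfolding lrep_def using coset_self[OF assms] by (rule someI)
  then show ?thesis using that by (auto simp: lcoset_def)
qed

abbreviation (input) "cs \<equiv> lcoset L I"

lemma quot_carrier: "lcar (lie_quot L I) = cs ` lcar L"
  and quot_zero: "lzero (lie_quot L I) = cs (lzero L)"
  by (simp_all add: lie_quot_def)

lemma coset_eq_zero_iff:
  assumes "x \<in> lcar L" shows "cs x = cs (lzero L) \<longleftrightarrow> x \<in> I"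
  using coset_eq_iff[OF assms zero_closed]
  by (metis add_commute add_zero ideal_carrier zero_closed)

lemma quot_add:
  assumes "x \<in> lcar L" "y \<in> lcar L"
  shows "ladd (lie_quot L I) (cs x) (cs y) = cs (ladd L x y)"
proof -
  obtain i where i: "i \<in> I" "lrep (cs x) = ladd L x i" using rep_coset assms(1) .
  obtain j where j: "j \<in> I" "lrep (cs y) = ladd L y j" using rep_coset assms(2) .
  have c: "i \<in> lcar L" "j \<in> lcar L" using i j by (auto intro: ideal_carrier)
  have "ladd L (ladd L x i) (ladd L y j) = ladd L (ladd L x y) (ladd L i j)"
    using c assms by (simp add: add_ac add_closed)
  then show ?thesis
    using i j assms by (simp add: lie_quot_def coset_absorb ideal_add add_closed)
qed

lemma quot_smult:
  assumes "x \<in> lcar L"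
  shows "lsmult (lie_quot L I) c (cs x) = cs (lsmult L c x)"
proof -
  obtain i where i: "i \<in> I" "lrep (cs x) = ladd L x i" using rep_coset assms .
  then show ?thesis
    using assms by (simp add: lie_quot_def coset_absorb smult_add_right smult_closed ideal_carrier ideal_smult)
qed

lemma quot_br:
  assumes "x \<in> lcar L" "y \<in> lcar L"
  shows "lbr (lie_quot L I) (cs x) (cs y) = cs (lbr L x y)"
proof -
  obtain i where i: "i \<in> I" "lrep (cs x) = ladd L x i" using rep_coset assms(1) .
  obtain j where j: "j \<in> I" "lrep (cs y) = ladd L y j" using rep_coset assms(2) .
  have c: "i \<in> lcar L" "j \<in> lcar L" using i j by (auto intro: ideal_carrier)
  \<comment> \<open>After expansion every term except the bracket of \<open>x\<close> and
    \<open>y\<close> has an argument in \<open>I\<close>.\<close>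
  have "lbr L (ladd L x i) (ladd L y j)
      = ladd L (ladd L (lbr L x y) (lbr L i y)) (ladd L (lbr L x j) (lbr L i j))"
    using c assms by (simp add: br_add_left br_add_right add_closed)
  moreover have "lbr L i y \<in> I" "ladd L (lbr L x j) (lbr L i j) \<in> I"
    using i j c assms by (auto intro: ideal_br ideal_br_left ideal_add)
  ultimately show ?thesis
    using i j assms by (simp add: lie_quot_def coset_absorb add_closed br_closed ideal_carrier)
qed

lemmas quot_simps = quot_carrier quot_zero quot_add quot_smult quot_br

lemma lie_algebra_quot: "lie_algebra (lie_quot L I)"
proof (rule lie_algebra.intro, goal_cases)
  case (13 x y z)
  then show ?case by (auto simp: quot_simps br_add_right add_closed br_closed)
next
  case (5 x y z)
  then show ?case by (auto simp: quot_simps add_assoc add_closed)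
next
  case (6 x y)
  then show ?case using add_commute by (force simp: quot_simps)
next
  case (14 x y)
  then obtain u v where "u \<in> lcar L" "v \<in> lcar L" "x = cs u" "y = cs v" by (auto simp: quot_carrier)
  then show ?case using br_antisym[of u v] by (simp add: quot_simps br_closed)
qed (auto simp: quot_simps zero_closed add_closed smult_closed br_closed add_zero smult_zero
    smult_one smult_add_left smult_add_right br_add_left)

lemma subspace_quot:
  assumes "lie_subspace L S"
  shows "lie_subspace (lie_quot L I) (cs ` S)"
proof -
  have c: "x \<in> lcar L" if "x \<in> S" for x using assms that by (auto simp: lie_subspace_def)
  show ?thesis
    using assms unfolding lie_subspace_def by (auto simp: quot_simps c)
qed

text \<open>The images of the \<open>S k\<close> bound the derived series of the image of
  \<open>S 0\<close>, so this image is a solvable ideal of the quotient and vanishes by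
  semisimplicity. All conditions are stated in \<open>L\<close>, which spares the applications any
  calculation with cosets.\<close>

lemma semisimple_quot_chain:
  assumes ss: "lie_semisimple (lie_quot L I)"
    and sub: "\<And>k. lie_subspace L (S k)"
    and id: "\<And>x y. \<lbrakk>x \<in> lcar L; y \<in> S 0\<rbrakk> \<Longrightarrow> lbr L x y \<in> S 0"
    and br: "\<And>k x y. \<lbrakk>x \<in> S k; y \<in> S k\<rbrakk> \<Longrightarrow> lbr L x y \<in> S (Suc k)"
    and fin: "S n \<subseteq> I"
  shows "S 0 \<subseteq> I"
proof -
  let ?Q = "lie_quot L I"
  have car: "x \<in> lcar L" if "x \<in> S k" for x k
    using sub[of k] that by (auto simp: lie_subspace_def)
  have "lie_ideal ?Q (cs ` S 0)"
    unfolding lie_ideal_def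
  proof (intro conjI ballI)
    fix X Y assume "X \<in> lcar ?Q" "Y \<in> cs ` S 0"
    then obtain x y where "x \<in> lcar L" "y \<in> S 0" "X = cs x" "Y = cs y" by (auto simp: quot_carrier)
    then show "lbr ?Q X Y \<in> cs ` S 0" using id car[of y 0] by (simp add: quot_br)
  qed (rule subspace_quot[OF sub])
  moreover have "derived_series ?Q (cs ` S 0) n = {lzero ?Q}"
  proof -
    have "derived_series ?Q (cs ` S 0) k \<subseteq> cs ` S k" for k
    proof (induction k)
      case (Suc k)
      \<comment> \<open>A commutator is an intersection of subspaces, so it is enough that the
        subspace given by the image of \<open>S (Suc k)\<close> contains the brackets.\<close>
      have "{lbr ?Q x y |x y. x \<in> derived_series ?Q (cs ` S 0) k \<and> y \<in> derived_series ?Q (cs ` S 0) k}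
          \<subseteq> cs ` S (Suc k)"
      proof clarify
        fix X Y
        assume "X \<in> derived_series ?Q (cs ` S 0) k" "Y \<in> derived_series ?Q (cs ` S 0) k"
        then obtain x y where "x \<in> S k" "y \<in> S k" "X = cs x" "Y = cs y" using Suc by blast
        then show "lbr ?Q X Y \<in> cs ` S (Suc k)" using br car[of x k] car[of y k] by (simp add: quot_br)
      qed
      then show ?case using subspace_quot[OF sub[of "Suc k"]] by (auto simp: lie_commutator_def)
    qed simp
    then have "derived_series ?Q (cs ` S 0) n \<subseteq> {lzero ?Q}"
      using fin car[of _ n] coset_eq_zero_iff unfolding quot_zero by blast
    moreover have "lzero ?Q \<in> derived_series ?Q (cs ` S 0) k" for k
      using subspace_quot[OF sub[of 0]] by (cases k) (auto simp: lie_commutator_def lie_subspace_def)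
    ultimately show ?thesis by auto
  qed
  ultimately have "cs ` S 0 = {lzero ?Q}"
    using ss unfolding lie_semisimple_def lie_solvable_set_def by blast
  then have "x \<in> I" if "x \<in> S 0" for x
    using coset_eq_zero_iff[OF car[OF that]] that by (auto simp: quot_zero)
  then show ?thesis by blast
qed

lemma quot_trivial_iff:
  "lcar (lie_quot L I) = {lzero (lie_quot L I)} \<longleftrightarrow> lcar L \<subseteq> I"
proof
  assume *: "lcar (lie_quot L I) = {lzero (lie_quot L I)}"
  show "lcar L \<subseteq> I"
  proof
    fix x assume x: "x \<in> lcar L"
    then have "lcoset L I x \<in> {lzero (lie_quot L I)}" unfolding *[symmetric] quot_carrier by blast
    then show "x \<in> I" using coset_eq_zero_iff[OF x] by (simp add: quot_zero)
  qed
next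
  assume *: "lcar L \<subseteq> I"
  have "lcoset L I x = lcoset L I (lzero L)" if "x \<in> lcar L" for x
    using coset_eq_zero_iff[OF that] * that by blast
  then show "lcar (lie_quot L I) = {lzero (lie_quot L I)}"
    unfolding quot_carrier quot_zero using zero_closed by blast
qed

text \<open>The first isomorphism theorem. The kernel is described through pairs with equal image,
  because \<open>M\<close> is a bare record in which no subtraction is at hand.\<close>

lemma quot_iso:
  assumes maps: "\<And>x. x \<in> lcar L \<Longrightarrow> h x \<in> lcar M"
    and add: "\<And>x y. \<lbrakk>x \<in> lcar L; y \<in> lcar L\<rbrakk> \<Longrightarrow> h (ladd L x y) = ladd M (h x) (h y)"
    and sm: "\<And>c x. x \<in> lcar L \<Longrightarrow> h (lsmult L c x) = lsmult M c (h x)"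
    and br: "\<And>x y. \<lbrakk>x \<in> lcar L; y \<in> lcar L\<rbrakk> \<Longrightarrow> h (lbr L x y) = lbr M (h x) (h y)"
    and surj: "\<And>z. z \<in> lcar M \<Longrightarrow> \<exists>x\<in>lcar L. h x = z"
    and ker: "\<And>x y. \<lbrakk>x \<in> lcar L; y \<in> lcar L\<rbrakk> \<Longrightarrow> h x = h y \<longleftrightarrow> (\<exists>i\<in>I. x = ladd L y i)"
  shows "lie_iso (lie_quot L I) M"
proof -
  define f where "f X = h (lrep X)" for X
  have f: "f (cs x) = h x" if x: "x \<in> lcar L" for x
  proof -
    obtain i where i: "i \<in> I" "lrep (cs x) = ladd L x i" using rep_coset x .
    then show ?thesis using ker[of "ladd L x i" x] x by (auto simp: f_def add_closed ideal_carrier)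
  qed
  have "bij_betw f (lcar (lie_quot L I)) (lcar M)"
    unfolding bij_betw_def quot_carrier
  proof
    show "inj_on f (cs ` lcar L)"
    proof (rule inj_onI)
      fix X Y assume "X \<in> cs ` lcar L" "Y \<in> cs ` lcar L" "f X = f Y"
      then obtain x y where "x \<in> lcar L" "y \<in> lcar L" "X = cs x" "Y = cs y" "h x = h y"
        using f by auto
      then show "X = Y" by (simp only: coset_eq_iff ker)
    qed
    show "f ` cs ` lcar L = lcar M"
    proof
      show "f ` cs ` lcar L \<subseteq> lcar M" using maps by (auto simp: f)
      show "lcar M \<subseteq> f ` cs ` lcar L"
      proof
        fix z assume "z \<in> lcar M"
        then obtain x where "x \<in> lcar L" "h x = z" using surj by blast
        then show "z \<in> f ` cs ` lcar L" using f by force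
      qed
    qed
  qed
  moreover have "f (ladd (lie_quot L I) X Y) = ladd M (f X) (f Y) \<and>
      f (lbr (lie_quot L I) X Y) = lbr M (f X) (f Y)"
    if "X \<in> lcar (lie_quot L I)" "Y \<in> lcar (lie_quot L I)" for X Y
  proof -
    obtain x y where "x \<in> lcar L" "y \<in> lcar L" "X = cs x" "Y = cs y"
      using \<open>X \<in> _\<close> \<open>Y \<in> _\<close> by (auto simp: quot_carrier)
    then show ?thesis by (simp add: quot_add quot_br f add br add_closed br_closed)
  qed
  moreover have "f (lsmult (lie_quot L I) c X) = lsmult M c (f X)"
    if "X \<in> lcar (lie_quot L I)" for c X
    using that by (auto simp: quot_carrier quot_smult f sm smult_closed)
  ultimately show ?thesis unfolding lie_iso_def by blast
qed

end

section \<open>Ideals of the general linear Lie algebra\<close>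

definition munit :: "nat \<Rightarrow> nat \<Rightarrow> nat \<Rightarrow> nat \<Rightarrow> 'k::field" where
  "munit i j = (\<lambda>x y. if x = i \<and> y = j then 1 else 0)"

lemma munit_apply: "munit i j x y = (if x = i \<and> y = j then 1 else 0)"
  by (simp add: munit_def)

lemma gl_simps:
  "lcar (gl n) = {M. \<forall>i j. (n \<le> i \<or> n \<le> j) \<longrightarrow> M i j = 0}"
  "lzero (gl n) = (\<lambda>i j. 0)"
  "ladd (gl n) M N = (\<lambda>i j. M i j + N i j)"
  "lsmult (gl n) c M = (\<lambda>i j. c * M i j)"
  "lbr (gl n) M N = (\<lambda>i j. (\<Sum>l<n. M i l * N l j) - (\<Sum>l<n. N i l * M l j))"
  by (simp_all add: gl_def)

lemma lie_algebra_gl: "lie_algebra (gl n)"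
  by (unfold_locales)
    (auto simp: gl_simps algebra_simps sum.distrib intro!: ext)

lemma scalar_matrices_ideal: "lie_ideal (gl n) (scalar_matrices n)"
  unfolding lie_ideal_def lie_subspace_def
proof (intro conjI ballI allI)
  show "scalar_matrices n \<subseteq> lcar (gl n)"
    by (auto simp: scalar_matrices_def gl_simps)
  show "lzero (gl n) \<in> scalar_matrices n"
    by (auto simp: scalar_matrices_def gl_simps intro!: exI[of _ 0])
  fix M N :: "nat \<Rightarrow> nat \<Rightarrow> 'a" assume "M \<in> scalar_matrices n" "N \<in> scalar_matrices n"
  then obtain c d where M: "M = (\<lambda>i j. if i = j \<and> i < n then c else 0)"
      "N = (\<lambda>i j. if i = j \<and> i < n then d else 0)"
    by (auto simp: scalar_matrices_def)
  then show "ladd (gl n) M N \<in> scalar_matrices n"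
    by (auto simp: scalar_matrices_def gl_simps intro!: exI[of _ "c + d"] ext)
next
  fix c :: 'a and M :: "nat \<Rightarrow> nat \<Rightarrow> 'a" assume "M \<in> scalar_matrices n"
  then obtain d where M: "M = (\<lambda>i j. if i = j \<and> i < n then d else 0)"
    by (auto simp: scalar_matrices_def)
  then show "lsmult (gl n) c M \<in> scalar_matrices n"
    by (auto simp: scalar_matrices_def gl_simps intro!: exI[of _ "c * d"] ext)
next
  fix X M :: "nat \<Rightarrow> nat \<Rightarrow> 'a"
  assume X: "X \<in> lcar (gl n)" and "M \<in> scalar_matrices n"
  then obtain d where M: "M = (\<lambda>i j. if i = j \<and> i < n then d else 0)"
    by (auto simp: scalar_matrices_def)
  have "(\<Sum>l<n. X i l * M l j) = X i j * d" for i j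
  proof -
    have "(\<Sum>l<n. X i l * M l j) = (\<Sum>l<n. if l = j then X i l * d else 0)"
      by (intro sum.cong) (auto simp: M)
    then show ?thesis using X by (auto simp: gl_simps)
  qed
  moreover have "(\<Sum>l<n. M i l * X l j) = X i j * d" for i j
  proof -
    have "(\<Sum>l<n. M i l * X l j) = (\<Sum>l<n. if l = i then X l j * d else 0)"
      by (intro sum.cong) (auto simp: M)
    then show ?thesis using X by (auto simp: gl_simps)
  qed
  ultimately show "lbr (gl n) X M \<in> scalar_matrices n"
    by (auto simp: scalar_matrices_def gl_simps intro!: exI[of _ 0])
qed

lemma lie_algebra_ideal_pgl: "lie_algebra_ideal (gl n) (scalar_matrices n)"
  by (intro lie_algebra_ideal.intro lie_algebra_ideal_axioms.intro lie_algebra_gl scalar_matrices_ideal)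

lemma munit_carrier: "\<lbrakk>i < n; j < n\<rbrakk> \<Longrightarrow> munit i j \<in> lcar (gl n)"
  by (auto simp: gl_simps munit_apply)

lemma munit_mult_left:
  "j < n \<Longrightarrow> (\<Sum>l<n. munit i j x l * M l y) = (if x = i then M j y else 0)"
proof -
  assume j: "j < n"
  have "(\<Sum>l<n. munit i j x l * M l y) = (\<Sum>l<n. if l = j then (if x = i then M l y else 0) else 0)"
    by (intro sum.cong) (auto simp: munit_apply)
  then show ?thesis using j by simp
qed

lemma munit_mult_right:
  "i < n \<Longrightarrow> (\<Sum>l<n. M x l * munit i j l y) = (if y = j then M x i else 0)"
proof -
  assume i: "i < n"
  have "(\<Sum>l<n. M x l * munit i j l y) = (\<Sum>l<n. if l = i then (if y = j then M x l else 0) else 0)"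
    by (intro sum.cong) (auto simp: munit_apply)
  then show ?thesis using i by simp
qed

lemma gl_br_munit:
  "\<lbrakk>i < n; j < n\<rbrakk> \<Longrightarrow> lbr (gl n) (munit i j) M
    = (\<lambda>x y. (if x = i then M j y else 0) - (if y = j then M x i else 0))"
  by (simp add: gl_simps munit_mult_left munit_mult_right)

lemma third_index: "3 \<le> n \<Longrightarrow> \<exists>c<n. c \<noteq> a \<and> c \<noteq> (b::nat)"
proof -
  assume "3 \<le> n"
  moreover have "\<exists>c\<in>{0,1,2}. c \<noteq> a \<and> c \<noteq> b" by auto
  ultimately show ?thesis by (metis One_nat_def insertE less_le_trans numeral_3_eq_3 singletonD zero_less_Suc lessI Suc_lessD numeral_2_eq_2)
qed

text \<open>Brackets with matrix units isolate one entry of \<open>M\<close> and give an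
  off-diagonal unit up to a factor; further brackets move this unit to \<open>(i, j)\<close>. For
  \<open>n = 2\<close> a factor -2 appears, hence the exclusion of characteristic 2.\<close>

lemma gl_ideal_munits:
  fixes M :: "nat \<Rightarrow> nat \<Rightarrow> 'k::field"
  assumes I: "lie_ideal (gl n) I" and M: "M \<in> I" "M \<notin> scalar_matrices n"
    and ch: "\<not> (n = 2 \<and> (2::'k) = 0)" and ij: "i < n" "j < n" "i \<noteq> j"
  shows "munit i j \<in> I"
proof -
  have br: "lbr (gl n) (munit a b) N \<in> I" if "a < n" "b < n" "N \<in> I" for a b N
    using I that munit_carrier[of a n b] by (auto simp: lie_ideal_def)
  have sm: "(\<lambda>x y. c * N x y) \<in> I" if "N \<in> I" for c N
    using I that by (auto simp: lie_ideal_def lie_subspace_def gl_simps)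
  have car: "N x y = 0" if "N \<in> I" "n \<le> x \<or> n \<le> y" for N x y
    using I that by (auto simp: lie_ideal_def lie_subspace_def gl_simps)
  have scale: "munit a b \<in> I" if "N \<in> I" "N = (\<lambda>x y. c * munit a b x y)" "c \<noteq> 0" for a b N c
  proof -
    have "munit a b = (\<lambda>x y. inverse c * N x y)" using that(3) by (intro ext) (simp add: that(2))
    then show ?thesis using sm[OF that(1)] by simp
  qed
  \<comment> \<open>\<open>row\<close> uses [E_xa, E_ab] = E_xb to change the row index,
    \<open>col\<close> uses [E_by, E_ab] = -E_ay to change the column index. The side conditions
    keep the result off the diagonal.\<close>
  have row: "munit x b \<in> I" if "munit a b \<in> I" "a < n" "b < n" "x < n" "a \<noteq> b" "x \<noteq> b" for a b x
    using br[of x a "munit a b"] that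
    by (intro scale[of "lbr (gl n) (munit x a) (munit a b)" 1])
      (auto simp: gl_br_munit munit_apply intro!: ext)
  have col: "munit a y \<in> I" if "munit a b \<in> I" "a < n" "b < n" "y < n" "a \<noteq> b" "y \<noteq> a" for a b y
    using br[of b y "munit a b"] that
    by (intro scale[of "lbr (gl n) (munit b y) (munit a b)" "-1"])
      (auto simp: gl_br_munit munit_apply intro!: ext)
  have "\<exists>a b. a < n \<and> b < n \<and> a \<noteq> b \<and> munit a b \<in> I"
  proof (cases "\<exists>a b. a \<noteq> b \<and> M a b \<noteq> 0")
    case True
    then obtain a b where ab: "a \<noteq> b" "M a b \<noteq> 0" by blast
    then have lt: "a < n" "b < n" using car[OF M(1)] by (meson not_less)+
    show ?thesis
    proof (cases "n = 2")
      case True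
      then have two: "(2::'k) \<noteq> 0" using ch by simp
      \<comment> \<open>With E = E_ba and E^2 = 0 the double bracket is -2 E M E = -2 M_ab
        E_ba.\<close>
      let ?N = "lbr (gl n) (munit b a) (lbr (gl n) (munit b a) M)"
      have "?N \<in> I" using br lt M(1) by blast
      moreover have "?N = (\<lambda>x y. (-2 * M a b) * munit b a x y)"
        using lt ab by (auto simp: gl_br_munit munit_apply intro!: ext)
      ultimately show ?thesis using scale[of ?N "-2 * M a b" b a] two ab lt by auto
    next
      case False
      then have "n \<ge> 3" using lt ab by linarith
      then obtain c where c: "c < n" "c \<noteq> a" "c \<noteq> b" using third_index by blast
      \<comment> \<open>Brackets with E_bb and E_aa leave -(M_ab E_ab + M_ba E_ba); the bracket with
        E_bc then kills the second term and moves the first one to E_ac.\<close>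
      let ?A = "lbr (gl n) (munit a a) (lbr (gl n) (munit b b) M)"
      let ?N = "lbr (gl n) (munit b c) ?A"
      have "?N \<in> I" using br lt M(1) c by blast
      moreover have "?N = (\<lambda>x y. M a b * munit a c x y)"
        using lt ab c by (auto simp: gl_br_munit munit_apply intro!: ext)
      ultimately show ?thesis using scale[of ?N "M a b" a c] ab lt c by auto
    qed
  next
    case False
    have "\<exists>a b. a < n \<and> b < n \<and> M a a \<noteq> M b b"
    proof (rule ccontr)
      assume "\<not> ?thesis"
      then obtain d where d: "\<And>a. a < n \<Longrightarrow> M a a = d" by metis
      have "M = (\<lambda>i j. if i = j \<and> i < n then d else 0)"
        using False car[OF M(1)] d by (intro ext) (auto simp: not_less)
      then show False using M(2) by (auto simp: scalar_matrices_def)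
    qed
    then obtain a b where ab: "a < n" "b < n" "M a a \<noteq> M b b" by blast
    have "lbr (gl n) (munit a b) M \<in> I" using br ab M(1) by blast
    moreover have "lbr (gl n) (munit a b) M = (\<lambda>x y. (M b b - M a a) * munit a b x y)"
      using ab False by (intro ext) (simp add: gl_br_munit munit_apply, metis)
    ultimately show ?thesis using scale[of _ "M b b - M a a" a b] ab by auto
  qed
  then obtain a b where ab: "a < n" "b < n" "a \<noteq> b" "munit a b \<in> I" by blast
  show ?thesis
  proof (cases "i = b")
    case False
    then have "munit i b \<in> I" using row ab ij by blast
    then show ?thesis using col[of i b j] ab ij False by blast
  next
    \<comment> \<open>Here the route over \<open>(i, b)\<close> would meet the diagonal. A third
      index avoids it, and for \<open>n = 2\<close> a double bracket transposes the unit.\<close>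
    case i: True
    show ?thesis
    proof (cases "n = 2")
      case True
      then have two: "(2::'k) \<noteq> 0" using ch by simp
      have "j = a" using True i ij ab by auto
      let ?N = "lbr (gl n) (munit b a) (lbr (gl n) (munit b a) (munit a b)) :: nat \<Rightarrow> nat \<Rightarrow> 'k"
      have "?N \<in> I" using br ab by blast
      moreover have "?N = (\<lambda>x y. (-2) * munit b a x y)"
        using ab by (auto simp: gl_br_munit munit_apply intro!: ext)
      ultimately show ?thesis using scale[of ?N "-2" b a] two \<open>j = a\<close> i by auto
    next
      case False
      then have "n \<ge> 3" using ab by linarith
      then obtain c where c: "c < n" "c \<noteq> a" "c \<noteq> b" using third_index by blast
      have "munit a c \<in> I" using col ab c by blast
      then have "munit b c \<in> I" using row ab c by blast
      then show ?thesis using col[of b c j] ab c i ij by blast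
    qed
  qed
qed

text \<open>A solvable ideal \<open>I\<close> is tested factor by factor. If its projection to a
  factor met a nonscalar matrix, it would contain all off-diagonal units of that factor, and its
  derived series could never reach zero. So all components are scalar, that is, zero in
  \<open>pgl\<close>.\<close>

lemma iso_prod_pgl_semisimple:
  fixes H :: "('x,'k::field) liealg" and m :: "'c \<Rightarrow> nat"
  assumes H: "lie_algebra H" and nz: "lcar H \<noteq> {lzero H}"
    and iso: "lie_iso H (lie_prod J (\<lambda>C. pgl (m C)))"
    and ch: "\<And>C. C \<in> J \<Longrightarrow> \<not> (m C = 2 \<and> (2::'k) = 0)"
  shows "lie_semisimple H"
proof -
  interpret H: lie_algebra H by (rule H)
  let ?P = "lie_prod J (\<lambda>C. pgl (m C)) :: ('c \<Rightarrow> (nat \<Rightarrow> nat \<Rightarrow> 'k) set, 'k) liealg"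
  obtain f where bij: "bij_betw f (lcar H) (lcar ?P)"
    and hom: "\<And>x y. \<lbrakk>x \<in> lcar H; y \<in> lcar H\<rbrakk> \<Longrightarrow> f (ladd H x y) = ladd ?P (f x) (f y)"
      "\<And>x y. \<lbrakk>x \<in> lcar H; y \<in> lcar H\<rbrakk> \<Longrightarrow> f (lbr H x y) = lbr ?P (f x) (f y)"
      "\<And>c x. x \<in> lcar H \<Longrightarrow> f (lsmult H c x) = lsmult ?P c (f x)"
    using iso unfolding lie_iso_def by metis
  define cs where "cs C = lcoset (gl (m C) :: (_, 'k) liealg) (scalar_matrices (m C))" for C
  have fC: "\<exists>M\<in>lcar (gl (m C)). f x C = cs C M" if "x \<in> lcar H" "C \<in> J" for x C
  proof -
    interpret G: lie_algebra_ideal "gl (m C) :: (_, 'k) liealg" "scalar_matrices (m C)"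
      by (rule lie_algebra_ideal_pgl)
    have "f x \<in> lcar ?P" using bij that by (auto simp: bij_betw_def)
    then have "f x C \<in> lcar (pgl (m C))" using that by (auto simp: lie_prod_def)
    then show ?thesis by (auto simp: pgl_def G.quot_carrier cs_def)
  qed
  have f_add: "f (ladd H x y) C = cs C (ladd (gl (m C)) M N)"
    and f_br: "f (lbr H x y) C = cs C (lbr (gl (m C)) M N)"
    if "C \<in> J" "x \<in> lcar H" "y \<in> lcar H" "M \<in> lcar (gl (m C))" "N \<in> lcar (gl (m C))"
      "f x C = cs C M" "f y C = cs C N" for x y C M N
  proof -
    interpret G: lie_algebra_ideal "gl (m C) :: (_, 'k) liealg" "scalar_matrices (m C)"
      by (rule lie_algebra_ideal_pgl)
    show "f (ladd H x y) C = cs C (ladd (gl (m C)) M N)"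
      using that by (simp add: hom lie_prod_def pgl_def cs_def G.quot_add)
    show "f (lbr H x y) C = cs C (lbr (gl (m C)) M N)"
      using that by (simp add: hom lie_prod_def pgl_def cs_def G.quot_br)
  qed
  have f_smult: "f (lsmult H c x) C = cs C (lsmult (gl (m C)) c M)"
    if "C \<in> J" "x \<in> lcar H" "M \<in> lcar (gl (m C))" "f x C = cs C M" for x C M c
  proof -
    interpret G: lie_algebra_ideal "gl (m C) :: (_, 'k) liealg" "scalar_matrices (m C)"
      by (rule lie_algebra_ideal_pgl)
    show ?thesis using that by (simp add: hom lie_prod_def pgl_def cs_def G.quot_smult)
  qed
  have f_zero: "f (lzero H) C = cs C (\<lambda>i j. 0)" if C: "C \<in> J" for C
  proof -
    obtain M where M: "M \<in> lcar (gl (m C))" "f (lzero H) C = cs C M" using fC[OF H.zero_closed C] by blast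
    show ?thesis using f_smult[OF C H.zero_closed M, of 0]
      by (simp add: H.smult_zero H.zero_closed gl_simps)
  qed
  have f_onto: "\<exists>y\<in>lcar H. f y C = cs C X" if "C \<in> J" "X \<in> lcar (gl (m C))" for C X
  proof -
    \<comment> \<open>Component \<open>X\<close> at \<open>C\<close> and zero elsewhere.
      Surjectivity onto a factor is what makes the preimage of \<open>I\<close> in that factor an
      ideal.\<close>
    let ?g = "restrict (\<lambda>D. if D = C then cs C X else cs D (\<lambda>i j. 0)) J"
    have "cs D Y \<in> lcar (pgl (m D))" if "Y \<in> lcar (gl (m D))" for D Y
      using that by (simp add: cs_def pgl_def lie_quot_def)
    moreover have "(\<lambda>i j. 0 :: 'k) \<in> lcar (gl (m D))" for D by (simp add: gl_simps)
    ultimately have "?g \<in> lcar ?P" using that(2) by (simp add: lie_prod_def Pi_iff)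
    then have "?g \<in> f ` lcar H" using bij by (simp add: bij_betw_def)
    then obtain y where "y \<in> lcar H" "f y = ?g" by force
    then show ?thesis using that by (intro bexI[of _ y]) simp_all
  qed
  have "I = {lzero H}" if I: "lie_ideal H I" and solv: "derived_series H I N = {lzero H}" for I N
  proof -
    have Icar: "x \<in> lcar H" if "x \<in> I" for x using I that by (auto simp: lie_ideal_def lie_subspace_def)
    have scalar: "M \<in> scalar_matrices (m C)"
      if C: "C \<in> J" and x: "x \<in> I" and M: "M \<in> lcar (gl (m C))" "f x C = cs C M" for C x M
    proof (rule ccontr)
      assume nonscalar: "M \<notin> scalar_matrices (m C)"
      let ?n = "m C"
      interpret G: lie_algebra_ideal "gl ?n :: (_, 'k) liealg" "scalar_matrices ?n"
        by (rule lie_algebra_ideal_pgl)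
      \<comment> \<open>The preimage in \<open>gl\<close> of the projection of \<open>I\<close> to
        the factor \<open>C\<close>.\<close>
      define K where "K = {M \<in> lcar (gl ?n). \<exists>x\<in>I. f x C = cs C M}"
      have Kideal: "lie_ideal (gl ?n) K"
        unfolding lie_ideal_def lie_subspace_def
      proof (intro conjI ballI allI)
        show "K \<subseteq> lcar (gl ?n)" by (auto simp: K_def)
        show "lzero (gl ?n) \<in> K"
          using I f_zero[OF C] by (auto simp: K_def gl_simps lie_ideal_def lie_subspace_def)
      next
        fix X Y assume "X \<in> K" "Y \<in> K"
        then obtain x y where xy: "x \<in> I" "y \<in> I" "f x C = cs C X" "f y C = cs C Y"
            "X \<in> lcar (gl ?n)" "Y \<in> lcar (gl ?n)"
          by (auto simp: K_def)
        then have "f (ladd H x y) C = cs C (ladd (gl ?n) X Y)" by (intro f_add Icar C)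
        moreover have "ladd H x y \<in> I" using I xy by (auto simp: lie_ideal_def lie_subspace_def)
        ultimately show "ladd (gl ?n) X Y \<in> K" using xy by (auto simp: K_def G.add_closed)
      next
        fix c X assume "X \<in> K"
        then obtain x where xy: "x \<in> I" "f x C = cs C X" "X \<in> lcar (gl ?n)"
          by (auto simp: K_def)
        then have "f (lsmult H c x) C = cs C (lsmult (gl ?n) c X)" by (intro f_smult Icar C)
        moreover have "lsmult H c x \<in> I" using I xy by (auto simp: lie_ideal_def lie_subspace_def)
        ultimately show "lsmult (gl ?n) c X \<in> K" using xy by (auto simp: K_def G.smult_closed)
      next
        fix X Y :: "nat \<Rightarrow> nat \<Rightarrow> 'k" assume X: "X \<in> lcar (gl ?n)" and "Y \<in> K"
        then obtain y where y: "y \<in> I" "f y C = cs C Y" "Y \<in> lcar (gl ?n)"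
          by (auto simp: K_def)
        obtain x where x: "x \<in> lcar H" "f x C = cs C X" using f_onto[OF C X] by blast
        have "f (lbr H x y) C = cs C (lbr (gl ?n) X Y)" using x y X C Icar by (intro f_br) auto
        moreover have "lbr H x y \<in> I" using I x y by (auto simp: lie_ideal_def)
        ultimately show "lbr (gl ?n) X Y \<in> K" using y X by (auto simp: K_def G.br_closed)
      qed
      have MK: "M \<in> K" using x M by (auto simp: K_def)
      have unitK: "munit i j \<in> K" if "i < ?n" "j < ?n" "i \<noteq> j" for i j
        using gl_ideal_munits[OF Kideal MK nonscalar ch[OF C]] that by blast
      define hm :: "nat \<Rightarrow> nat \<Rightarrow> nat \<Rightarrow> nat \<Rightarrow> 'k"
        where "hm i j = (\<lambda>x y. munit i i x y - munit j j x y)" for i j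
      have hm_car: "hm i j \<in> lcar (gl ?n)" if "i < ?n" "j < ?n" for i j
        using that by (auto simp: hm_def munit_apply gl_simps)
      have br_hm: "lbr (gl ?n) (munit i j) (munit j i) = hm i j" if "i < ?n" "j < ?n" "i \<noteq> j" for i j
        using that by (auto simp: gl_br_munit hm_def munit_apply intro!: ext)
      have br_munit: "lbr (gl ?n) (munit i l) (munit l j) = munit i j"
        if "i < ?n" "j < ?n" "l < ?n" "i \<noteq> j" for i j l
        using that by (auto simp: gl_br_munit munit_apply intro!: ext)
      have br_hm_munit: "lbr (gl ?n) (hm i j) (munit i j) = (\<lambda>x y. 2 * munit i j x y)"
        if "i < ?n" "j < ?n" "i \<noteq> j" for i j
        using that
        by (intro ext) (simp add: gl_simps munit_mult_left munit_mult_right, simp add: hm_def munit_apply)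
      \<comment> \<open>An invariant of the derived series. The \<open>hm i j\<close> are carried
        along because for two indices a unit is regained from [hm, E_ij] = 2 E_ij; in characteristic
        2 the factorization [E_il, E_lj] = E_ij through a third index takes over.\<close>
      define good where "good U \<longleftrightarrow> U \<subseteq> lcar H \<and> (\<forall>i<?n. \<forall>j<?n. i \<noteq> j \<longrightarrow>
          (\<exists>x\<in>U. f x C = cs C (munit i j)) \<and> (\<exists>x\<in>U. f x C = cs C (hm i j)))" for U
      have goodI: "good I"
      proof -
        have "hm i j \<in> K" if "i < ?n" "j < ?n" "i \<noteq> j" for i j
        proof -
          have "lbr (gl ?n) (munit i j) (munit j i) \<in> K"
            using Kideal unitK[of j i] munit_carrier[of i ?n j] that unfolding lie_ideal_def by blast
          then show ?thesis using br_hm[OF that] by simp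
        qed
        then show ?thesis using unitK Icar by (auto simp: good_def K_def)
      qed
      have good_step: "good (lie_commutator H U)" if U: "good U" for U
        unfolding good_def
      proof (intro conjI allI impI)
        have Ucar: "x \<in> lcar H" if "x \<in> U" for x using U that by (auto simp: good_def)
        show "lie_commutator H U \<subseteq> lcar H"
          unfolding lie_commutator_def using H.subspace_carrier H.br_closed Ucar by blast
        have br_in: "lbr H x y \<in> lie_commutator H U" if "x \<in> U" "y \<in> U" for x y
          using that by (auto simp: lie_commutator_def)
        have sm_in: "lsmult H c x \<in> lie_commutator H U" if "x \<in> lie_commutator H U" for c x
          using that by (auto simp: lie_commutator_def lie_subspace_def)
        have un: "\<exists>x\<in>U. f x C = cs C (munit i j)" and hm: "\<exists>x\<in>U. f x C = cs C (hm i j)"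
          if "i < ?n" "j < ?n" "i \<noteq> j" for i j
          using U that by (auto simp: good_def)
        fix i j assume ij: "i < ?n" "j < ?n" "i \<noteq> j"
        obtain x y where xy: "x \<in> U" "f x C = cs C (munit i j)" "y \<in> U" "f y C = cs C (munit j i)"
          using un[of i j] un[of j i] ij by blast
        have "f (lbr H x y) C = cs C (hm i j)"
          using f_br[OF C, of x y "munit i j" "munit j i"] xy ij
          by (simp add: Ucar munit_carrier br_hm)
        then show "\<exists>x\<in>lie_commutator H U. f x C = cs C (hm i j)" using br_in xy by blast
        show "\<exists>x\<in>lie_commutator H U. f x C = cs C (munit i j)"
        proof (cases "(2::'k) = 0")
          case False
          obtain h where h: "h \<in> U" "f h C = cs C (hm i j)" using hm ij by blast
          have "f (lbr H h x) C = cs C (\<lambda>x y. 2 * munit i j x y)"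
            using f_br[OF C, of h x "hm i j" "munit i j"] xy h ij
            by (simp add: Ucar munit_carrier hm_car br_hm_munit)
          moreover have "(\<lambda>x y. 2 * munit i j x y :: 'k) \<in> lcar (gl ?n)"
            using ij by (auto simp: munit_apply gl_simps)
          ultimately have "f (lsmult H (1/2) (lbr H h x)) C
              = cs C (lsmult (gl ?n) (1/2) (\<lambda>x y. 2 * munit i j x y))"
            using xy h Ucar C by (intro f_smult H.br_closed) auto
          also have "\<dots> = cs C (munit i j)" using False by (simp add: gl_simps)
          finally show ?thesis using sm_in br_in h xy by blast
        next
          case True
          then have "?n \<ge> 3" using ch[OF C] ij by linarith
          then obtain l where l: "l < ?n" "l \<noteq> i" "l \<noteq> j" using third_index by blast
          obtain u v where uv: "u \<in> U" "f u C = cs C (munit i l)" "v \<in> U" "f v C = cs C (munit l j)"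
            using un[of i l] un[of l j] ij l by blast
          have "f (lbr H u v) C = cs C (munit i j)"
            using f_br[OF C, of u v "munit i l" "munit l j"] uv ij l
            by (simp add: Ucar munit_carrier br_munit)
          then show ?thesis using br_in uv by blast
        qed
      qed
      have "good (derived_series H I k)" for k
        by (induction k) (simp_all add: goodI good_step)
      then have "good {lzero H}" using solv by metis
      \<comment> \<open>Matrices of size 0 or 1 are all scalar.\<close>
      moreover have "?n \<ge> 2"
      proof (rule ccontr)
        assume "\<not> ?thesis"
        then have "(i = 0 \<and> j = 0) \<or> ?n \<le> i \<or> ?n \<le> j" for i j by linarith
        then have "M = (\<lambda>i j. if i = j \<and> i < ?n then M 0 0 else 0)"
          using M(1) unfolding gl_simps by (intro ext) (smt (verit) mem_Collect_eq not_less)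
        then show False using nonscalar by (auto simp: scalar_matrices_def)
      qed
      ultimately have "f (lzero H) C = cs C (munit 0 1)" by (auto simp: good_def)
      then have "cs C (munit 0 1) = cs C (lzero (gl ?n))" using f_zero[OF C] by (simp add: gl_simps)
      then have "(munit 0 1 :: nat \<Rightarrow> nat \<Rightarrow> 'k) \<in> scalar_matrices ?n"
        unfolding cs_def using G.coset_eq_zero_iff[OF munit_carrier[of 0 ?n 1]] \<open>?n \<ge> 2\<close> by simp
      then obtain c where "(munit 0 1 :: nat \<Rightarrow> nat \<Rightarrow> 'k) = (\<lambda>i j. if i = j \<and> i < ?n then c else 0)"
        by (auto simp: scalar_matrices_def)
      from fun_cong[OF fun_cong[OF this], of 0 1] show False by (simp add: munit_apply)
    qed
    have "x = lzero H" if x: "x \<in> I" for x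
    proof -
      have "f x C = f (lzero H) C" for C
      proof (cases "C \<in> J")
        case C: True
        interpret G: lie_algebra_ideal "gl (m C) :: (_, 'k) liealg" "scalar_matrices (m C)"
          by (rule lie_algebra_ideal_pgl)
        obtain M where M: "M \<in> lcar (gl (m C))" "f x C = cs C M" using fC[OF Icar[OF x] C] by blast
        then have "cs C M = cs C (lzero (gl (m C)))"
          using G.coset_eq_zero_iff[OF M(1)] scalar[OF C x M] by (simp add: cs_def)
        then show ?thesis using M f_zero[OF C] by (simp add: gl_simps)
      next
        case False
        have "f x \<in> lcar ?P" "f (lzero H) \<in> lcar ?P"
          using bij Icar[OF x] H.zero_closed by (auto simp: bij_betw_def)
        then show ?thesis using False by (auto simp: lie_prod_def PiE_def extensional_def)
      qed
      then have "f x = f (lzero H)" by blast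
      then show ?thesis
        using bij Icar[OF x] H.zero_closed by (auto simp: bij_betw_def inj_on_def)
    qed
    then show ?thesis using I by (auto simp: lie_ideal_def lie_subspace_def)
  qed
  then show ?thesis using nz by (auto simp: lie_semisimple_def lie_solvable_set_def)
qed

section \<open>The monomial algebra\<close>

locale monomial_quiver =
  fixes Q0 :: "'v set" and Q1 :: "'a set" and s t :: "'a \<Rightarrow> 'v" and Z :: "('v,'a) qpath set"
  assumes quiver: "finite_quiver Q0 Q1 s t"
    and Zmin: "minimal_relations Q0 Q1 s t Z"
    and findim: "finite (Bpaths Q0 Q1 s t Z)"
begin

definition B where "B = Bpaths Q0 Q1 s t Z"

abbreviation "path \<equiv> is_path Q0 Q1 s t"
abbreviation "tgt \<equiv> ptgt t"
abbreviation "arr \<equiv> arrow_path s"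

definition pconcat :: "('v,'a) qpath \<Rightarrow> ('v,'a) qpath \<Rightarrow> ('v,'a) qpath" where
  "pconcat p q = (fst p, snd p @ snd q)"

lemma finite_B: "finite B" and finite_Q1: "finite Q1"
  and endpoints: "a \<in> Q1 \<Longrightarrow> s a \<in> Q0" "a \<in> Q1 \<Longrightarrow> t a \<in> Q0"
  using findim quiver by (auto simp: B_def finite_quiver_def)

section \<open>Paths as lists of arrows and the basis \<open>B\<close>\<close>

lemma tgt_simps [simp]:
  "tgt (v, []) = v" "tgt (v, a # as) = tgt (t a, as)" "tgt (v, as @ bs) = tgt (tgt (v, as), bs)"
  by (auto simp: ptgt_def)

lemma path_Nil [simp]: "path (v, []) \<longleftrightarrow> v \<in> Q0"
  by (simp add: is_path_def)

text \<open>Turns the indexwise definition of a path into a recursion over the list of arrows, on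
  which the later inductions rest.\<close>

lemma path_Cons [simp]: "path (v, a # as) \<longleftrightarrow> a \<in> Q1 \<and> s a = v \<and> path (t a, as)"
proof
  assume p: "path (v, a # as)"
  have "t (as ! i) = s (as ! Suc i)" if "Suc i < length as" for i
    using p that by (auto simp: is_path_def dest!: spec[of _ "Suc i"])
  moreover have "s (hd as) = t a" if "as \<noteq> []"
    using p that by (auto simp: is_path_def hd_conv_nth dest!: spec[of _ 0])
  ultimately show "a \<in> Q1 \<and> s a = v \<and> path (t a, as)"
    using p endpoints by (auto simp: is_path_def)
next
  assume p: "a \<in> Q1 \<and> s a = v \<and> path (t a, as)"
  have "t ((a # as) ! i) = s ((a # as) ! Suc i)" if "Suc i < length (a # as)" for i
    using p that by (cases i) (auto simp: is_path_def hd_conv_nth)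
  then show "path (v, a # as)" using p endpoints by (auto simp: is_path_def)
qed

lemma path_append [simp]: "path (v, as @ bs) \<longleftrightarrow> path (v, as) \<and> path (tgt (v, as), bs)"
proof (induction as arbitrary: v)
  case Nil
  then show ?case by (auto simp: is_path_def)
qed auto

lemma path_fst: "path p \<Longrightarrow> fst p \<in> Q0"
  by (simp add: is_path_def)

lemma path_tgt: "path p \<Longrightarrow> tgt p \<in> Q0"
  using endpoints by (cases "snd p = []") (auto simp: is_path_def ptgt_def subset_iff)

lemma arr_simps [simp]: "fst (arr a) = s a" "snd (arr a) = [a]" "tgt (arr a) = t a"
  by (auto simp: arrow_path_def ptgt_def)

lemma arr_inj [simp]: "arr a = arr b \<longleftrightarrow> a = b"
  by (auto simp: arrow_path_def)

lemma pconcat_simps [simp]: "fst (pconcat p q) = fst p" "snd (pconcat p q) = snd p @ snd q"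
  "tgt p = fst q \<Longrightarrow> tgt (pconcat p q) = tgt q"
  by (cases p, cases q, auto simp: pconcat_def)+

lemma path_pconcat: "\<lbrakk>path p; path q; tgt p = fst q\<rbrakk> \<Longrightarrow> path (pconcat p q)"
  by (cases p, cases q) (auto simp: pconcat_def)

lemma Z_path: "z \<in> Z \<Longrightarrow> path z" and Z_length: "z \<in> Z \<Longrightarrow> 2 \<le> length (snd z)"
  using Zmin by (auto simp: minimal_relations_def plen_def)

lemma Z_nonempty: "z \<in> Z \<Longrightarrow> snd z \<noteq> []"
  using Z_length[of z] by auto

text \<open>Elements of \<open>Z\<close> contain arrows, so being a subpath reduces to
  \<open>sublist\<close> and the source vertices drop out.\<close>

lemma B_iff: "p \<in> B \<longleftrightarrow> path p \<and> (\<forall>z\<in>Z. \<not> sublist (snd z) (snd p))"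
  unfolding B_def Bpaths_def subpath_def using Z_nonempty by auto

lemma B_path: "p \<in> B \<Longrightarrow> path p"
  by (simp add: B_iff)

lemma Z_not_B: "z \<in> Z \<Longrightarrow> z \<notin> B"
  by (auto simp: B_iff)

lemma short_B: "\<lbrakk>path p; length (snd p) \<le> 1\<rbrakk> \<Longrightarrow> p \<in> B"
  unfolding B_iff using Z_length sublist_length_le by fastforce

lemma vertex_B [simp]: "(v, []) \<in> B \<longleftrightarrow> v \<in> Q0"
  using short_B[of "(v, [])"] B_path[of "(v, [])"] by auto

lemma arr_path [simp]: "path (arr a) \<longleftrightarrow> a \<in> Q1"
  using endpoints by (auto simp: arrow_path_def)

lemma arr_B [simp]: "arr a \<in> B \<longleftrightarrow> a \<in> Q1"
  using short_B[of "arr a"] B_path[of "arr a"] by auto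

lemma length_one_arr:
  assumes "path p" "length (snd p) = 1"
  obtains a where "a \<in> Q1" "p = arr a"
proof -
  obtain v a where "p = (v, [a])"
    using assms(2) by (cases p) (auto simp: length_Suc_conv)
  then show ?thesis using assms(1) that[of a] by (auto simp: arrow_path_def)
qed

lemma pconcat_B:
  assumes "pconcat p q \<in> B" "path p" "path q"
  shows "p \<in> B" "q \<in> B"
proof -
  have "sublist xs (snd p) \<or> sublist xs (snd q) \<Longrightarrow> sublist xs (snd p @ snd q)" for xs
    by (auto simp: sublist_append)
  then show "p \<in> B" "q \<in> B" using assms by (simp_all add: B_iff) blast+
qed

text \<open>A sublist forgets the source vertex of \<open>z\<close>. It is recovered because
  \<open>z\<close> contains an arrow, whose source must be the vertex where \<open>u\<close>
  ends.\<close>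

lemma not_B_decomp:
  assumes "path p" "p \<notin> B"
  obtains u z w where "z \<in> Z" "path u" "path w" "tgt u = fst z" "tgt z = fst w" "p = pconcat u (pconcat z w)"
proof -
  obtain z where z: "z \<in> Z" "sublist (snd z) (snd p)" using assms by (auto simp: B_iff)
  then obtain u w where uw: "snd p = u @ snd z @ w" by (auto simp: sublist_def)
  then have p: "p = (fst p, u @ snd z @ w)" by (metis prod.collapse)
  then have P: "path (fst p, u)" "path (tgt (fst p, u), snd z)" "path (tgt (tgt (fst p, u), snd z), w)"
    using assms(1) by (metis path_append)+
  have "tgt (fst p, u) = fst z"
    using P(2) Z_path[OF z(1)] Z_nonempty[OF z(1)] by (cases z; cases "snd z") auto
  then show ?thesis
    using that[of z "(fst p, u)" "(tgt z, w)"] P p z(1) by (auto simp: pconcat_def)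
qed

text \<open>The image in \<open>\<Lambda>\<close> of a path, which is zero for a path outside \<open>B\<close>.\<close>

definition basis :: "('v,'a) qpath \<Rightarrow> ('v,'a) qpath \<Rightarrow> 'k::field" where
  "basis p = (\<lambda>r. if r = p \<and> p \<in> B then 1 else 0)"

abbreviation mul :: "(('v,'a) qpath \<Rightarrow> 'k::field) \<Rightarrow> (('v,'a) qpath \<Rightarrow> 'k) \<Rightarrow> ('v,'a) qpath \<Rightarrow> 'k"
  where "mul \<equiv> lam_mult t B"

lemma basis_apply: "basis p r = (if r = p \<and> p \<in> B then 1 else 0)"
  by (simp add: basis_def)

lemma basis_Lam [simp]: "basis p \<in> Lam B"
  by (auto simp: Lam_def basis_def)

lemma basis_not_B: "p \<notin> B \<Longrightarrow> basis p = (\<lambda>_. 0)"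
  by (auto simp: basis_def)

lemma Lam_zero [simp]: "(\<lambda>_. 0) \<in> Lam B"
  and Lam_add: "\<lbrakk>x \<in> Lam B; y \<in> Lam B\<rbrakk> \<Longrightarrow> (\<lambda>p. x p + y p) \<in> Lam B"
  and Lam_diff: "\<lbrakk>x \<in> Lam B; y \<in> Lam B\<rbrakk> \<Longrightarrow> (\<lambda>p. x p - y p) \<in> Lam B"
  and Lam_smult: "x \<in> Lam B \<Longrightarrow> (\<lambda>p. c * x p) \<in> Lam B"
  and mul_Lam [simp]: "mul x y \<in> Lam B"
  by (auto simp: Lam_def lam_mult_def)

lemma Lam_outside: "\<lbrakk>x \<in> Lam B; p \<notin> B\<rbrakk> \<Longrightarrow> x p = 0"
  unfolding Lam_def by blast

section \<open>Multiplication in \<open>Lam B\<close>\<close>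

definition factorizations where
  "factorizations r = {(p, q). p \<in> B \<and> q \<in> B \<and> tgt p = psrc q \<and> (fst p, snd p @ snd q) = r}"

lemma finite_factorizations: "finite (factorizations r)"
  by (rule finite_subset[of _ "B \<times> B"]) (auto simp: factorizations_def finite_B)

lemma mul_eq: "mul x y r = (if r \<in> B then \<Sum>(p, q)\<in>factorizations r. x p * y q else 0)"
  by (simp add: lam_mult_def factorizations_def)

lemma mul_add_left: "mul (\<lambda>p. x p + y p) z = (\<lambda>p. mul x z p + mul y z p)"
  and mul_add_right: "mul x (\<lambda>p. y p + z p) = (\<lambda>p. mul x y p + mul x z p)"
  and mul_diff_left: "mul (\<lambda>p. x p - y p) z = (\<lambda>p. mul x z p - mul y z p)"
  and mul_diff_right: "mul x (\<lambda>p. y p - z p) = (\<lambda>p. mul x y p - mul x z p)"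
  and mul_smult_left: "mul (\<lambda>p. c * x p) z = (\<lambda>p. c * mul x z p)"
  and mul_smult_right: "mul x (\<lambda>p. c * z p) = (\<lambda>p. c * mul x z p)"
  by (auto intro!: ext simp: mul_eq algebra_simps sum.distrib sum_subtractf sum_distrib_left case_prod_unfold)

lemma mul_zero_left [simp]: "mul (\<lambda>_. 0) z = (\<lambda>_. 0)"
  and mul_zero_right [simp]: "mul z (\<lambda>_. 0) = (\<lambda>_. 0)"
  by (auto intro!: ext simp: mul_eq)

lemma mul_sum_left: "finite A \<Longrightarrow> mul (\<lambda>p. \<Sum>k\<in>A. X k p) z = (\<lambda>p. \<Sum>k\<in>A. mul (X k) z p)"
  by (induction A rule: finite_induct) (simp_all add: mul_add_left)

lemma mul_sum_right: "finite A \<Longrightarrow> mul z (\<lambda>p. \<Sum>k\<in>A. X k p) = (\<lambda>p. \<Sum>k\<in>A. mul z (X k) p)"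
  by (induction A rule: finite_induct) (simp_all add: mul_add_right)

text \<open>A path of length n has n + 1 factorizations, one for each cut, and both pieces lie in
  \<open>B\<close> again; the source of the second piece is dictated by the first.\<close>

lemma mul_split:
  assumes "r \<in> B"
  shows "mul x y r = (\<Sum>i\<le>length (snd r). x (fst r, take i (snd r)) * y (tgt (fst r, take i (snd r)), drop i (snd r)))"
proof -
  have "(\<Sum>(p, q)\<in>factorizations r. x p * y q)
      = (\<Sum>i\<le>length (snd r). x (fst r, take i (snd r)) * y (tgt (fst r, take i (snd r)), drop i (snd r)))"
  proof (rule sum.reindex_bij_witness[where
        i = "\<lambda>i. ((fst r, take i (snd r)), (tgt (fst r, take i (snd r)), drop i (snd r)))" and
        j = "\<lambda>(p, q). length (snd p)"])
    fix i assume "i \<in> {..length (snd r)}"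
    let ?p = "(fst r, take i (snd r))" and ?q = "(tgt (fst r, take i (snd r)), drop i (snd r))"
    have "path (fst r, take i (snd r) @ drop i (snd r))" using assms B_path by simp
    then have "path ?p" "path ?q" by (simp_all only: path_append)
    moreover have "pconcat ?p ?q = r" by (simp add: pconcat_def)
    ultimately show "(?p, ?q) \<in> factorizations r"
      using pconcat_B[of ?p ?q] assms by (auto simp: factorizations_def psrc_def)
  qed (auto simp: factorizations_def psrc_def)
  then show ?thesis using assms by (simp add: mul_eq)
qed

lemma mul_basis:
  assumes "path p" "path q"
  shows "mul (basis p) (basis q) = (if tgt p = fst q then basis (pconcat p q) else (\<lambda>_. 0))"
proof
  fix r
  show "mul (basis p) (basis q) r = (if tgt p = fst q then basis (pconcat p q) else (\<lambda>_. 0)) r"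
  proof (cases "r \<in> B")
    case True
    have "mul (basis p) (basis q) r = (\<Sum>x\<in>factorizations r. if x = (p, q) then 1 else 0)"
      using True by (auto simp: mul_eq basis_apply factorizations_def intro!: sum.cong)
    also have "\<dots> = (if (p, q) \<in> factorizations r then 1 else 0)"
      by (simp add: finite_factorizations)
    also have "\<dots> = (if tgt p = fst q then basis (pconcat p q) else (\<lambda>_. 0)) r"
      using True pconcat_B[OF _ assms] by (auto simp: factorizations_def psrc_def basis_apply pconcat_def)
    finally show ?thesis .
  qed (auto simp: mul_eq basis_apply)
qed

lemma mul_vertex_left:
  assumes "x \<in> Lam B"
  shows "mul (basis (v, [])) x r = (if fst r = v then x r else 0)"
proof (cases "r \<in> B")
  case True
  then have "fst r \<in> Q0" using B_path path_fst by blast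
  have "mul (basis (v, [])) x r = (\<Sum>i\<le>length (snd r). if i = 0 then (if fst r = v then x r else 0) else 0)"
    unfolding mul_split[OF True] using \<open>fst r \<in> Q0\<close> by (intro sum.cong) (auto simp: basis_apply)
  then show ?thesis by simp
qed (use assms in \<open>simp add: mul_eq Lam_outside\<close>)

lemma mul_vertex_right:
  assumes "x \<in> Lam B"
  shows "mul x (basis (v, [])) r = (if tgt r = v then x r else 0)"
proof (cases "r \<in> B")
  case True
  then have "tgt r \<in> Q0" using B_path path_tgt by blast
  have "mul x (basis (v, [])) r
      = (\<Sum>i\<le>length (snd r). if i = length (snd r) then (if tgt r = v then x r else 0) else 0)"
    unfolding mul_split[OF True] using \<open>tgt r \<in> Q0\<close> by (intro sum.cong) (auto simp: basis_apply)
  then show ?thesis by simp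
qed (use assms in \<open>simp add: mul_eq Lam_outside\<close>)

text \<open>Linearity is asked on \<open>Lam B\<close> only: derivations are extended by 0 outside
  and need not be linear on all functions.\<close>

definition lin :: "((('v,'a) qpath \<Rightarrow> 'k::field) \<Rightarrow> ('v,'a) qpath \<Rightarrow> 'k) \<Rightarrow> bool" where
  "lin F \<longleftrightarrow> (\<forall>x\<in>Lam B. \<forall>y\<in>Lam B. F (\<lambda>p. x p + y p) = (\<lambda>p. F x p + F y p))
    \<and> (\<forall>c. \<forall>x\<in>Lam B. F (\<lambda>p. c * x p) = (\<lambda>p. c * F x p))"

lemma lin_add: "\<lbrakk>lin F; x \<in> Lam B; y \<in> Lam B\<rbrakk> \<Longrightarrow> F (\<lambda>p. x p + y p) = (\<lambda>p. F x p + F y p)"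
  and lin_smult: "\<lbrakk>lin F; x \<in> Lam B\<rbrakk> \<Longrightarrow> F (\<lambda>p. c * x p) = (\<lambda>p. c * F x p)"
  by (simp_all add: lin_def)

lemma lin_zero: "lin F \<Longrightarrow> F (\<lambda>_. 0) = (\<lambda>_. 0)"
  using lin_smult[of F "\<lambda>_. 0" 0] by simp

lemma Lam_sum: "\<lbrakk>finite A; \<And>k. k \<in> A \<Longrightarrow> X k \<in> Lam B\<rbrakk> \<Longrightarrow> (\<lambda>r. \<Sum>k\<in>A. X k r) \<in> Lam B"
  by (auto simp: Lam_def)

lemma lin_expand:
  assumes F: "lin F" and x: "x \<in> Lam B"
  shows "F x = (\<lambda>r. \<Sum>p\<in>B. x p * F (basis p) r)"
proof -
  have *: "F (\<lambda>r. \<Sum>p\<in>A. x p * basis p r) = (\<lambda>r. \<Sum>p\<in>A. x p * F (basis p) r)" if "finite A" for A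
    using that
  proof (induction A rule: finite_induct)
    case empty
    then show ?case using lin_zero[OF F] by simp
  next
    case (insert p A)
    have "(\<lambda>r. x p * basis p r) \<in> Lam B" "(\<lambda>r. \<Sum>p\<in>A. x p * basis p r) \<in> Lam B"
      using insert(1) by (auto intro!: Lam_sum Lam_smult)
    then have "F (\<lambda>r. x p * basis p r + (\<Sum>p\<in>A. x p * basis p r))
        = (\<lambda>r. F (\<lambda>r. x p * basis p r) r + F (\<lambda>r. \<Sum>p\<in>A. x p * basis p r) r)"
      by (rule lin_add[OF F])
    moreover have "F (\<lambda>r. x p * basis p r) = (\<lambda>r. x p * F (basis p) r)"
      by (rule lin_smult[OF F basis_Lam])
    ultimately show ?case using insert by simp
  qed
  have "x = (\<lambda>r. \<Sum>p\<in>B. x p * basis p r)"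
  proof
    fix r
    have "(\<Sum>p\<in>B. x p * basis p r) = (\<Sum>p\<in>B. if p = r then x p else 0)"
      by (intro sum.cong) (auto simp: basis_apply)
    then show "x r = (\<Sum>p\<in>B. x p * basis p r)" using finite_B Lam_outside[OF x] by auto
  qed
  then have "F x = F (\<lambda>r. \<Sum>p\<in>B. x p * basis p r)" by (rule arg_cong)
  also have "\<dots> = (\<lambda>r. \<Sum>p\<in>B. x p * F (basis p) r)" by (rule *[OF finite_B])
  finally show ?thesis .
qed

lemma lin_ext:
  assumes "lin F" "lin G" "\<And>p. p \<in> B \<Longrightarrow> F (basis p) = G (basis p)" "x \<in> Lam B"
  shows "F x = G x"
  unfolding lin_expand[OF assms(1,4)] lin_expand[OF assms(2,4)]
  by (intro ext sum.cong refl) (simp only: assms(3))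

lemma lin_mul_left: "lin (\<lambda>x. mul x z)"
  and lin_mul_right: "lin (\<lambda>x. mul z x)"
  and lin_mul_mul: "lin (\<lambda>x. mul (mul x y) z)" "lin (\<lambda>x. mul (mul y x) z)"
    "lin (\<lambda>x. mul y (mul x z))" "lin (\<lambda>x. mul y (mul z x))"
  by (simp_all add: lin_def mul_add_left mul_smult_left mul_add_right mul_smult_right)

text \<open>Linearity in each factor reduces the claim to three paths, where both sides are the
  image of the concatenation, or zero if some ends do not meet.\<close>

lemma mul_assoc:
  assumes "x \<in> Lam B" "y \<in> Lam B" "z \<in> Lam B"
  shows "mul (mul x y) z = mul x (mul y z)"
proof (rule lin_ext[OF lin_mul_mul(1) lin_mul_left _ assms(1)])
  fix p assume p: "p \<in> B"
  show "mul (mul (basis p) y) z = mul (basis p) (mul y z)"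
  proof (rule lin_ext[OF lin_mul_mul(2,3) _ assms(2)])
    fix q assume q: "q \<in> B"
    show "mul (mul (basis p) (basis q)) z = mul (basis p) (mul (basis q) z)"
    proof (rule lin_ext[OF lin_mul_right lin_mul_mul(4) _ assms(3)])
      fix r assume r: "r \<in> B"
      have "path p" "path q" "path r" using p q r B_path by auto
      moreover have "pconcat (pconcat p q) r = pconcat p (pconcat q r)" by (simp add: pconcat_def)
      ultimately show "mul (mul (basis p) (basis q)) (basis r) = mul (basis p) (mul (basis q) (basis r))"
        by (cases "tgt p = fst q"; cases "tgt q = fst r") (simp_all add: mul_basis path_pconcat)
    qed
  qed
qed

end

section \<open>Derivations\<close>

context monomial_quiver begin

abbreviation Der :: "((('v,'a) qpath \<Rightarrow> 'k::field) \<Rightarrow> ('v,'a) qpath \<Rightarrow> 'k) set" where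
  "Der \<equiv> derivations t B"

lemma der_Lam: "\<lbrakk>D \<in> Der; x \<in> Lam B\<rbrakk> \<Longrightarrow> D x \<in> Lam B"
  and der_outside: "\<lbrakk>D \<in> Der; x \<notin> Lam B\<rbrakk> \<Longrightarrow> D x = (\<lambda>_. 0)"
  and der_lin: "D \<in> Der \<Longrightarrow> lin D"
  and der_mul: "\<lbrakk>D \<in> Der; x \<in> Lam B; y \<in> Lam B\<rbrakk>
    \<Longrightarrow> D (mul x y) = (\<lambda>p. mul (D x) y p + mul x (D y) p)"
  by (simp_all add: derivations_def lin_def)

lemma derI:
  assumes "\<And>x. x \<in> Lam B \<Longrightarrow> D x \<in> Lam B" "\<And>x. x \<notin> Lam B \<Longrightarrow> D x = (\<lambda>_. 0)" "lin D"
    "\<And>x y. \<lbrakk>x \<in> Lam B; y \<in> Lam B\<rbrakk> \<Longrightarrow> D (mul x y) = (\<lambda>p. mul (D x) y p + mul x (D y) p)"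
  shows "D \<in> Der"
  using assms by (simp add: derivations_def lin_def)

lemma lin_diff:
  assumes "lin F" "x \<in> Lam B" "y \<in> Lam B"
  shows "F (\<lambda>p. x p - y p) = (\<lambda>p. F x p - F y p)"
  using lin_add[OF assms(1,2) Lam_smult[OF assms(3), of "-1"]] lin_smult[OF assms(1,3), of "-1"]
  by simp

lemma der_any_Lam: "D \<in> Der \<Longrightarrow> D x \<in> Lam B"
  by (cases "x \<in> Lam B") (simp_all add: der_Lam der_outside)

lemma der_add: "\<lbrakk>D \<in> Der; E \<in> Der\<rbrakk> \<Longrightarrow> (\<lambda>x p. D x p + E x p) \<in> Der"
  by (rule derI)
    (simp_all add: der_any_Lam der_outside Lam_add der_mul lin_def lin_add[OF der_lin]
      lin_smult[OF der_lin] mul_add_left mul_add_right algebra_simps)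

lemma der_smult: "D \<in> Der \<Longrightarrow> (\<lambda>x p. c * D x p) \<in> Der"
  by (rule derI)
    (simp_all add: der_any_Lam der_outside Lam_smult der_mul lin_def lin_add[OF der_lin]
      lin_smult[OF der_lin] mul_smult_left mul_smult_right algebra_simps)

lemma der_zero: "(\<lambda>x p. 0) \<in> Der"
  by (rule derI) (simp_all add: lin_def)

lemma der_diff: "\<lbrakk>D \<in> Der; E \<in> Der\<rbrakk> \<Longrightarrow> (\<lambda>x p. D x p - E x p) \<in> Der"
  using der_add[OF _ der_smult[of E "-1"], of D] by simp

lemma der_br:
  fixes D E :: "(('v,'a) qpath \<Rightarrow> 'k::field) \<Rightarrow> ('v,'a) qpath \<Rightarrow> 'k"
  assumes D: "D \<in> Der" and E: "E \<in> Der"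
  shows "(\<lambda>x p. D (E x) p - E (D x) p) \<in> Der"
proof (rule derI)
  fix x :: "('v,'a) qpath \<Rightarrow> 'k"
  show "(\<lambda>p. D (E x) p - E (D x) p) \<in> Lam B"
    using D E by (simp add: Lam_diff der_any_Lam)
  show "(\<lambda>p. D (E x) p - E (D x) p) = (\<lambda>_. 0)" if "x \<notin> Lam B"
    using that by (simp add: der_outside[OF D] der_outside[OF E] lin_zero der_lin[OF D] der_lin[OF E])
  show "lin (\<lambda>x p. D (E x) p - E (D x) p)"
    unfolding lin_def
    by (simp add: lin_add[OF der_lin[OF D]] lin_add[OF der_lin[OF E]] lin_smult[OF der_lin[OF D]]
        lin_smult[OF der_lin[OF E]] der_Lam[OF D] der_Lam[OF E] algebra_simps)
  fix y :: "('v,'a) qpath \<Rightarrow> 'k" assume x: "x \<in> Lam B" and y: "y \<in> Lam B"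
  note simps = der_mul[OF D] der_mul[OF E] lin_add[OF der_lin[OF D]] lin_add[OF der_lin[OF E]]
    der_Lam[OF D] der_Lam[OF E] mul_Lam x y mul_diff_left mul_diff_right
  show "(\<lambda>p. D (E (mul x y)) p - E (D (mul x y)) p)
      = (\<lambda>p. mul (\<lambda>p. D (E x) p - E (D x) p) y p + mul x (\<lambda>p. D (E y) p - E (D y) p) p)"
    by (simp add: simps algebra_simps)
qed

section \<open>The Lie algebra \<open>Der\<close> and its ideal \<open>Inn\<close>\<close>

lemma Der_lie_simps:
  "lcar (Der_lie t B) = Der" "lzero (Der_lie t B) = (\<lambda>x p. 0)"
  "ladd (Der_lie t B) D E = (\<lambda>x p. D x p + E x p)"
  "lsmult (Der_lie t B) c D = (\<lambda>x p. c * D x p)"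
  "lbr (Der_lie t B) D E = (\<lambda>x p. D (E x) p - E (D x) p)"
  by (simp_all add: Der_lie_def)

lemma lie_algebra_Der: "lie_algebra (Der_lie t B)"
proof (unfold_locales, unfold Der_lie_simps, goal_cases)
  case (12 D E F)
  then show ?case by (simp add: lin_add[OF der_lin] der_any_Lam algebra_simps)
next
  case (13 D E F)
  then show ?case by (simp add: lin_add[OF der_lin] der_any_Lam algebra_simps)
qed (auto simp: der_zero der_add der_smult der_br algebra_simps)

definition ad :: "(('v,'a) qpath \<Rightarrow> 'k::field) \<Rightarrow> (('v,'a) qpath \<Rightarrow> 'k) \<Rightarrow> ('v,'a) qpath \<Rightarrow> 'k" where
  "ad y = (\<lambda>x. if x \<in> Lam B then (\<lambda>p. mul y x p - mul x y p) else (\<lambda>_. 0))"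

abbreviation Inn :: "((('v,'a) qpath \<Rightarrow> 'k::field) \<Rightarrow> ('v,'a) qpath \<Rightarrow> 'k) set" where
  "Inn \<equiv> inner_derivations t B"

lemma Inn_eq: "Inn = ad ` Lam B"
  by (auto simp: inner_derivations_def ad_def)

lemma ad_der: "y \<in> Lam B \<Longrightarrow> ad y \<in> Der"
  by (rule derI)
    (auto simp: ad_def Lam_diff lin_def Lam_add Lam_smult mul_add_left mul_add_right mul_smult_left
      mul_smult_right mul_diff_left mul_diff_right mul_assoc algebra_simps)

lemma ad_add: "ad (\<lambda>p. y p + z p) = (\<lambda>x p. ad y x p + ad z x p)"
  and ad_smult: "ad (\<lambda>p. c * y p) = (\<lambda>x p. c * ad y x p)"
  and ad_zero: "ad (\<lambda>_. 0) = (\<lambda>x p. 0)"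
  by (auto intro!: ext simp: ad_def mul_add_left mul_add_right mul_smult_left mul_smult_right algebra_simps)

lemma br_ad:
  assumes D: "D \<in> Der" and y: "y \<in> Lam B"
  shows "(\<lambda>x p. D (ad y x) p - ad y (D x) p) = ad (D y)"
proof (intro ext)
  fix x p
  show "D (ad y x) p - ad y (D x) p = ad (D y) x p"
  proof (cases "x \<in> Lam B")
    case True
    then show ?thesis
      using D y by (simp add: ad_def lin_diff[OF der_lin] der_mul der_Lam algebra_simps)
  next
    case False
    then show ?thesis
      using D y by (simp add: ad_def lin_zero[OF der_lin] der_outside der_Lam)
  qed
qed

lemma lie_ideal_Inn: "lie_ideal (Der_lie t B :: (_, 'k::field) liealg) Inn"
  unfolding lie_ideal_def lie_subspace_def Der_lie_simps
proof (intro conjI ballI allI)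
  show "Inn \<subseteq> Der" using ad_der by (auto simp: Inn_eq)
  show "(\<lambda>x p. 0) \<in> Inn" unfolding Inn_eq ad_zero[symmetric] by simp
  fix D E :: "(('v,'a) qpath \<Rightarrow> 'k) \<Rightarrow> ('v,'a) qpath \<Rightarrow> 'k" assume "D \<in> Inn" "E \<in> Inn"
  then obtain y z where "y \<in> Lam B" "D = ad y" "z \<in> Lam B" "E = ad z" by (auto simp: Inn_eq)
  then show "(\<lambda>x p. D x p + E x p) \<in> Inn"
    using ad_add[of y z, symmetric] Lam_add[of y z] by (simp add: Inn_eq)
next
  fix c and D :: "(('v,'a) qpath \<Rightarrow> 'k) \<Rightarrow> ('v,'a) qpath \<Rightarrow> 'k" assume "D \<in> Inn"
  then obtain y where "y \<in> Lam B" "D = ad y" by (auto simp: Inn_eq)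
  then show "(\<lambda>x p. c * D x p) \<in> Inn"
    using ad_smult[of c y, symmetric] Lam_smult[of y c] by (simp add: Inn_eq)
next
  fix D E :: "(('v,'a) qpath \<Rightarrow> 'k) \<Rightarrow> ('v,'a) qpath \<Rightarrow> 'k" assume D: "D \<in> Der" and "E \<in> Inn"
  then obtain y where "y \<in> Lam B" "E = ad y" by (auto simp: Inn_eq)
  then show "(\<lambda>x p. D (E x) p - E (D x) p) \<in> Inn"
    using br_ad[OF D] der_Lam[OF D] by (simp add: Inn_eq)
qed

lemma lie_algebra_ideal_HH1: "lie_algebra_ideal (Der_lie t B) Inn"
  by (intro lie_algebra_ideal.intro lie_algebra_ideal_axioms.intro lie_algebra_Der lie_ideal_Inn)

section \<open>Normalizing a derivation at the vertices\<close>

lemma vertex_relation: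
  fixes D :: "(('v,'a) qpath \<Rightarrow> 'k::field) \<Rightarrow> ('v,'a) qpath \<Rightarrow> 'k"
  assumes D: "D \<in> Der" and v: "v \<in> Q0" "w \<in> Q0"
  shows "(if tgt r = w then D (basis (v, [])) r else 0) + (if fst r = v then D (basis (w, [])) r else 0)
    = (if v = w then D (basis (v, [])) r else 0)"
proof -
  have "D (mul (basis (v, [])) (basis (w, []))) r
      = mul (D (basis (v, []))) (basis (w, [])) r + mul (basis (v, [])) (D (basis (w, []))) r"
    using der_mul[OF D] by simp
  moreover have "mul (basis (v, [])) (basis (w, []))
      = (if v = w then basis (v, []) else (\<lambda>_. 0 :: 'k))"
    using v by (simp add: mul_basis pconcat_def)
  ultimately have "D (if v = w then basis (v, []) else (\<lambda>_. 0)) r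
      = mul (D (basis (v, []))) (basis (w, [])) r + mul (basis (v, [])) (D (basis (w, []))) r"
    by simp
  moreover have "D (if v = w then basis (v, []) else (\<lambda>_. 0)) r = (if v = w then D (basis (v, [])) r else 0)"
    using lin_zero[OF der_lin[OF D]] by simp
  ultimately show ?thesis
    by (simp only: mul_vertex_left[OF der_any_Lam[OF D]] mul_vertex_right[OF der_any_Lam[OF D]])
qed

definition normalized :: "((('v,'a) qpath \<Rightarrow> 'k::field) \<Rightarrow> ('v,'a) qpath \<Rightarrow> 'k) \<Rightarrow> bool" where
  "normalized D \<longleftrightarrow> D \<in> Der \<and> (\<forall>v\<in>Q0. D (basis (v, [])) = (\<lambda>_. 0))"

text \<open>The vertices are orthogonal idempotents e_v. Applying \<open>D\<close> to their products
  shows that the coefficient of \<open>r\<close> in D(e_v) vanishes unless \<open>v\<close> is one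
  of two different ends of \<open>r\<close>, and that the coefficients for these two ends are
  opposite. Such values are those of an inner derivation.\<close>

lemma normalize:
  assumes D: "D \<in> Der"
  obtains D0 y where "normalized D0" "y \<in> Lam B" "D = (\<lambda>x p. D0 x p + ad y x p)"
proof -
  \<comment> \<open>[y, e_w] takes the coefficients of \<open>y\<close> with sign +1 at paths ending
    in \<open>w\<close> and -1 at paths starting in \<open>w\<close>, so \<open>y\<close> has to
    record the value of \<open>D\<close> at the terminus.\<close>
  define y where "y = (\<lambda>r. if r \<in> B then D (basis (tgt r, [])) r else 0)"
  have y: "y \<in> Lam B" by (simp add: Lam_def y_def)
  have "D (basis (w, [])) r = ad y (basis (w, [])) r" if w: "w \<in> Q0" for w r
  proof (cases "r \<in> B")
    case True
    then have "tgt r \<in> Q0" using B_path path_tgt by blast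
    have "ad y (basis (w, [])) r = (if tgt r = w then y r else 0) - (if fst r = w then y r else 0)"
      by (simp add: ad_def mul_vertex_left[OF y] mul_vertex_right[OF y])
    moreover have "y r = D (basis (tgt r, [])) r" using True by (simp add: y_def)
    moreover have "D (basis (w, [])) r
        = (if w = tgt r then D (basis (w, [])) r else 0) - (if fst r = w then D (basis (tgt r, [])) r else 0)"
      using vertex_relation[OF D w \<open>tgt r \<in> Q0\<close>, of r] by (simp only: eq_diff_eq refl if_True)
    ultimately show ?thesis by (cases "w = tgt r") auto
  next
    case False
    then show ?thesis
      using Lam_outside[OF der_any_Lam[OF D]] Lam_outside[OF der_any_Lam[OF ad_der[OF y]]] by metis
  qed
  then have "normalized (\<lambda>x p. D x p - ad y x p)"
    unfolding normalized_def using der_diff[OF D ad_der[OF y]] by simp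
  then show ?thesis using that y by fastforce
qed

section \<open>Derivations prescribed on the arrows\<close>

definition replace_at :: "('v,'a) qpath \<Rightarrow> nat \<Rightarrow> ('v,'a) qpath \<Rightarrow> ('v,'a) qpath" where
  "replace_at p i \<gamma> = (fst p, take i (snd p) @ snd \<gamma> @ drop (Suc i) (snd p))"

definition par_supp :: "('a \<times> ('v,'a) qpath \<Rightarrow> 'k::field) \<Rightarrow> bool" where
  "par_supp f \<longleftrightarrow> (\<forall>a \<gamma>. f (a, \<gamma>) \<noteq> 0 \<longrightarrow> a \<in> Q1 \<and> \<gamma> \<in> B \<and> fst \<gamma> = s a \<and> tgt \<gamma> = t a)"

lemma par_suppD:
  assumes "par_supp f" "f (a, \<gamma>) \<noteq> 0"
  shows "a \<in> Q1" "\<gamma> \<in> B" "fst \<gamma> = s a" "tgt \<gamma> = t a"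
  using assms unfolding par_supp_def by blast+

text \<open>The derivation of the path algebra with values \<open>f (a, -)\<close> on the arrows \<open>a\<close>, evaluated at a
  path and projected to \<open>\<Lambda>\<close>.\<close>

definition path_deriv :: "('a \<times> ('v,'a) qpath \<Rightarrow> 'k::field) \<Rightarrow> ('v,'a) qpath \<Rightarrow> ('v,'a) qpath \<Rightarrow> 'k" where
  "path_deriv f p = (\<lambda>r. \<Sum>i<length (snd p). \<Sum>\<gamma>\<in>B. f (snd p ! i, \<gamma>) * basis (replace_at p i \<gamma>) r)"

lemma path_deriv_Lam: "path_deriv f p \<in> Lam B"
  unfolding path_deriv_def by (intro Lam_sum Lam_smult basis_Lam finite_B finite_lessThan)

lemma replace_at_path:
  assumes p: "path p" "i < length (snd p)"
    and g: "path \<gamma>" "fst \<gamma> = s (snd p ! i)" "tgt \<gamma> = t (snd p ! i)"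
  shows "path (replace_at p i \<gamma>)" "tgt (replace_at p i \<gamma>) = tgt p"
proof -
  let ?a = "snd p ! i" and ?u = "take i (snd p)" and ?w = "drop (Suc i) (snd p)"
  have p': "p = (fst p, ?u @ ?a # ?w)" using id_take_nth_drop[OF p(2)] by simp
  then have P: "path (fst p, ?u)" "s ?a = tgt (fst p, ?u)" "path (t ?a, ?w)"
    using p(1) by (metis path_append path_Cons)+
  have T: "tgt p = tgt (t ?a, ?w)" using p' by (metis tgt_simps(2,3))
  have g': "path (s ?a, snd \<gamma>)" "tgt (s ?a, snd \<gamma>) = t ?a" using g by (metis prod.collapse)+
  show "path (replace_at p i \<gamma>)" "tgt (replace_at p i \<gamma>) = tgt p"
    unfolding replace_at_def using P g' T by simp_all
qed

lemma replace_at_pconcat_left: "i < length (snd p) \<Longrightarrow> pconcat (replace_at p i \<gamma>) q = replace_at (pconcat p q) i \<gamma>"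
  by (simp add: replace_at_def pconcat_def)

lemma replace_at_pconcat_right: "pconcat p (replace_at q i \<gamma>) = replace_at (pconcat p q) (length (snd p) + i) \<gamma>"
  by (simp add: replace_at_def pconcat_def)

lemma path_deriv_mul_right:
  assumes f: "par_supp f" and p: "path p" and q: "path q"
  shows "mul (path_deriv f p) (basis q) = (\<lambda>r. \<Sum>i<length (snd p). \<Sum>\<gamma>\<in>B. f (snd p ! i, \<gamma>)
      * (if tgt p = fst q then basis (pconcat (replace_at p i \<gamma>) q) r else 0))"
proof -
  have "mul (\<lambda>r. f (snd p ! i, \<gamma>) * basis (replace_at p i \<gamma>) r) (basis q)
      = (\<lambda>r. f (snd p ! i, \<gamma>) * (if tgt p = fst q then basis (pconcat (replace_at p i \<gamma>) q) r else 0))"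
    if "i < length (snd p)" for i \<gamma>
  proof (cases "f (snd p ! i, \<gamma>) = 0")
    case False
    then have "path \<gamma>" "fst \<gamma> = s (snd p ! i)" "tgt \<gamma> = t (snd p ! i)"
      using f B_path unfolding par_supp_def by blast+
    from replace_at_path[OF p that this] show ?thesis
      by (simp add: mul_smult_left mul_basis q)
  qed simp
  then show ?thesis
    unfolding path_deriv_def by (simp add: mul_sum_left finite_B)
qed

lemma path_deriv_mul_left:
  assumes f: "par_supp f" and p: "path p" and q: "path q"
  shows "mul (basis p) (path_deriv f q) = (\<lambda>r. \<Sum>i<length (snd q). \<Sum>\<gamma>\<in>B. f (snd q ! i, \<gamma>)
      * (if tgt p = fst q then basis (pconcat p (replace_at q i \<gamma>)) r else 0))"
proof -
  have "mul (basis p) (\<lambda>r. f (snd q ! i, \<gamma>) * basis (replace_at q i \<gamma>) r)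
      = (\<lambda>r. f (snd q ! i, \<gamma>) * (if tgt p = fst q then basis (pconcat p (replace_at q i \<gamma>)) r else 0))"
    if "i < length (snd q)" for i \<gamma>
  proof (cases "f (snd q ! i, \<gamma>) = 0")
    case False
    then have "path \<gamma>" "fst \<gamma> = s (snd q ! i)" "tgt \<gamma> = t (snd q ! i)"
      using f B_path unfolding par_supp_def by blast+
    from replace_at_path[OF q that this] show ?thesis
      by (simp add: mul_smult_right mul_basis p) (simp add: replace_at_def)
  qed simp
  then show ?thesis
    unfolding path_deriv_def by (simp add: mul_sum_right finite_B)
qed

lemma sum_lessThan_add: "(\<Sum>i<m + n. g i) = (\<Sum>i<m. g i) + (\<Sum>i<n. g (m + i :: nat) :: 'k::field)"
  by (induction n) (simp_all add: add.assoc)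

text \<open>The Leibniz rule for composable paths inside or outside \<open>B\<close>. Relations can
  thus be treated in the path algebra before passing to the quotient.\<close>

lemma path_deriv_pconcat:
  assumes "par_supp f" "path p" "path q" "tgt p = fst q"
  shows "path_deriv f (pconcat p q) = (\<lambda>r. mul (path_deriv f p) (basis q) r + mul (basis p) (path_deriv f q) r)"
  unfolding path_deriv_mul_right[OF assms(1-3)] path_deriv_mul_left[OF assms(1-3)]
  by (simp add: path_deriv_def assms(4) sum_lessThan_add nth_append replace_at_pconcat_left replace_at_pconcat_right)

text \<open>Expand \<open>p = u z w\<close> by the Leibniz rule: each term contains the image of a
  path through \<open>z\<close>, which is zero, or the derivative of \<open>z\<close>. So vanishing
  on \<open>Z\<close> lets the derivation descend to the quotient.\<close>

lemma path_deriv_not_B: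
  assumes f: "par_supp f" and z: "\<And>z. z \<in> Z \<Longrightarrow> path_deriv f z = (\<lambda>_. 0)" and p: "path p" "p \<notin> B"
  shows "path_deriv f p = (\<lambda>_. 0)"
proof -
  obtain u z w where uzw: "z \<in> Z" "path u" "path w" "tgt u = fst z" "tgt z = fst w" "p = pconcat u (pconcat z w)"
    using not_B_decomp[OF p] .
  have "pconcat z w \<notin> B" using pconcat_B(1) Z_not_B uzw Z_path by blast
  then show ?thesis
    using uzw z[OF uzw(1)] Z_path[OF uzw(1)] Z_not_B[OF uzw(1)]
    by (simp add: path_deriv_pconcat[OF f] path_pconcat basis_not_B)
qed

definition mkder :: "('a \<times> ('v,'a) qpath \<Rightarrow> 'k::field) \<Rightarrow> (('v,'a) qpath \<Rightarrow> 'k) \<Rightarrow> ('v,'a) qpath \<Rightarrow> 'k" where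
  "mkder f x = (if x \<in> Lam B then (\<lambda>r. \<Sum>p\<in>B. x p * path_deriv f p r) else (\<lambda>_. 0))"

lemma mkder_basis: "p \<in> B \<Longrightarrow> mkder f (basis p) = path_deriv f p"
proof
  fix r assume "p \<in> B"
  have "(\<Sum>q\<in>B. basis p q * path_deriv f q r) = (\<Sum>q\<in>B. if q = p then path_deriv f q r else 0)"
    using \<open>p \<in> B\<close> by (intro sum.cong) (auto simp: basis_apply)
  then show "mkder f (basis p) r = path_deriv f p r"
    using \<open>p \<in> B\<close> finite_B by (simp add: mkder_def)
qed

lemma mkder_lin: "lin (mkder f)"
  by (auto simp: lin_def mkder_def Lam_add Lam_smult sum.distrib sum_distrib_left algebra_simps)

text \<open>The Leibniz rule on paths is extended bilinearly. The product of two paths of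
  \<open>B\<close> may leave \<open>B\<close>; there the left side is zero, and the right side is
  zero by \<open>path_deriv_not_B\<close>.\<close>

lemma mkder_der:
  fixes f :: "'a \<times> ('v,'a) qpath \<Rightarrow> 'k::field"
  assumes f: "par_supp f" and z: "\<And>z. z \<in> Z \<Longrightarrow> path_deriv f z = (\<lambda>_. 0)"
  shows "normalized (mkder f)"
  unfolding normalized_def
proof (intro conjI ballI)
  note l = lin_add[OF mkder_lin] lin_smult[OF mkder_lin] mul_add_left mul_add_right mul_smult_left
    mul_smult_right
  have path: "mkder f (basis p) = path_deriv f p" if "path p" for p
    using that by (cases "p \<in> B") (simp_all add: mkder_basis path_deriv_not_B[OF f z] basis_not_B lin_zero[OF mkder_lin])
  show "mkder f \<in> Der"
  proof (rule derI)
    fix x :: "('v,'a) qpath \<Rightarrow> 'k"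
    show "mkder f x \<in> Lam B" if "x \<in> Lam B"
      unfolding mkder_def using that path_deriv_Lam[of f] finite_B by (auto intro!: Lam_sum Lam_smult)
    show "mkder f x = (\<lambda>_. 0)" if "x \<notin> Lam B"
      using that by (simp add: mkder_def)
    show "lin (mkder f)" by (rule mkder_lin)
    fix y :: "('v,'a) qpath \<Rightarrow> 'k" assume x: "x \<in> Lam B" and y: "y \<in> Lam B"
    show "mkder f (mul x y) = (\<lambda>p. mul (mkder f x) y p + mul x (mkder f y) p)"
    proof (rule lin_ext[of "\<lambda>x. mkder f (mul x y)" "\<lambda>x p. mul (mkder f x) y p + mul x (mkder f y) p"])
      fix p assume p: "p \<in> B"
      show "mkder f (mul (basis p) y) = (\<lambda>r. mul (mkder f (basis p)) y r + mul (basis p) (mkder f y) r)"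
      proof (rule lin_ext[of "\<lambda>y. mkder f (mul (basis p) y)"
            "\<lambda>y r. mul (mkder f (basis p)) y r + mul (basis p) (mkder f y) r"])
        fix q assume q: "q \<in> B"
        have P: "path p" "path q" using p q B_path by auto
        show "mkder f (mul (basis p) (basis q))
            = (\<lambda>r. mul (mkder f (basis p)) (basis q) r + mul (basis p) (mkder f (basis q)) r)"
        proof (cases "tgt p = fst q")
          case True
          then show ?thesis using P by (simp add: mul_basis path path_pconcat path_deriv_pconcat[OF f])
        next
          case False
          then show ?thesis
            using P by (simp add: mul_basis path path_deriv_mul_left[OF f] path_deriv_mul_right[OF f] lin_zero[OF mkder_lin])
        qed
      qed (auto simp: lin_def l algebra_simps y)
    qed (auto simp: lin_def l algebra_simps x)
  qed
  show "mkder f (basis (v, [])) = (\<lambda>_. 0)" if "v \<in> Q0" for v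
    using that by (simp add: mkder_basis path_deriv_def)
qed

lemma path_deriv_arr:
  assumes f: "par_supp f"
  shows "path_deriv f (arr a) = (\<lambda>r. f (a, r))"
proof
  fix r
  have replace_at: "f (a, \<gamma>) * basis (replace_at (arr a) 0 \<gamma>) r = (if \<gamma> = r then f (a, r) else 0)" for \<gamma>
  proof (cases "f (a, \<gamma>) = 0")
    case False
    then have "\<gamma> \<in> B" "fst \<gamma> = s a" using par_suppD[OF f] by blast+
    then show ?thesis by (cases \<gamma>) (auto simp: replace_at_def basis_apply)
  qed auto
  have "path_deriv f (arr a) r = (\<Sum>\<gamma>\<in>B. if \<gamma> = r then f (a, r) else 0)"
    by (simp add: path_deriv_def replace_at)
  then show "path_deriv f (arr a) r = f (a, r)"
    using par_suppD(2)[OF f, of a r] finite_B by auto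
qed

definition arrow_vals :: "((('v,'a) qpath \<Rightarrow> 'k::field) \<Rightarrow> ('v,'a) qpath \<Rightarrow> 'k) \<Rightarrow> 'a \<times> ('v,'a) qpath \<Rightarrow> 'k" where
  "arrow_vals D = (\<lambda>(a, \<gamma>). if a \<in> Q1 then D (basis (arr a)) \<gamma> else 0)"

text \<open>An arrow is unchanged by multiplication with its source on the left and its terminus on
  the right. As \<open>D\<close> kills both vertices, the image of the arrow is unchanged too, hence
  supported on parallel paths.\<close>

lemma arrow_vals_par:
  fixes D :: "(('v,'a) qpath \<Rightarrow> 'k::field) \<Rightarrow> ('v,'a) qpath \<Rightarrow> 'k"
  assumes D: "normalized D"
  shows "par_supp (arrow_vals D)"
  unfolding par_supp_def
proof (intro allI impI)
  fix a \<gamma> assume nz: "arrow_vals D (a, \<gamma>) \<noteq> 0"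
  then have a: "a \<in> Q1" "D (basis (arr a)) \<gamma> \<noteq> 0" by (auto simp: arrow_vals_def split: if_splits)
  have der: "D \<in> Der" using D by (simp add: normalized_def)
  let ?s = "basis (s a, []) :: ('v,'a) qpath \<Rightarrow> 'k" and ?t = "basis (t a, []) :: ('v,'a) qpath \<Rightarrow> 'k"
  have z: "D ?s = (\<lambda>_. 0)" "D ?t = (\<lambda>_. 0)" using D a endpoints by (auto simp: normalized_def)
  have "mul ?s (basis (arr a)) = basis (arr a)" "mul (basis (arr a)) ?t = basis (arr a)"
    using a endpoints by (auto simp: mul_basis pconcat_def arrow_path_def)
  then have "D (basis (arr a)) = mul ?s (D (basis (arr a)))" "D (basis (arr a)) = mul (D (basis (arr a))) ?t"
    using der_mul[OF der, of ?s "basis (arr a)"] der_mul[OF der, of "basis (arr a)" ?t] z by auto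
  then have "mul ?s (D (basis (arr a))) \<gamma> \<noteq> 0" "mul (D (basis (arr a))) ?t \<gamma> \<noteq> 0" using a by auto
  moreover have "\<gamma> \<in> B" using a(2) Lam_outside[OF der_any_Lam[OF der]] by blast
  ultimately show "a \<in> Q1 \<and> \<gamma> \<in> B \<and> fst \<gamma> = s a \<and> tgt \<gamma> = t a"
    using a(1) by (auto simp: mul_vertex_left mul_vertex_right der_any_Lam[OF der] split: if_splits)
qed

lemma normalized_path_deriv:
  assumes D: "normalized D" and p: "path p"
  shows "D (basis p) = path_deriv (arrow_vals D) p"
proof -
  have der: "D \<in> Der" using D by (simp add: normalized_def)
  have "path (v, as) \<Longrightarrow> D (basis (v, as)) = path_deriv (arrow_vals D) (v, as)" for v as
  proof (induction as arbitrary: v)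
    case Nil
    then show ?case using D by (simp add: normalized_def path_deriv_def)
  next
    case (Cons a as)
    let ?q = "(t a, as)"
    have P: "path (arr a)" "path ?q" "tgt (arr a) = fst ?q" "(v, a # as) = pconcat (arr a) ?q"
      using Cons(2) by (auto simp: pconcat_def)
    have "D (basis (v, a # as)) = D (mul (basis (arr a)) (basis ?q))"
      using P by (simp add: mul_basis)
    also have "\<dots> = (\<lambda>r. mul (D (basis (arr a))) (basis ?q) r + mul (basis (arr a)) (D (basis ?q)) r)"
      using der_mul[OF der] by simp
    also have "\<dots> = path_deriv (arrow_vals D) (pconcat (arr a) ?q)"
      unfolding path_deriv_pconcat[OF arrow_vals_par[OF D] P(1,2,3)]
      using Cons.IH[OF P(2)] Cons(2) by (simp add: path_deriv_arr[OF arrow_vals_par[OF D]]) (simp add: arrow_vals_def)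
    finally show ?case using P(4) by simp
  qed
  then show ?thesis using p by (metis prod.collapse)
qed

text \<open>A relation is zero in the quotient, hence so is its derivative: the values of a
  normalized derivation on the arrows lie in Ker psi_1.\<close>

lemma normalized_path_deriv_Z:
  assumes "normalized D" "z \<in> Z"
  shows "path_deriv (arrow_vals D) z = (\<lambda>_. 0)"
proof -
  have "D \<in> Der" using assms(1) by (simp add: normalized_def)
  then show ?thesis
    using normalized_path_deriv[OF assms(1) Z_path[OF assms(2)]] lin_zero[OF der_lin, of D] assms(2)
    by (simp add: basis_not_B Z_not_B)
qed

lemma normalized_ext:
  assumes "normalized D" "normalized E" "\<And>a. a \<in> Q1 \<Longrightarrow> D (basis (arr a)) = E (basis (arr a))"
  shows "D = E"
proof
  fix x
  have der: "D \<in> Der" "E \<in> Der" using assms by (simp_all add: normalized_def)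
  have "arrow_vals D = arrow_vals E" using assms(3) by (auto simp: arrow_vals_def)
  then have "D (basis p) = E (basis p)" if "p \<in> B" for p
    using normalized_path_deriv assms(1,2) B_path[OF that] by metis
  then have "D x = E x" if "x \<in> Lam B"
    by (rule lin_ext[OF der_lin[OF der(1)] der_lin[OF der(2)] _ that])
  then show "D x = E x" using der_outside[OF der(1)] der_outside[OF der(2)] by (cases "x \<in> Lam B") simp_all
qed

end

section \<open>The radical filtration and the symbol of a derivation\<close>

context monomial_quiver begin

section \<open>Comparison with psi_1\<close>

lemma repl_sum:
  "repl B a \<gamma> z e = (\<Sum>i<length (snd z). if snd z ! i = a then basis (replace_at z i \<gamma>) e else 0)"
proof -
  let ?S = "{i. i < length (snd z) \<and> snd z ! i = a \<and> e \<in> B \<and> e = replace_at z i \<gamma>}"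
  have "(\<Sum>i<length (snd z). if snd z ! i = a then basis (replace_at z i \<gamma>) e else 0)
      = (\<Sum>i<length (snd z). if i \<in> ?S then 1 else (0::'b))"
    by (intro sum.cong) (auto simp: basis_apply)
  also have "\<dots> = (\<Sum>i\<in>{..<length (snd z)} \<inter> ?S. 1)"
    by (rule sum.inter_restrict[symmetric]) simp
  also have "{..<length (snd z)} \<inter> ?S = ?S" by auto
  finally show ?thesis by (simp add: repl_def repl_count_def replace_at_def)
qed

text \<open>The same replacements are counted in two ways: \<open>psi1\<close> sums over arrows and
  then their occurrences, \<open>path_deriv\<close> over positions.\<close>

lemma psi1_path_deriv:
  assumes f: "par_supp f" and z: "z \<in> Z"
  shows "psi1 Q1 s t B Z f (z, e) = path_deriv f z e"
proof -
  let ?S = "{(a, \<gamma>). a \<in> Q1 \<and> \<gamma> \<in> B \<and> parallel t (arr a) \<gamma>}"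
  have sub: "f (a, \<gamma>) * repl B a \<gamma> z e = 0" if "(a, \<gamma>) \<in> Q1 \<times> B - ?S" for a \<gamma>
  proof -
    have "f (a, \<gamma>) = 0"
    proof (rule ccontr)
      assume "f (a, \<gamma>) \<noteq> 0"
      from par_suppD[OF f this] that show False by (auto simp: parallel_def psrc_def)
    qed
    then show ?thesis by simp
  qed
  have len: "snd z ! i \<in> Q1" if "i < length (snd z)" for i
    using Z_path[OF z] that by (auto simp: is_path_def subset_iff)
  have "psi1 Q1 s t B Z f (z, e) = (\<Sum>(a, \<gamma>)\<in>?S. f (a, \<gamma>) * repl B a \<gamma> z e)"
    using z by (simp add: psi1_def)
  also have "\<dots> = (\<Sum>(a, \<gamma>)\<in>Q1 \<times> B. f (a, \<gamma>) * repl B a \<gamma> z e)"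
  proof (rule sum.mono_neutral_left)
    show "\<forall>x\<in>Q1 \<times> B - ?S. (case x of (a, \<gamma>) \<Rightarrow> f (a, \<gamma>) * repl B a \<gamma> z e) = 0"
    proof
      fix x assume "x \<in> Q1 \<times> B - ?S"
      moreover obtain a \<gamma> where "x = (a, \<gamma>)" by (cases x) blast
      ultimately show "(case x of (a, \<gamma>) \<Rightarrow> f (a, \<gamma>) * repl B a \<gamma> z e) = 0"
        using sub[of a \<gamma>] by (simp only: prod.case)
    qed
  qed (auto simp: finite_Q1 finite_B)
  also have "\<dots> = (\<Sum>a\<in>Q1. \<Sum>\<gamma>\<in>B. \<Sum>i<length (snd z). f (a, \<gamma>) * (if snd z ! i = a then basis (replace_at z i \<gamma>) e else 0))"
    by (simp add: sum.cartesian_product[symmetric] repl_sum sum_distrib_left)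
  also have "\<dots> = (\<Sum>a\<in>Q1. \<Sum>i<length (snd z). \<Sum>\<gamma>\<in>B. f (a, \<gamma>) * (if snd z ! i = a then basis (replace_at z i \<gamma>) e else 0))"
    by (intro sum.cong refl sum.swap)
  also have "\<dots> = (\<Sum>i<length (snd z). \<Sum>a\<in>Q1. \<Sum>\<gamma>\<in>B. f (a, \<gamma>) * (if snd z ! i = a then basis (replace_at z i \<gamma>) e else 0))"
    by (rule sum.swap)
  also have "\<dots> = (\<Sum>i<length (snd z). \<Sum>a\<in>Q1. if a = snd z ! i then (\<Sum>\<gamma>\<in>B. f (a, \<gamma>) * basis (replace_at z i \<gamma>) e) else 0)"
    by (intro sum.cong refl) auto
  also have "\<dots> = path_deriv f z e"
    using len finite_Q1 by (simp add: path_deriv_def)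
  finally show ?thesis .
qed

text \<open>The \<open>i\<close>-th power of the radical, described by coefficients.\<close>

definition Rad :: "nat \<Rightarrow> (('v,'a) qpath \<Rightarrow> 'k::field) set" where
  "Rad i = {x \<in> Lam B. \<forall>p. length (snd p) < i \<longrightarrow> x p = 0}"

lemma RadI: "\<lbrakk>x \<in> Lam B; \<And>p. \<lbrakk>p \<in> B; length (snd p) < i\<rbrakk> \<Longrightarrow> x p = 0\<rbrakk> \<Longrightarrow> x \<in> Rad i"
  unfolding Rad_def using Lam_outside by blast

lemma RadD: "x \<in> Rad i \<Longrightarrow> length (snd p) < i \<Longrightarrow> x p = 0"
  and Rad_Lam: "x \<in> Rad i \<Longrightarrow> x \<in> Lam B"
  unfolding Rad_def by blast+

lemma Rad_add: "\<lbrakk>x \<in> Rad i; y \<in> Rad i\<rbrakk> \<Longrightarrow> (\<lambda>p. x p + y p) \<in> Rad i"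
  and Rad_diff: "\<lbrakk>x \<in> Rad i; y \<in> Rad i\<rbrakk> \<Longrightarrow> (\<lambda>p. x p - y p) \<in> Rad i"
  and Rad_smult: "x \<in> Rad i \<Longrightarrow> (\<lambda>p. c * x p) \<in> Rad i"
  and Rad_zero: "(\<lambda>_. 0) \<in> Rad i"
  by (rule RadI; simp add: Lam_add Lam_diff Lam_smult Rad_Lam RadD)+

lemma Rad_mono: "\<lbrakk>x \<in> Rad i; j \<le> i\<rbrakk> \<Longrightarrow> x \<in> Rad j"
  by (rule RadI) (simp_all add: Rad_Lam RadD)

lemma mul_Rad:
  assumes "x \<in> Rad i" "y \<in> Rad j"
  shows "mul x y \<in> Rad (i + j)"
proof (rule RadI)
  fix r :: "('v,'a) qpath" assume r: "r \<in> B" "length (snd r) < i + j"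
  have "x (fst r, take k (snd r)) * y (tgt (fst r, take k (snd r)), drop k (snd r)) = 0" for k
  proof (cases "length (take k (snd r)) < i")
    case True
    then show ?thesis using RadD[OF assms(1), of "(fst r, take k (snd r))"] by simp
  next
    case False
    then have "length (drop k (snd r)) < j" using r(2) by auto
    then show ?thesis using RadD[OF assms(2), of "(tgt (fst r, take k (snd r)), drop k (snd r))"] by simp
  qed
  then show "mul x y r = 0" unfolding mul_split[OF r(1)] by (intro sum.neutral ballI)
qed simp

lemma basis_Rad: "basis p \<in> Rad (length (snd p))"
  by (rule RadI) (auto simp: basis_apply)

text \<open>Derivations raising the powers of the radical by \<open>j\<close>. That every derivation
  lies in \<open>Fil 0\<close> is where L_{-1} = 0 will enter.\<close>

definition Fil :: "nat \<Rightarrow> ((('v,'a) qpath \<Rightarrow> 'k::field) \<Rightarrow> ('v,'a) qpath \<Rightarrow> 'k) set" where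
  "Fil j = {D \<in> Der. \<forall>p\<in>B. D (basis p) \<in> Rad (length (snd p) + j)}"

lemma Fil_Der: "D \<in> Fil j \<Longrightarrow> D \<in> Der"
  by (simp add: Fil_def)

lemma FilI:
  assumes D: "D \<in> Der" and v: "\<And>v. v \<in> Q0 \<Longrightarrow> D (basis (v, [])) \<in> Rad j"
    and a: "\<And>a. a \<in> Q1 \<Longrightarrow> D (basis (arr a)) \<in> Rad (Suc j)"
  shows "D \<in> Fil j"
proof -
  have "path (v, as) \<Longrightarrow> D (basis (v, as)) \<in> Rad (length as + j)" for v as
  proof (induction as arbitrary: v)
    case Nil
    then show ?case using v by simp
  next
    case (Cons b as)
    let ?q = "(t b, as)"
    have P: "path (arr b)" "path ?q" "tgt (arr b) = fst ?q" "(v, b # as) = pconcat (arr b) ?q"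
      using Cons(2) by (auto simp: pconcat_def)
    have "D (basis (v, b # as)) = D (mul (basis (arr b)) (basis ?q))"
      using P by (simp add: mul_basis)
    also have "\<dots> = (\<lambda>r. mul (D (basis (arr b))) (basis ?q) r + mul (basis (arr b)) (D (basis ?q)) r)"
      using der_mul[OF D] by simp
    finally have eq: "D (basis (v, b # as)) = \<dots>" .
    have "mul (D (basis (arr b))) (basis ?q) \<in> Rad (Suc j + length as)"
      using mul_Rad[OF a basis_Rad[of ?q]] Cons(2) by simp
    moreover have "mul (basis (arr b)) (D (basis ?q)) \<in> Rad (1 + (length as + j))"
      using mul_Rad[OF basis_Rad[of "arr b"] Cons.IH[OF P(2)]] by simp
    ultimately show ?case unfolding eq by (auto intro!: Rad_add simp: add.commute)
  qed
  then have "D (basis p) \<in> Rad (length (snd p) + j)" if "p \<in> B" for p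
    using B_path[OF that] by (cases p) simp
  then show ?thesis using D by (simp add: Fil_def)
qed

lemma Fil_Rad:
  assumes D: "D \<in> Fil j" and x: "x \<in> Rad i"
  shows "D x \<in> Rad (i + j)"
proof (rule RadI)
  show "D x \<in> Lam B" using Fil_Der[OF D] by (rule der_any_Lam)
  fix r :: "('v,'a) qpath" assume r: "length (snd r) < i + j"
  have "x p * D (basis p) r = 0" if "p \<in> B" for p
  proof (cases "length (snd p) < i")
    case True
    then show ?thesis using RadD[OF x] by simp
  next
    case False
    then have "length (snd r) < length (snd p) + j" using r by simp
    moreover have "D (basis p) \<in> Rad (length (snd p) + j)" using D that unfolding Fil_def by blast
    ultimately show ?thesis using RadD[of "D (basis p)" _ r] by simp
  qed
  then show "D x r = 0"
    unfolding lin_expand[OF der_lin[OF Fil_Der[OF D]] Rad_Lam[OF x]] by (intro sum.neutral ballI)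
qed

lemma Fil_br:
  assumes "D \<in> Fil i" "E \<in> Fil j"
  shows "(\<lambda>x p. D (E x) p - E (D x) p) \<in> Fil (i + j)"
proof -
  have "D (E (basis p)) \<in> Rad (length (snd p) + (i + j))" "E (D (basis p)) \<in> Rad (length (snd p) + (i + j))" for p
    using Fil_Rad[OF assms(1) Fil_Rad[OF assms(2) basis_Rad[of p]]]
      Fil_Rad[OF assms(2) Fil_Rad[OF assms(1) basis_Rad[of p]]] by (simp_all add: algebra_simps)
  then show ?thesis
    using der_br[OF Fil_Der[OF assms(1)] Fil_Der[OF assms(2)]] by (simp add: Fil_def Rad_diff)
qed

lemma Fil_mono: "\<lbrakk>D \<in> Fil i; j \<le> i\<rbrakk> \<Longrightarrow> D \<in> Fil j"
  by (auto simp: Fil_def intro: Rad_mono)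

lemma Fil_subspace: "lie_subspace (Der_lie t B) (Fil j)"
  unfolding lie_subspace_def Der_lie_simps
  by (auto simp: Fil_def der_zero der_add der_smult Rad_zero Rad_add Rad_smult)

lemma Fil_eventually_zero: "\<exists>N. Fil N \<subseteq> {\<lambda>x p. 0}"
proof -
  define N where "N = Suc (Max (insert 0 ((\<lambda>p. length (snd p)) ` B)))"
  have N: "length (snd p) < N" if "p \<in> B" for p
    unfolding N_def using that finite_B by (auto simp: less_Suc_eq_le intro!: Max_ge)
  have "D = (\<lambda>x p. 0)" if D: "D \<in> Fil N" for D :: "(('v,'a) qpath \<Rightarrow> 'b) \<Rightarrow> ('v,'a) qpath \<Rightarrow> 'b"
  proof
    fix x
    have "D (basis p) r = 0" if "p \<in> B" for p r
    proof (cases "r \<in> B")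
      case True
      have "D (basis p) \<in> Rad (length (snd p) + N)" using D that by (simp add: Fil_def)
      then show ?thesis using RadD N[OF True] by (metis trans_less_add2)
    next
      case False
      then show ?thesis using Lam_outside[OF der_any_Lam[OF Fil_Der[OF D]]] by blast
    qed
    then show "D x = (\<lambda>p. 0)"
      using lin_expand[OF der_lin[OF Fil_Der[OF D]], of x] der_outside[OF Fil_Der[OF D], of x]
      by (cases "x \<in> Lam B") simp_all
  qed
  then show ?thesis by blast
qed

text \<open>Idempotence gives c + c = c for the coefficient c at \<open>v\<close> itself, and
  orthogonality gives zero at the other vertices, in every characteristic.\<close>

lemma der_vertex_Rad:
  assumes D: "D \<in> Der" and v: "v \<in> Q0"
  shows "D (basis (v, [])) \<in> Rad 1"
proof (rule RadI)
  show "D (basis (v, [])) \<in> Lam B" using D by (rule der_any_Lam)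
  fix r :: "('v,'a) qpath" assume "r \<in> B" "length (snd r) < 1"
  then obtain w where r: "r = (w, [])" "w \<in> Q0" by (cases r) auto
  show "D (basis (v, [])) r = 0"
  proof (cases "v = w")
    case True
    then have "D (basis (v, [])) r + D (basis (v, [])) r = D (basis (v, [])) r"
      using vertex_relation[OF D v v, of r] by (simp only: r fst_conv tgt_simps if_True refl)
    then show ?thesis by (simp only: add_cancel_left_right)
  next
    case False
    then show ?thesis using vertex_relation[OF D v r(2), of r] by (simp add: r)
  qed
qed

text \<open>Entry \<open>(c, b)\<close> is the coefficient of \<open>c\<close> in the image of \<open>b\<close>, so that composition of derivations
  becomes matrix multiplication.\<close>

definition symbol :: "((('v,'a) qpath \<Rightarrow> 'k::field) \<Rightarrow> ('v,'a) qpath \<Rightarrow> 'k) \<Rightarrow> 'a \<Rightarrow> 'a \<Rightarrow> 'k" where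
  "symbol D = (\<lambda>c b. if b \<in> Q1 \<and> c \<in> Q1 then D (basis (arr b)) (arr c) else 0)"

definition mat_br :: "('a \<Rightarrow> 'a \<Rightarrow> 'k::field) \<Rightarrow> ('a \<Rightarrow> 'a \<Rightarrow> 'k) \<Rightarrow> 'a \<Rightarrow> 'a \<Rightarrow> 'k" where
  "mat_br M N = (\<lambda>c a. (\<Sum>b\<in>Q1. M c b * N b a) - (\<Sum>b\<in>Q1. N c b * M b a))"

text \<open>The diagonal matrix of the coboundary of a 0-cochain \<open>x\<close> on the graph of
  the quiver.\<close>

definition cobd :: "('v \<Rightarrow> 'k::field) \<Rightarrow> 'a \<Rightarrow> 'a \<Rightarrow> 'k" where
  "cobd x = (\<lambda>c b. if c = b \<and> b \<in> Q1 then x (s b) - x (t b) else 0)"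

lemma symbol_add: "symbol (\<lambda>x p. D x p + E x p) = (\<lambda>c b. symbol D c b + symbol E c b)"
  and symbol_diff: "symbol (\<lambda>x p. D x p - E x p) = (\<lambda>c b. symbol D c b - symbol E c b)"
  and symbol_smult: "symbol (\<lambda>x p. k * D x p) = (\<lambda>c b. k * symbol D c b)"
  and symbol_zero: "symbol (\<lambda>x p. 0) = (\<lambda>c b. 0)"
  by (auto simp: symbol_def intro!: ext)

text \<open>An arrow has only two factorizations, each with a vertex as one factor, so only the
  vertex coefficients of \<open>y\<close> contribute.\<close>

lemma symbol_ad:
  assumes "y \<in> Lam B"
  shows "symbol (ad y) = cobd (\<lambda>v. y (v, []))"
proof (intro ext)
  fix c b
  show "symbol (ad y) c b = cobd (\<lambda>v. y (v, [])) c b"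
  proof (cases "b \<in> Q1 \<and> c \<in> Q1")
    case True
    then have "mul y (basis (arr b)) (arr c) = (if c = b then y (s b, []) else 0)"
      "mul (basis (arr b)) y (arr c) = (if c = b then y (t b, []) else 0)"
      by (auto simp: mul_split basis_apply arrow_path_def[symmetric])
        (auto simp: basis_apply arrow_path_def)
    then show ?thesis using True by (simp add: symbol_def cobd_def ad_def)
  qed (auto simp: symbol_def cobd_def)
qed

text \<open>Equivalent to \<open>p\<^sup>(\<^sup>a\<^sup>,\<^sup>b\<^sup>) = 0\<close> for all \<open>p \<in> Z\<close>: distinct occurrences of \<open>a\<close> give distinct paths,
  so the coefficients are 0 or 1 and cannot vanish in positive characteristic.\<close>

definition arrow_le :: "'a \<Rightarrow> 'a \<Rightarrow> bool" where
  "arrow_le a b \<longleftrightarrow> a \<in> Q1 \<and> b \<in> Q1 \<and> s a = s b \<and> t a = t b \<and>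
    (\<forall>z\<in>Z. \<forall>i<length (snd z). snd z ! i = a \<longrightarrow> (fst z, (snd z)[i := b]) \<notin> B)"

definition symbol_space :: "('a \<Rightarrow> 'a \<Rightarrow> 'k::field) set" where
  "symbol_space = {M. \<forall>b a. M b a \<noteq> 0 \<longrightarrow> arrow_le a b}"

lemma arrow_le_refl: "a \<in> Q1 \<Longrightarrow> arrow_le a a"
  unfolding arrow_le_def using Z_not_B by (metis list_update_id prod.collapse)

lemma replace_at_arr: "i < length (snd z) \<Longrightarrow> replace_at z i (arr b) = (fst z, (snd z)[i := b])"
  by (simp add: replace_at_def upd_conv_take_nth_drop)

text \<open>Removing an inner derivation changes the symbol on the diagonal only, where reflexivity
  of \<open>arrow_le\<close> settles the claim. Off the diagonal, the derivative of a relation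
  \<open>z\<close>, which is zero, has a single entry of the symbol as its coefficient at
  \<open>z\<close> with one \<open>a\<close> changed to \<open>b\<close>.\<close>

lemma symbol_symbol_space:
  fixes D :: "(('v,'a) qpath \<Rightarrow> 'k::field) \<Rightarrow> ('v,'a) qpath \<Rightarrow> 'k"
  assumes D: "D \<in> Der"
  shows "symbol D \<in> symbol_space"
proof -
  obtain D0 y where D0: "normalized D0" and y: "y \<in> Lam B" and eq: "D = (\<lambda>x p. D0 x p + ad y x p)"
    using normalize[OF D] .
  have "arrow_le a b" if nz: "symbol D b a \<noteq> 0" for a b
  proof (cases "a = b")
    case True
    then show ?thesis using nz arrow_le_refl by (auto simp: symbol_def split: if_splits)
  next
    case False
    then have "symbol D0 b a \<noteq> 0" using nz by (simp add: eq symbol_add symbol_ad[OF y] cobd_def)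
    then have ab: "a \<in> Q1" "b \<in> Q1" and f: "arrow_vals D0 (a, arr b) \<noteq> 0"
      by (auto simp: symbol_def arrow_vals_def split: if_splits)
    note supp = arrow_vals_par[OF D0]
    have False if z: "z \<in> Z" "i < length (snd z)" "snd z ! i = a" and e: "(fst z, (snd z)[i := b]) \<in> B" for z i
    proof -
      let ?e = "(fst z, (snd z)[i := b])" and ?f = "arrow_vals D0"
      \<comment> \<open>Only one replacement can produce \<open>?e\<close>: equal lengths force
        \<open>\<gamma>\<close> to be an arrow, and \<open>z\<close> and \<open>?e\<close> differ at
        position \<open>i\<close>, which forces \<open>j = i\<close>.\<close>
      have trm: "?f (snd z ! j, \<gamma>) * basis (replace_at z j \<gamma>) ?e = (if j = i then (if \<gamma> = arr b then ?f (a, arr b) else 0) else 0)"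
        if j: "j < length (snd z)" for j \<gamma>
      proof (cases "?f (snd z ! j, \<gamma>) \<noteq> 0 \<and> ?e = replace_at z j \<gamma>")
        case True
        then have g: "\<gamma> \<in> B" using par_suppD[OF supp] by blast
        have "length (snd ?e) = length (snd (replace_at z j \<gamma>))" using True by simp
        then have "length (snd \<gamma>) = 1" using j by (simp add: replace_at_def)
        then obtain c where c: "\<gamma> = arr c" using length_one_arr[OF B_path[OF g]] by blast
        then have upd: "(snd z)[i := b] = (snd z)[j := c]" using True replace_at_arr[OF j] by simp
        have "j = i"
        proof (rule ccontr)
          assume "j \<noteq> i"
          then have "(snd z)[j := c] ! i = a" using z by simp
          moreover have "(snd z)[i := b] ! i = b" using z by simp
          ultimately show False using upd False by simp
        qed
        moreover have "c = b" using upd j \<open>j = i\<close> by (metis nth_list_update_eq)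
        ultimately show ?thesis using True c z e by (simp add: basis_apply)
      next
        case F: False
        then have "\<not> (j = i \<and> \<gamma> = arr b)" using z f replace_at_arr[OF z(2), of b] by auto
        then have "(if j = i then (if \<gamma> = arr b then ?f (a, arr b) else 0) else 0) = 0" by auto
        moreover have "?f (snd z ! j, \<gamma>) = 0 \<or> basis (replace_at z j \<gamma>) ?e = (0::'k)"
          using F by (cases "?e = replace_at z j \<gamma>") (simp_all only: basis_apply simp_thms if_False not_not)
        then have "?f (snd z ! j, \<gamma>) * basis (replace_at z j \<gamma>) ?e = 0" by (simp only: mult_eq_0_iff)
        ultimately show ?thesis by (simp only:)
      qed
      have "path_deriv ?f z ?e = (\<Sum>j<length (snd z). \<Sum>\<gamma>\<in>B. (if j = i then (if \<gamma> = arr b then ?f (a, arr b) else 0) else 0))"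
        unfolding path_deriv_def using trm by (intro sum.cong refl) simp
      also have "\<dots> = (\<Sum>j<length (snd z). if j = i then \<Sum>\<gamma>\<in>B. (if \<gamma> = arr b then ?f (a, arr b) else 0) else 0)"
        by (intro sum.cong refl) auto
      also have "\<dots> = ?f (a, arr b)" using z(2) ab finite_B by simp
      finally show False using f normalized_path_deriv_Z[OF D0 z(1)] by simp
    qed
    then show ?thesis
      unfolding arrow_le_def using ab par_suppD(3,4)[OF supp f] by auto
  qed
  then show ?thesis by (simp add: symbol_space_def)
qed

text \<open>Every replacement that \<open>M\<close> allows in a relation leaves \<open>B\<close>, so
  the derivative of a relation vanishes term by term.\<close>

lemma symbol_surj:
  fixes M :: "'a \<Rightarrow> 'a \<Rightarrow> 'k::field"
  assumes M: "M \<in> symbol_space"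
  obtains D where "normalized D" "symbol D = M"
proof -
  define f where "f = (\<lambda>(a, \<gamma>). if \<gamma> \<in> arr ` Q1 then M (hd (snd \<gamma>)) a else 0)"
  have f_arr: "f (a, arr b) = M b a" if "b \<in> Q1" for a b using that by (simp add: f_def)
  have supp: "par_supp f"
    unfolding par_supp_def
  proof (intro allI impI)
    fix a \<gamma> assume "f (a, \<gamma>) \<noteq> 0"
    then obtain b where "b \<in> Q1" "\<gamma> = arr b" "M b a \<noteq> 0" by (auto simp: f_def split: if_splits)
    then show "a \<in> Q1 \<and> \<gamma> \<in> B \<and> fst \<gamma> = s a \<and> tgt \<gamma> = t a"
      using M by (auto simp: symbol_space_def arrow_le_def)
  qed
  have "path_deriv f z = (\<lambda>_. 0)" if z: "z \<in> Z" for z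
  proof
    fix e
    have "f (snd z ! i, \<gamma>) * basis (replace_at z i \<gamma>) e = 0" if i: "i < length (snd z)" for i \<gamma>
    proof (cases "f (snd z ! i, \<gamma>) = 0")
      case False
      then obtain b where b: "b \<in> Q1" "\<gamma> = arr b" "M b (snd z ! i) \<noteq> 0"
        by (auto simp: f_def split: if_splits)
      then have "arrow_le (snd z ! i) b" using M by (auto simp: symbol_space_def)
      then have "replace_at z i \<gamma> \<notin> B" using z i b by (auto simp: arrow_le_def replace_at_arr)
      then show ?thesis by (simp add: basis_apply)
    qed simp
    then show "path_deriv f z e = 0" unfolding path_deriv_def by (intro sum.neutral ballI) simp
  qed
  then have "normalized (mkder f)" using mkder_der[OF supp] by blast
  moreover have "symbol (mkder f) c b = M c b" for c b
  proof (cases "b \<in> Q1 \<and> c \<in> Q1")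
    case True
    then show ?thesis by (simp add: symbol_def mkder_basis path_deriv_arr[OF supp] f_arr)
  next
    case False
    then have "M c b = 0" using M by (auto simp: symbol_space_def arrow_le_def)
    then show ?thesis using False by (auto simp: symbol_def)
  qed
  ultimately show ?thesis using that by blast
qed

end

text \<open>\<open>L_minus1\<close> depends on the field, so the locale carries a type token that
  fixes \<open>'k\<close>.\<close>

locale monomial_algebra = monomial_quiver Q0 Q1 s t Z
  for Q0 :: "'v set" and Q1 :: "'a set" and s t :: "'a \<Rightarrow> 'v" and Z :: "('v,'a) qpath set" +
  fixes ground :: "'k::field itself"
  assumes L0: "(L_minus1 Q0 Q1 s t Z :: ('a \<times> ('v,'a) qpath \<Rightarrow> 'k) set) = {\<lambda>_. 0}"
begin

abbreviation DerK :: "((('v,'a) qpath \<Rightarrow> 'k) \<Rightarrow> ('v,'a) qpath \<Rightarrow> 'k) set" where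
  "DerK \<equiv> Der"

text \<open>Replacing an arrow by a path of length l changes the length by l - 1, so Ker psi_1 is
  graded. The component of \<open>arrow_vals D\<close> at the vertices is itself in the kernel,
  hence in L_{-1} = 0.\<close>

lemma normalized_no_vertex:
  fixes D :: "(('v,'a) qpath \<Rightarrow> 'k) \<Rightarrow> ('v,'a) qpath \<Rightarrow> 'k"
  assumes D: "normalized D" and a: "a \<in> Q1"
  shows "D (basis (arr a)) (w, []) = 0"
proof -
  let ?f = "arrow_vals D"
  define f0 where "f0 = (\<lambda>(a, \<gamma>). if snd \<gamma> = [] then ?f (a, \<gamma>) else 0)"
  note supp = arrow_vals_par[OF D]
  have supp0: "par_supp f0"
    unfolding par_supp_def
  proof (intro allI impI)
    fix a \<gamma> assume "f0 (a, \<gamma>) \<noteq> 0"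
    then have "?f (a, \<gamma>) \<noteq> 0" by (auto simp: f0_def split: if_splits)
    from par_suppD[OF supp this] show "a \<in> Q1 \<and> \<gamma> \<in> B \<and> fst \<gamma> = s a \<and> tgt \<gamma> = t a" by blast
  qed
  have "f0 \<in> kQ1B Q1 s t {(v, []) | v. v \<in> Q0}"
    unfolding kQ1B_def
  proof (clarsimp simp del: split_paired_All)
    fix a \<gamma> assume *: "a \<in> Q1 \<longrightarrow> (arr a, \<gamma>) \<notin> par_pairs t {arr a} {(v, []) |v. v \<in> Q0}"
    show "f0 (a, \<gamma>) = 0"
    proof (rule ccontr)
      assume nz: "f0 (a, \<gamma>) \<noteq> 0"
      then have "snd \<gamma> = []" by (auto simp: f0_def split: if_splits)
      with par_suppD[OF supp0 nz] * show False
        using endpoints by (cases \<gamma>) (auto simp: par_pairs_def parallel_def psrc_def)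
    qed
  qed
  moreover have "psi1 Q1 s t B Z f0 = (\<lambda>_. 0)"
  proof
    fix x :: "('v,'a) qpath \<times> ('v,'a) qpath"
    obtain z e where x: "x = (z, e)" by (cases x) blast
    show "psi1 Q1 s t B Z f0 x = 0"
    proof (cases "z \<in> Z")
      case z: True
      have *: "basis (replace_at z i \<gamma>) e = (0::'k) \<or> length (snd e) + 1 = length (snd z) + length (snd \<gamma>)"
        if "i < length (snd z)" for i \<gamma>
        using that by (auto simp: basis_apply replace_at_def)
      \<comment> \<open>A path \<open>e\<close> one arrow shorter than \<open>z\<close> receives
        contributions from vertices only, where \<open>f0\<close> agrees with \<open>?f\<close>; any
        other \<open>e\<close> receives none from \<open>f0\<close>.\<close>
      have "path_deriv f0 z e = 0"
      proof (cases "length (snd e) + 1 = length (snd z)")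
        case True
        have "f0 (snd z ! i, \<gamma>) * basis (replace_at z i \<gamma>) e = ?f (snd z ! i, \<gamma>) * basis (replace_at z i \<gamma>) e"
          if "i < length (snd z)" for i \<gamma>
          using *[OF that, of \<gamma>] True by (auto simp: f0_def)
        then have "path_deriv f0 z e = path_deriv ?f z e" unfolding path_deriv_def by (intro sum.cong refl) simp
        then show ?thesis using normalized_path_deriv_Z[OF D z] by simp
      next
        case False
        have "f0 (snd z ! i, \<gamma>) * basis (replace_at z i \<gamma>) e = 0" if "i < length (snd z)" for i \<gamma>
          using *[OF that, of \<gamma>] False by (auto simp: f0_def)
        then show ?thesis unfolding path_deriv_def by (intro sum.neutral ballI) simp
      qed
      then show ?thesis using psi1_path_deriv[OF supp0 z] x by simp
    qed (simp add: x psi1_def)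
  qed
  ultimately have "f0 \<in> L_minus1 Q0 Q1 s t Z" unfolding L_minus1_def B_def by simp
  then have "f0 = (\<lambda>_. 0)" using L0 by simp
  then have "f0 (a, (w, [])) = 0" by simp
  then show ?thesis using a by (simp add: f0_def arrow_vals_def)
qed

lemma der_arrow_Rad:
  assumes D: "D \<in> DerK" and a: "a \<in> Q1"
  shows "D (basis (arr a)) \<in> Rad 1"
proof -
  obtain D0 y where D0: "normalized D0" and y: "y \<in> Lam B" and eq: "D = (\<lambda>x p. D0 x p + ad y x p)"
    using normalize[OF D] .
  have "D0 (basis (arr a)) \<in> Rad 1"
  proof (rule RadI)
    show "D0 (basis (arr a)) \<in> Lam B" using D0 by (auto simp: normalized_def der_any_Lam)
    fix r :: "('v,'a) qpath" assume "length (snd r) < 1"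
    then show "D0 (basis (arr a)) r = 0" using normalized_no_vertex[OF D0 a] by (cases r) simp
  qed
  moreover have "ad y (basis (arr a)) \<in> Rad 1"
  proof -
    have "y \<in> Rad 0" using y by (rule RadI) simp
    then show ?thesis
      using mul_Rad[of y 0 "basis (arr a)" 1] mul_Rad[of "basis (arr a)" 1 y 0] basis_Rad[of "arr a"]
      by (auto simp: ad_def intro!: Rad_diff)
  qed
  ultimately show ?thesis by (simp add: eq Rad_add)
qed

lemma Der_Fil: "D \<in> DerK \<Longrightarrow> D \<in> Fil 0"
  by (rule FilI) (auto intro: Rad_mono[OF der_vertex_Rad] der_arrow_Rad[unfolded One_nat_def])

lemma symbol_zero_Fil:
  assumes D: "D \<in> DerK" and symbol: "symbol D = (\<lambda>c b. 0)"
  shows "D \<in> Fil 1"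
proof (rule FilI[OF D])
  show "D (basis (v, [])) \<in> Rad 1" if "v \<in> Q0" for v using der_vertex_Rad[OF D that] .
  fix a assume a: "a \<in> Q1"
  show "D (basis (arr a)) \<in> Rad (Suc 1)"
  proof (rule RadI)
    show "D (basis (arr a)) \<in> Lam B" using D by (rule der_any_Lam)
    fix r :: "('v,'a) qpath" assume r: "r \<in> B" "length (snd r) < Suc 1"
    show "D (basis (arr a)) r = 0"
    proof (cases "length (snd r) = 1")
      case True
      then obtain c where "c \<in> Q1" "r = arr c" using length_one_arr[OF B_path[OF r(1)]] by blast
      then show ?thesis using fun_cong[OF fun_cong[OF symbol], of c a] a by (simp add: symbol_def)
    next
      case False
      then have "length (snd r) < 1" using r(2) by linarith
      then show ?thesis using RadD[OF der_arrow_Rad[OF D a]] by blast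
    qed
  qed
qed

text \<open>Paths of length at least 2 stay in \<open>Rad 2\<close>, so the arrow coefficients of
  \<open>D x\<close> depend only on those of \<open>x\<close>. This is the action on r/r^2.\<close>

lemma der_at_arrow:
  assumes D: "D \<in> DerK" and x: "x \<in> Rad 1" and c: "c \<in> Q1"
  shows "D x (arr c) = (\<Sum>b\<in>Q1. symbol D c b * x (arr b))"
proof -
  have z: "x p * D (basis p) (arr c) = 0" if p: "p \<in> B - arr ` Q1" for p
  proof (cases "length (snd p) = 0")
    case True
    then show ?thesis using RadD[OF x] by simp
  next
    case False
    moreover have "length (snd p) \<noteq> 1" using p length_one_arr[OF B_path] by blast
    ultimately have "2 \<le> length (snd p)" by linarith
    moreover have "D (basis p) \<in> Rad (length (snd p) + 0)" using Der_Fil[OF D] p unfolding Fil_def by blast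
    ultimately show ?thesis using RadD[of "D (basis p)" _ "arr c"] by simp
  qed
  have "D x (arr c) = (\<Sum>p\<in>B. x p * D (basis p) (arr c))"
    using lin_expand[OF der_lin[OF D] Rad_Lam[OF x]] by simp
  also have "\<dots> = (\<Sum>p\<in>arr ` Q1. x p * D (basis p) (arr c))"
    using z finite_B by (intro sum.mono_neutral_right) auto
  also have "\<dots> = (\<Sum>b\<in>Q1. x (arr b) * D (basis (arr b)) (arr c))"
    by (subst sum.reindex) (auto simp: inj_on_def)
  also have "\<dots> = (\<Sum>b\<in>Q1. symbol D c b * x (arr b))"
    using c by (intro sum.cong) (auto simp: symbol_def)
  finally show ?thesis .
qed

lemma symbol_br:
  assumes D: "D \<in> DerK" and E: "E \<in> DerK"
  shows "symbol (\<lambda>x p. D (E x) p - E (D x) p) = mat_br (symbol D) (symbol E)"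
proof (intro ext)
  fix c a
  show "symbol (\<lambda>x p. D (E x) p - E (D x) p) c a = mat_br (symbol D) (symbol E) c a"
  proof (cases "a \<in> Q1 \<and> c \<in> Q1")
    case True
    then have "D (E (basis (arr a))) (arr c) = (\<Sum>b\<in>Q1. symbol D c b * E (basis (arr a)) (arr b))"
      "E (D (basis (arr a))) (arr c) = (\<Sum>b\<in>Q1. symbol E c b * D (basis (arr a)) (arr b))"
      using der_at_arrow[OF D der_arrow_Rad[OF E]] der_at_arrow[OF E der_arrow_Rad[OF D]] by auto
    moreover have "(\<Sum>b\<in>Q1. symbol D c b * E (basis (arr a)) (arr b)) = (\<Sum>b\<in>Q1. symbol D c b * symbol E b a)"
      "(\<Sum>b\<in>Q1. symbol E c b * D (basis (arr a)) (arr b)) = (\<Sum>b\<in>Q1. symbol E c b * symbol D b a)"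
      using True by (auto intro!: sum.cong simp: symbol_def)
    ultimately show ?thesis using True by (simp add: mat_br_def symbol_def[of "\<lambda>x p. D (E x) p - E (D x) p"])
  qed (auto simp: mat_br_def symbol_def)
qed

text \<open>Both matrices lift to derivations, whose bracket is again a derivation.\<close>

lemma symbol_space_br:
  fixes M N :: "'a \<Rightarrow> 'a \<Rightarrow> 'k"
  assumes "M \<in> symbol_space" "N \<in> symbol_space"
  shows "mat_br M N \<in> symbol_space"
proof -
  obtain D E :: "(('v,'a) qpath \<Rightarrow> 'k) \<Rightarrow> ('v,'a) qpath \<Rightarrow> 'k"
    where "normalized D" "symbol D = M" "normalized E" "symbol E = N"
    using symbol_surj assms by metis
  then show ?thesis using symbol_br[of D E] symbol_symbol_space[OF der_br[of D E]] by (simp add: normalized_def)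
qed

lemma HH1_eq: "HH1 t B = lie_quot (Der_lie t B) Inn"
  by (simp add: HH1_def)

text \<open>Brackets add filtration degrees and \<open>Der\<close> is \<open>Fil 0\<close>, so the
  \<open>Fil (Suc k)\<close> form a chain as in \<open>semisimple_quot_chain\<close>; it reaches
  zero because \<open>B\<close> is finite.\<close>

lemma Fil_Inn:
  assumes ss: "lie_semisimple (HH1 t B :: (_, 'k) liealg)"
  shows "(Fil 1 :: ((('v,'a) qpath \<Rightarrow> 'k) \<Rightarrow> _) set) \<subseteq> Inn"
proof -
  interpret H: lie_algebra_ideal "Der_lie t B :: (_, 'k) liealg" Inn by (rule lie_algebra_ideal_HH1)
  obtain N where N: "(Fil N :: ((('v,'a) qpath \<Rightarrow> 'k) \<Rightarrow> _) set) \<subseteq> {\<lambda>x p. 0}"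
    using Fil_eventually_zero by blast
  have "Fil (Suc 0) \<subseteq> (Inn :: ((('v,'a) qpath \<Rightarrow> 'k) \<Rightarrow> _) set)"
  proof (rule H.semisimple_quot_chain[of "\<lambda>k. Fil (Suc k)" N])
    show "lie_semisimple (lie_quot (Der_lie t B :: (_, 'k) liealg) Inn)" using ss by (simp add: HH1_eq)
    show "lie_subspace (Der_lie t B) (Fil (Suc k))" for k by (rule Fil_subspace)
    show "lbr (Der_lie t B) D E \<in> Fil (Suc 0)"
      if "D \<in> lcar (Der_lie t B :: (_, 'k) liealg)" "E \<in> Fil (Suc 0)" for D E
      using Fil_br[OF Der_Fil that(2), of D] that(1) by (simp add: Der_lie_simps)
    show "lbr (Der_lie t B) D E \<in> Fil (Suc (Suc k))" if "D \<in> Fil (Suc k)" "E \<in> Fil (Suc k)" for k D E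
      using Fil_mono[OF Fil_br[OF that]] by (simp add: Der_lie_simps)
    have "Fil (Suc N) \<subseteq> {\<lambda>x p. 0 :: 'k}" using N Fil_mono[of _ "Suc N" N] by auto
    then show "(Fil (Suc N) :: ((('v,'a) qpath \<Rightarrow> 'k) \<Rightarrow> _) set) \<subseteq> Inn"
      using H.ideal_zero by (auto simp: Der_lie_simps)
  qed
  then show ?thesis by simp
qed

text \<open>Subtracting \<open>ad y\<close> for y = sum of x(v) e_v leaves a derivation with zero
  symbol, which lies in \<open>Fil 1\<close>.\<close>

lemma cobd_Inn:
  assumes F: "(Fil 1 :: ((('v,'a) qpath \<Rightarrow> 'k) \<Rightarrow> _) set) \<subseteq> Inn"
    and D: "D \<in> DerK" and symbol: "symbol D = cobd x"
  shows "D \<in> Inn"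
proof -
  interpret H: lie_algebra_ideal "Der_lie t B :: (_, 'k) liealg" Inn by (rule lie_algebra_ideal_HH1)
  define y where "y = (\<lambda>(v, as). if v \<in> Q0 \<and> as = ([] :: 'a list) then x v else 0)"
  have y: "y \<in> Lam B" by (auto simp: Lam_def y_def)
  have "cobd (\<lambda>v. y (v, [])) = cobd x" using endpoints by (auto simp: cobd_def y_def intro!: ext)
  then have "symbol (\<lambda>x p. D x p - ad y x p) = (\<lambda>c b. 0)" by (simp add: symbol_diff symbol symbol_ad[OF y])
  then have "(\<lambda>x p. D x p - ad y x p) \<in> Inn"
    using symbol_zero_Fil[OF der_diff[OF D ad_der[OF y]]] F by blast
  moreover have "ad y \<in> Inn" using y by (simp add: Inn_eq)
  ultimately show ?thesis using H.ideal_add by (fastforce simp: Der_lie_simps)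
qed

text \<open>Preimages under the symbol map turn a chain of matrix spaces into a chain of subspaces
  of \<open>Der\<close>, whose last member is inner by \<open>cobd_Inn\<close>. The
  \<open>J k\<close> may contain matrices that are not symbols, so they can be described by their
  entries alone.\<close>

lemma symbol_chain_Inn:
  fixes J :: "nat \<Rightarrow> ('a \<Rightarrow> 'a \<Rightarrow> 'k) set"
  assumes ss: "lie_semisimple (HH1 t B :: (_, 'k) liealg)"
    and zero: "\<And>k. (\<lambda>c b. 0) \<in> J k"
    and add: "\<And>k M N. \<lbrakk>M \<in> J k; N \<in> J k\<rbrakk> \<Longrightarrow> (\<lambda>c b. M c b + N c b) \<in> J k"
    and smult: "\<And>k M r. M \<in> J k \<Longrightarrow> (\<lambda>c b. r * M c b) \<in> J k"
    and ideal: "\<And>M N. \<lbrakk>M \<in> symbol_space; N \<in> symbol_space; N \<in> J 0\<rbrakk> \<Longrightarrow> mat_br M N \<in> J 0"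
    and br: "\<And>k M N. \<lbrakk>M \<in> symbol_space; N \<in> symbol_space; M \<in> J k; N \<in> J k\<rbrakk> \<Longrightarrow> mat_br M N \<in> J (Suc k)"
    and fin: "\<And>M. \<lbrakk>M \<in> symbol_space; M \<in> J n\<rbrakk> \<Longrightarrow> \<exists>x. M = cobd x"
    and D: "D \<in> DerK" "symbol D \<in> J 0"
  shows "D \<in> Inn"
proof -
  interpret H: lie_algebra_ideal "Der_lie t B :: (_, 'k) liealg" Inn by (rule lie_algebra_ideal_HH1)
  let ?S = "\<lambda>k. {D \<in> DerK. symbol D \<in> J k}"
  have "?S 0 \<subseteq> Inn"
  proof (rule H.semisimple_quot_chain[of ?S n])
    show "lie_semisimple (lie_quot (Der_lie t B :: (_, 'k) liealg) Inn)" using ss by (simp add: HH1_eq)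
    show "lie_subspace (Der_lie t B) (?S k)" for k
      unfolding lie_subspace_def Der_lie_simps
      by (auto simp: der_zero der_add der_smult symbol_zero symbol_add symbol_smult zero add smult)
    show "lbr (Der_lie t B) D E \<in> ?S 0"
      if "D \<in> lcar (Der_lie t B :: (_, 'k) liealg)" "E \<in> ?S 0" for D E
      using that ideal[OF symbol_symbol_space symbol_symbol_space, of D E] by (simp add: Der_lie_simps der_br symbol_br)
    show "lbr (Der_lie t B) D E \<in> ?S (Suc k)" if "D \<in> ?S k" "E \<in> ?S k" for k D E
      using that br[OF symbol_symbol_space symbol_symbol_space, of D E k] by (simp add: Der_lie_simps der_br symbol_br)
    show "?S n \<subseteq> Inn"
      using fin[OF symbol_symbol_space] cobd_Inn[OF Fil_Inn[OF ss]] by blast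
  qed
  then show ?thesis using D by blast
qed

end

section \<open>Consequences of semisimplicity\<close>

context monomial_quiver begin

definition par :: "'a \<Rightarrow> 'a \<Rightarrow> bool" where
  "par a b \<longleftrightarrow> a \<in> Q1 \<and> b \<in> Q1 \<and> s a = s b \<and> t a = t b"

lemma arrow_le_par: "arrow_le a b \<Longrightarrow> par a b"
  by (simp add: arrow_le_def par_def)

lemma par_classes_iff: "C \<in> par_classes Q1 s t \<longleftrightarrow> (\<exists>a\<in>Q1. C = {b. par a b})"
  by (auto simp: par_classes_def quotient_def arrow_par_def par_def Image_def)

lemma par_class_eq: "C \<in> par_classes Q1 s t \<Longrightarrow> a \<in> C \<Longrightarrow> C = {b. par a b}"
  by (auto simp: par_classes_iff par_def)

lemma par_class_self: "a \<in> Q1 \<Longrightarrow> {b. par a b} \<in> par_classes Q1 s t"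
  by (auto simp: par_classes_iff)

lemma par_class_finite: "C \<in> par_classes Q1 s t \<Longrightarrow> finite C"
  by (rule finite_subset[OF _ finite_Q1]) (auto simp: par_classes_iff par_def)

lemma completely_saturated_iff:
  "completely_saturated Q0 Q1 s t Z TYPE('k::field) \<longleftrightarrow> (\<forall>a b. par a b \<longrightarrow> arrow_le a b)"
proof
  assume sat: "completely_saturated Q0 Q1 s t Z TYPE('k)"
  show "\<forall>a b. par a b \<longrightarrow> arrow_le a b"
  proof (intro allI impI)
    fix a b assume ab: "par a b"
    have "(fst z, (snd z)[i := b]) \<notin> B" if z: "z \<in> Z" "i < length (snd z)" "snd z ! i = a" for z i
    proof
      let ?e = "(fst z, (snd z)[i := b])"
      assume e: "?e \<in> B"
      have "a \<noteq> b" using e Z_not_B[OF z(1)] z by auto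
      have "(repl B a (arr b) z :: _ \<Rightarrow> 'k) = (\<lambda>_. 0)"
        using sat ab z(1) by (auto simp: completely_saturated_def arrow_par_def par_def B_def)
      then have "0 = (\<Sum>j<length (snd z). if snd z ! j = a then basis (replace_at z j (arr b)) ?e else (0::'k))"
        using repl_sum[of a "arr b" z ?e, where ?'b = 'k] by simp
      also have "\<dots> = (\<Sum>j<length (snd z). if j = i then 1 else 0)"
      proof (intro sum.cong refl)
        fix j assume j: "j \<in> {..<length (snd z)}"
        have "(snd z)[i := b] \<noteq> (snd z)[j := b]" if "j \<noteq> i" "snd z ! j = a"
        proof
          assume "(snd z)[i := b] = (snd z)[j := b]"
          then have "(snd z)[i := b] ! j = (snd z)[j := b] ! j" by simp
          then show False using that j \<open>a \<noteq> b\<close> by simp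
        qed
        then show "(if snd z ! j = a then basis (replace_at z j (arr b)) ?e else (0::'k)) = (if j = i then 1 else 0)"
          using j z e by (auto simp: replace_at_arr basis_apply)
      qed
      also have "\<dots> = 1" using z(2) by simp
      finally show False by simp
    qed
    then show "arrow_le a b" using ab by (auto simp: arrow_le_def par_def)
  qed
next
  assume arrow_le: "\<forall>a b. par a b \<longrightarrow> arrow_le a b"
  show "completely_saturated Q0 Q1 s t Z TYPE('k)"
    unfolding completely_saturated_def B_def[symmetric]
  proof (clarify)
    fix a b z1 z2 assume ab: "(a, b) \<in> arrow_par Q1 s t" and z: "(z1, z2) \<in> Z"
    then have "arrow_le b a" using arrow_le by (auto simp: arrow_par_def par_def)
    then have "(if snd (z1, z2) ! i = b then basis (replace_at (z1, z2) i (arr a)) e else 0) = (0::'k)"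
      if "i < length (snd (z1, z2))" for i e
      using that z replace_at_arr[OF that, of a] by (auto simp: arrow_le_def basis_apply)
    then show "repl B b (arr a) (z1, z2) = (\<lambda>_. 0 :: 'k)"
      unfolding repl_sum by (intro ext sum.neutral ballI) simp
  qed
qed

definition arrow_unit :: "'a \<Rightarrow> 'a \<Rightarrow> 'a \<Rightarrow> 'a \<Rightarrow> 'k::field" where
  "arrow_unit b a = (\<lambda>x y. if x = b \<and> y = a then 1 else 0)"

lemma arrow_unit_symbol_space: "arrow_le a b \<Longrightarrow> arrow_unit b a \<in> symbol_space"
  by (auto simp: symbol_space_def arrow_unit_def)

lemma mat_br_nonzero:
  assumes "mat_br M N c a \<noteq> 0"
  obtains b where "b \<in> Q1" "M c b \<noteq> 0 \<and> N b a \<noteq> 0 \<or> N c b \<noteq> 0 \<and> M b a \<noteq> 0"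
proof -
  have "\<exists>b\<in>Q1. M c b * N b a \<noteq> 0 \<or> N c b * M b a \<noteq> 0"
  proof (rule ccontr)
    assume "\<not> ?thesis"
    then have "(\<Sum>b\<in>Q1. M c b * N b a) = 0" "(\<Sum>b\<in>Q1. N c b * M b a) = 0"
      by (intro sum.neutral ballI; blast)+
    then show False using assms by (simp add: mat_br_def)
  qed
  then obtain b where "b \<in> Q1" "M c b * N b a \<noteq> 0 \<or> N c b * M b a \<noteq> 0" by blast
  then show ?thesis using that[of b] by auto
qed

lemma cobd_zero: "cobd (\<lambda>_. 0) = (\<lambda>c b. 0)"
  by (intro ext) (simp add: cobd_def)

lemma Inn_cobd: "D \<in> Inn \<Longrightarrow> \<exists>x. symbol D = cobd x"
  unfolding Inn_eq using symbol_ad by blast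

lemma Inn_diagonal: "\<lbrakk>D \<in> Inn; c \<noteq> b\<rbrakk> \<Longrightarrow> symbol D c b = 0"
  using Inn_cobd by (fastforce simp: cobd_def)

end

context monomial_algebra begin

text \<open>For distinct arrows [E_cb, E_ba] = E_ca. The symbol space is closed under brackets, and
  its matrices have nonzero entries only where \<open>arrow_le\<close> holds.\<close>

lemma arrow_le_trans:
  assumes "arrow_le a b" "arrow_le b c"
  shows "arrow_le a c"
proof (cases "a = b \<or> b = c \<or> a = c")
  case True
  then show ?thesis using assms arrow_le_refl by (auto simp: arrow_le_def)
next
  case False
  have Q: "b \<in> Q1" using assms by (simp add: arrow_le_def)
  have "(\<Sum>x\<in>Q1. arrow_unit c b c x * arrow_unit b a x a) = (\<Sum>x\<in>Q1. if x = b then 1 else (0::'k))"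
    by (intro sum.cong) (auto simp: arrow_unit_def)
  moreover have "(\<Sum>x\<in>Q1. arrow_unit b a c x * arrow_unit c b x a) = (0::'k)"
    using False by (intro sum.neutral) (auto simp: arrow_unit_def)
  ultimately have "mat_br (arrow_unit c b) (arrow_unit b a) c a = (1::'k)"
    using Q finite_Q1 by (simp add: mat_br_def)
  moreover have "(mat_br (arrow_unit c b) (arrow_unit b a) :: _ \<Rightarrow> _ \<Rightarrow> 'k) \<in> symbol_space"
    using assms by (intro symbol_space_br arrow_unit_symbol_space)
  ultimately show ?thesis unfolding symbol_space_def by (metis (mono_tags, lifting) mem_Collect_eq zero_neq_one)
qed

lemma arrow_unit_der:
  assumes "arrow_le a b"
  obtains D where "D \<in> DerK" "symbol D = arrow_unit b a"
  using symbol_surj[OF arrow_unit_symbol_space[OF assms]] by (auto simp: normalized_def)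

context
  assumes ss: "lie_semisimple (HH1 t B :: (_, 'k) liealg)"
begin

text \<open>The symbols strictly raising the number of predecessors of an arrow form a nilpotent ideal.\<close>

lemma arrow_le_sym:
  assumes ab: "arrow_le a b"
  shows "arrow_le b a"
proof (rule ccontr)
  assume nba: "\<not> arrow_le b a"
  define h where "h a = card {c \<in> Q1. arrow_le c a}" for a
  have fin: "finite {c \<in> Q1. arrow_le c a}" for a using finite_Q1 by simp
  have h_mono: "h x \<le> h y" if "arrow_le x y" for x y
    unfolding h_def using arrow_le_trans[OF _ that] by (intro card_mono fin) auto
  have h_bound: "h x \<le> card Q1" for x
    unfolding h_def using finite_Q1 by (intro card_mono) auto
  have h_strict: "h a < h b"
  proof -
    have "b \<in> Q1" using ab by (simp add: arrow_le_def)
    then have "{c \<in> Q1. arrow_le c a} \<subseteq> {c \<in> Q1. arrow_le c b}" "b \<in> {c \<in> Q1. arrow_le c b}" "b \<notin> {c \<in> Q1. arrow_le c a}"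
      using arrow_le_trans[OF _ ab] nba arrow_le_refl by blast+
    then show ?thesis unfolding h_def by (intro psubset_card_mono fin) blast
  qed
  \<comment> \<open>The gap in \<open>h\<close> is strict already for \<open>k = 0\<close>. Two gaps
    exceeding k add up to one exceeding k + 1, and none exceeds \<open>card Q1\<close>, which bounds
    \<open>h\<close>.\<close>
  define J where "J k = {M :: 'a \<Rightarrow> 'a \<Rightarrow> 'k. \<forall>b a. M b a \<noteq> 0 \<longrightarrow> h a + k < h b}" for k
  obtain D where D: "D \<in> DerK" "symbol D = arrow_unit b a" using arrow_unit_der[OF ab] .
  have "D \<in> Inn"
  proof (rule symbol_chain_Inn[OF ss, of J "card Q1"])
    show "(\<lambda>c b. 0) \<in> J k" for k by (simp add: J_def)
    show "(\<lambda>c b. M c b + N c b) \<in> J k" if "M \<in> J k" "N \<in> J k" for k M N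
      unfolding J_def
    proof (clarify)
      fix x y assume "M x y + N x y \<noteq> 0"
      then have "M x y \<noteq> 0 \<or> N x y \<noteq> 0" by auto
      then show "h y + k < h x" using that by (auto simp: J_def)
    qed
    show "(\<lambda>c b. r * M c b) \<in> J k" if "M \<in> J k" for k M r using that by (simp add: J_def)
    show "mat_br M N \<in> J 0" if M: "M \<in> symbol_space" and N: "N \<in> J 0" for M N
      unfolding J_def
    proof (clarify)
      fix c a assume "mat_br M N c a \<noteq> 0"
      then obtain b where "M c b \<noteq> 0 \<and> N b a \<noteq> 0 \<or> N c b \<noteq> 0 \<and> M b a \<noteq> 0" using mat_br_nonzero by metis
      moreover have "M u v \<noteq> 0 \<Longrightarrow> h v \<le> h u" for u v using M h_mono by (auto simp: symbol_space_def)
      moreover have "N u v \<noteq> 0 \<Longrightarrow> h v < h u" for u v using N by (auto simp: J_def)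
      ultimately show "h a + 0 < h c" by fastforce
    qed
    show "mat_br M N \<in> J (Suc k)" if M: "M \<in> J k" and N: "N \<in> J k" for k M N
      unfolding J_def
    proof (clarify)
      fix c a assume "mat_br M N c a \<noteq> 0"
      then obtain b where "M c b \<noteq> 0 \<and> N b a \<noteq> 0 \<or> N c b \<noteq> 0 \<and> M b a \<noteq> 0" using mat_br_nonzero by metis
      moreover have "M u v \<noteq> 0 \<Longrightarrow> h v + k < h u" "N u v \<noteq> 0 \<Longrightarrow> h v + k < h u" for u v
        using M N by (auto simp: J_def)
      ultimately show "h a + Suc k < h c" by fastforce
    qed
    show "\<exists>x. M = cobd x" if "M \<in> J (card Q1)" for M
    proof -
      have "M x y = 0" for x y
      proof (rule ccontr)
        assume "M x y \<noteq> 0"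
        then have "h y + card Q1 < h x" using that by (auto simp: J_def)
        then show False using h_bound[of x] by simp
      qed
      then have "M = cobd (\<lambda>_. 0)" by (auto simp: cobd_def intro!: ext)
      then show ?thesis by blast
    qed
    show "D \<in> DerK" by (rule D)
    show "symbol D \<in> J 0" using h_strict by (auto simp: D J_def arrow_unit_def split: if_splits)
  qed
  moreover have "a \<noteq> b" using h_strict by auto
  ultimately have "arrow_unit b a b a = (0::'k)" using Inn_diagonal[of D b a] D by simp
  then show False by (simp add: arrow_unit_def)
qed

text \<open>For diagonal \<open>N\<close> one has [M, N]_ca = M_ca (N_aa - N_cc). A nonzero entry
  M_ca of a symbol means \<open>arrow_le a c\<close>, so the diagonal matrices considered commute
  with all symbols and give an abelian ideal.\<close>

lemma diagonal_Inn:
  assumes D: "D \<in> DerK" and diag: "\<And>c b. c \<noteq> b \<Longrightarrow> symbol D c b = 0"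
    and const: "\<And>a b. arrow_le a b \<Longrightarrow> symbol D a a = symbol D b b"
  shows "D \<in> Inn"
proof -
  \<comment> \<open>\<open>J 0\<close> is the space of these matrices and every later
    \<open>J k\<close> is zero, so the chain has a single step.\<close>
  define J where "J k = {M :: 'a \<Rightarrow> 'a \<Rightarrow> 'k. (\<forall>c b. c \<noteq> b \<longrightarrow> M c b = 0)
      \<and> (\<forall>a b. arrow_le a b \<longrightarrow> M a a = M b b) \<and> (k \<noteq> (0::nat) \<longrightarrow> M = (\<lambda>c b. 0))}" for k
  have br0: "mat_br M N = (\<lambda>c b. 0)" if M: "M \<in> symbol_space" and N: "N \<in> J 0" for M N
  proof (intro ext)
    fix c a
    have Nd: "N x y = (if x = y then N x x else 0)" for x y using N by (auto simp: J_def)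
    show "mat_br M N c a = 0"
    proof (cases "c \<in> Q1 \<and> a \<in> Q1")
      case True
      have "(\<Sum>b\<in>Q1. M c b * N b a) = (\<Sum>b\<in>Q1. if b = a then M c a * N a a else 0)"
        by (intro sum.cong refl) (subst Nd, simp)
      moreover have "(\<Sum>b\<in>Q1. N c b * M b a) = (\<Sum>b\<in>Q1. if b = c then N c c * M c a else 0)"
        by (intro sum.cong refl) (subst Nd, simp)
      ultimately have eq: "mat_br M N c a = M c a * (N a a - N c c)"
        using True finite_Q1 by (simp add: mat_br_def algebra_simps)
      show ?thesis
      proof (cases "M c a = 0")
        case False
        then have "arrow_le a c" using M by (auto simp: symbol_space_def)
        then have "N a a = N c c" using N by (auto simp: J_def)
        then show ?thesis using eq by simp
      qed (use eq in simp)
    next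
      case False
      have "M c b * N b a = 0" "N c b * M b a = 0" if "b \<in> Q1" for b
      proof -
        have "M x y = 0" if "x \<notin> Q1 \<or> y \<notin> Q1" for x y using M that by (auto simp: symbol_space_def arrow_le_def)
        then show "M c b * N b a = 0" "N c b * M b a = 0"
          using False that by (subst Nd, auto)+
      qed
      then have "(\<Sum>b\<in>Q1. M c b * N b a) = 0" "(\<Sum>b\<in>Q1. N c b * M b a) = 0"
        by (intro sum.neutral ballI; blast)+
      then show ?thesis by (simp add: mat_br_def)
    qed
  qed
  show ?thesis
  proof (rule symbol_chain_Inn[OF ss, of J 1])
    show "(\<lambda>c b. 0) \<in> J k" for k by (simp add: J_def)
    show "(\<lambda>c b. M c b + N c b) \<in> J k" if "M \<in> J k" "N \<in> J k" for k M N
      using that unfolding J_def by auto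
    show "(\<lambda>c b. r * M c b) \<in> J k" if "M \<in> J k" for k M r
      using that unfolding J_def by auto
    show "mat_br M N \<in> J 0" if "M \<in> symbol_space" "N \<in> J 0" for M N
      unfolding br0[OF that] by (simp add: J_def)
    show "mat_br M N \<in> J (Suc k)" if "M \<in> symbol_space" "N \<in> J k" for k M N
    proof -
      have "N \<in> J 0" using that(2) by (simp add: J_def)
      then show ?thesis using br0[OF that(1)] by (simp add: J_def)
    qed
    show "\<exists>x. M = cobd x" if "M \<in> J 1" for M
      using that by (intro exI[of _ "\<lambda>_. 0"]) (simp add: J_def cobd_zero)
    show "D \<in> DerK" by (rule D)
    show "symbol D \<in> J 0" using diag const by (simp add: J_def)
  qed
qed

text \<open>The diagonal matrix of \<open>f\<close> is the symbol of a derivation, which is inner by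
  \<open>diagonal_Inn\<close>; symbols of inner derivations are coboundaries.\<close>

lemma class_function_cobd:
  assumes const: "\<And>a b. arrow_le a b \<Longrightarrow> f a = f b"
  obtains x :: "'v \<Rightarrow> 'k" where "\<And>a. a \<in> Q1 \<Longrightarrow> f a = x (s a) - x (t a)"
proof -
  define M where "M = (\<lambda>c b. if c = b \<and> b \<in> Q1 then f b else 0)"
  have "M \<in> symbol_space" using arrow_le_refl by (auto simp: symbol_space_def M_def)
  then obtain D where "normalized D" and D: "symbol D = M" by (rule symbol_surj)
  then have Der: "D \<in> DerK" by (simp add: normalized_def)
  have "D \<in> Inn"
  proof (rule diagonal_Inn[OF Der])
    show "symbol D c b = 0" if "c \<noteq> b" for c b using that by (simp add: D M_def)
    show "symbol D a a = symbol D b b" if "arrow_le a b" for a b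
      using const[OF that] arrow_le_par[OF that] by (simp add: D M_def par_def)
  qed
  from Inn_cobd[OF this] obtain x where "M = cobd x" using D by auto
  then have "M a a = cobd x a a" for a by simp
  then have "f a = x (s a) - x (t a)" if "a \<in> Q1" for a
    using that unfolding M_def cobd_def by presburger
  then show ?thesis using that by blast
qed

text \<open>The indicator of the arrows above \<open>a\<close> is constant on the classes of the
  preorder, by its symmetry. Being a coboundary, it takes equal values on arrows with equal
  ends.\<close>

lemma semisimple_par_arrow_le:
  assumes ab: "par a b"
  shows "arrow_le a b"
proof -
  define f where "f c = (if arrow_le a c then 1 else (0::'k))" for c
  have "f c = f d" if "arrow_le c d" for c d
  proof -
    have "arrow_le a c \<longleftrightarrow> arrow_le a d" using arrow_le_trans[OF _ that] arrow_le_trans[OF _ arrow_le_sym[OF that]] by blast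
    then show ?thesis by (simp add: f_def)
  qed
  then obtain x where "\<And>a. a \<in> Q1 \<Longrightarrow> f a = x (s a) - x (t a)"
    using class_function_cobd[of f] by metis
  then have "f a = f b" using ab by (simp add: par_def)
  then show ?thesis using arrow_le_refl[of a] ab by (auto simp: f_def par_def split: if_splits)
qed

text \<open>Given a cycle, the indicator of the parallel class of its first edge is the coboundary
  of some \<open>x\<close>. Then \<open>x\<close> is constant along the remaining edges, so it
  agrees at both ends of the first edge, where the difference should be 1.\<close>

lemma semisimple_Qbar_tree:
  assumes conn: "quiver_connected Q0 Q1 s t"
  shows "Qbar_is_tree Q0 Q1 s t"
proof -
  \<comment> \<open>Choosing by the pair of ends gives all arrows of a class the same
    representative.\<close>
  define r where "r u v = (SOME b. b \<in> Q1 \<and> s b = u \<and> t b = v)" for u v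
  have r: "r (s a) (t a) \<in> Q1 \<and> s (r (s a) (t a)) = s a \<and> t (r (s a) (t a)) = t a" if "a \<in> Q1" for a
    unfolding r_def by (rule someI[of _ a]) (simp add: that)
  define R where "R = {r (s a) (t a) | a. a \<in> Q1}"
  have RQ: "R \<subseteq> Q1" using r by (auto simp: R_def)
  have "a = r (s a) (t a)" if aR: "a \<in> R" for a
  proof -
    obtain c where "c \<in> Q1" "a = r (s c) (t c)" using aR by (auto simp: R_def)
    then show ?thesis using r[of c] by simp
  qed
  then have R_unique: "a = b" if "a \<in> R" "b \<in> R" "s a = s b" "t a = t b" for a b
    using that by metis
  have "card (C \<inter> R) = 1" if C: "C \<in> par_classes Q1 s t" for C
  proof -
    obtain a where a: "a \<in> Q1" "C = {b. par a b}" using C by (auto simp: par_classes_iff)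
    have "r (s a) (t a) \<in> C \<inter> R" using r[OF a(1)] a by (auto simp: par_def R_def)
    moreover have "x = r (s a) (t a)" if "x \<in> C \<inter> R" for x
    proof -
      have "x \<in> R" "s x = s a" "t x = t a" using that by (simp_all add: a par_def)
      then show ?thesis
        using R_unique[of x "r (s a) (t a)"] \<open>r (s a) (t a) \<in> C \<inter> R\<close> r[OF a(1)] by simp
    qed
    ultimately have "C \<inter> R = {r (s a) (t a)}" by blast
    then show ?thesis by simp
  qed
  moreover have "quiver_connected Q0 R s t"
  proof -
    have "{(s a, t a) |a. a \<in> R} = {(s a, t a) |a. a \<in> Q1}" "{(t a, s a) |a. a \<in> R} = {(t a, s a) |a. a \<in> Q1}"
      using r RQ by (auto simp: R_def) metis+
    then show ?thesis using conn by (simp add: quiver_connected_def)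
  qed
  moreover have False if cyc: "unoriented_cycle Q0 R s t es vs" for es vs
  proof -
    let ?n = "length es"
    have es: "es \<noteq> []" "distinct es" "set es \<subseteq> R"
      and edge: "\<And>i. i < ?n \<Longrightarrow> {s (es ! i), t (es ! i)} = {vs ! i, vs ! (Suc i mod ?n)}"
      using cyc by (auto simp: unoriented_cycle_def)
    have n: "0 < ?n" using es by simp
    define f where "f a = (if par (es ! 0) a then 1 else (0::'k))" for a
    have "f c = f d" if "arrow_le c d" for c d
      using arrow_le_par[OF that] by (auto simp: f_def par_def)
    then obtain x where x: "\<And>a. a \<in> Q1 \<Longrightarrow> f a = x (s a) - x (t a)"
      using class_function_cobd[of f] by metis
    have esR: "es ! i \<in> R" if "i < ?n" for i using es that by (auto simp: subset_iff)
    have step: "x (vs ! i) = x (vs ! (Suc i mod ?n))" if "i < ?n" "f (es ! i) = 0" for i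
    proof -
      have "x (s (es ! i)) = x (t (es ! i))" using x[of "es ! i"] esR[OF that(1)] RQ that(2) by auto
      then show ?thesis using edge[OF that(1)] by (metis doubleton_eq_iff)
    qed
    \<comment> \<open>The walk starts at the vertex with index \<open>1 mod ?n\<close> and avoids
      edge 0; \<open>i = ?n - 1\<close> leads back to vertex 0. Reduction modulo \<open>?n\<close>
      also covers loops.\<close>
    have "x (vs ! (Suc i mod ?n)) = x (vs ! (1 mod ?n))" if "i < ?n" for i
      using that
    proof (induction i)
      case (Suc i)
      have "f (es ! Suc i) = 0"
      proof -
        have "es ! Suc i \<noteq> es ! 0" using Suc(2) es(2) n by (simp add: nth_eq_iff_index_eq)
        then show ?thesis
          using R_unique[OF esR[OF n] esR[OF Suc(2)]] by (auto simp: f_def par_def)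
      qed
      then show ?case using step[OF Suc(2)] Suc by simp
    qed simp
    from this[of "?n - 1"] have "x (vs ! 0) = x (vs ! (Suc 0 mod ?n))" using n by simp
    then have "x (s (es ! 0)) = x (t (es ! 0))" using edge[OF n] by (metis doubleton_eq_iff)
    moreover have "f (es ! 0) = 1" using esR[OF n] RQ by (auto simp: f_def par_def)
    ultimately show False using x[of "es ! 0"] esR[OF n] RQ by auto
  qed
  ultimately show ?thesis
    unfolding Qbar_is_tree_def quiver_is_tree_def using RQ by blast
qed

text \<open>If parallel arrows are equal, every symbol is diagonal and \<open>diagonal_Inn\<close>
  makes all derivations inner; but a semisimple algebra is nonzero.\<close>

lemma semisimple_big_class: "\<exists>C\<in>par_classes Q1 s t. card C \<ge> 2"
proof (rule ccontr)
  assume small: "\<not> ?thesis"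
  interpret H: lie_algebra_ideal "Der_lie t B :: (_, 'k) liealg" Inn by (rule lie_algebra_ideal_HH1)
  have eq: "a = b" if "par a b" for a b
  proof (rule ccontr)
    assume "a \<noteq> b"
    moreover have "a \<in> Q1" using that by (simp add: par_def)
    moreover have "{a, b} \<subseteq> {c. par a c}" using that by (auto simp: par_def)
    ultimately have "2 \<le> card {c. par a c}"
      using card_mono[OF par_class_finite[OF par_class_self[of a]], of "{a, b}"] by simp
    then show False using small par_class_self[OF \<open>a \<in> Q1\<close>] by blast
  qed
  have "D \<in> Inn" if D: "D \<in> DerK" for D
  proof (rule diagonal_Inn[OF D])
    show "symbol D c b = 0" if "c \<noteq> b" for c b
    proof (rule ccontr)
      assume "symbol D c b \<noteq> 0"
      then have "arrow_le b c" using symbol_symbol_space[OF D] by (auto simp: symbol_space_def)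
      then show False using eq arrow_le_par that by blast
    qed
    show "symbol D a a = symbol D b b" if "arrow_le a b" for a b using eq[OF arrow_le_par[OF that]] by simp
  qed
  then have "lcar (HH1 t B :: (_, 'k) liealg) = {lzero (HH1 t B)}"
    unfolding HH1_eq H.quot_trivial_iff by (auto simp: Der_lie_simps)
  then show False using ss by (simp add: lie_semisimple_def)
qed

text \<open>In characteristic 2 the Lie algebra gl(2) is solvable, so a class of two arrows would
  give a solvable ideal containing a derivation with symbol \<open>arrow_unit q p\<close>. Symbols
  of inner derivations are diagonal, a contradiction.\<close>

lemma semisimple_char_2:
  assumes ch: "(2::'k) = 0" and C: "C \<in> par_classes Q1 s t"
  shows "card C \<noteq> 2"
proof
  assume "card C = 2"
  then obtain p q where pq: "C = {p, q}" "p \<noteq> q" by (auto simp: card_2_iff)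
  have parC: "a \<in> C \<longleftrightarrow> b \<in> C" if "arrow_le a b" for a b
    using arrow_le_par[OF that] C by (auto simp: par_classes_iff par_def)
  have CQ: "C \<subseteq> Q1" using C by (auto simp: par_classes_iff par_def)
  define blk where "blk M \<longleftrightarrow> (\<forall>b a. M b a \<noteq> 0 \<longrightarrow> a \<in> C \<and> b \<in> C)" for M :: "'a \<Rightarrow> 'a \<Rightarrow> 'k"
  \<comment> \<open>The chain is gl(2), trace zero, diagonal of trace zero, zero. In characteristic
    2 trace zero means equal diagonal entries, and this kills the off-diagonal entries of
    brackets.\<close>
  define J where "J k = {M. blk M \<and> (k \<ge> 1 \<longrightarrow> M p p + M q q = 0) \<and> (k \<ge> 2 \<longrightarrow> M p q = 0 \<and> M q p = 0)
      \<and> (k \<ge> 3 \<longrightarrow> M = (\<lambda>c b. 0))}" for k :: nat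
  have blk_zero: "M c a = 0" if "blk M" "c \<notin> C \<or> a \<notin> C" for M c a using that by (auto simp: blk_def)
  have sum2: "(\<Sum>b\<in>Q1. M c b * N b a) = M c p * N p a + M c q * N q a" if "blk M" for M N c a
  proof -
    have "(\<Sum>b\<in>Q1. M c b * N b a) = (\<Sum>b\<in>C. M c b * N b a)"
      using blk_zero[OF that] CQ finite_Q1 by (intro sum.mono_neutral_right) auto
    then show ?thesis using pq by simp
  qed
  have mbr2: "mat_br M N c a = M c p * N p a + M c q * N q a - (N c p * M p a + N c q * M q a)"
    if "blk M" "blk N" for M N c a
    using that by (simp add: mat_br_def sum2)
  have blk_br: "blk (mat_br M N)" if M: "M \<in> symbol_space" and N: "blk N" for M N
    unfolding blk_def
  proof (intro allI impI)
    fix c a assume "mat_br M N c a \<noteq> 0"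
    then obtain b where "M c b \<noteq> 0 \<and> N b a \<noteq> 0 \<or> N c b \<noteq> 0 \<and> M b a \<noteq> 0" using mat_br_nonzero by metis
    moreover have "M u v \<noteq> 0 \<Longrightarrow> arrow_le v u" for u v using M by (auto simp: symbol_space_def)
    ultimately show "a \<in> C \<and> c \<in> C" using N parC unfolding blk_def by blast
  qed
  have two: "x + x = 0" for x :: 'k
    using ch by (metis mult_2 mult_zero_left)
  have neg: "- x = x" for x :: 'k
    using two[of x] by (simp add: neg_eq_iff_add_eq_0)
  have eq_of_sum: "x = y" if "x + y = 0" for x y :: 'k
    using that neg[of y] by (simp add: eq_neg_iff_add_eq_0[symmetric])
  have p: "p \<in> C" and q: "q \<in> C" using pq by auto
  have "par p q" using C p q by (auto simp: par_classes_iff par_def)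
  then have arrow_le: "arrow_le p q" by (rule semisimple_par_arrow_le)
  obtain D where D: "D \<in> DerK" "symbol D = arrow_unit q p" using arrow_unit_der[OF arrow_le] .
  have "D \<in> Inn"
  proof (rule symbol_chain_Inn[OF ss, of J 3])
    show "(\<lambda>c b. 0) \<in> J k" for k by (simp add: J_def blk_def)
    show "(\<lambda>c b. M c b + N c b) \<in> J k" if "M \<in> J k" "N \<in> J k" for k M N
    proof -
      have "blk (\<lambda>c b. M c b + N c b)"
        unfolding blk_def
      proof (intro allI impI)
        fix x y assume "M x y + N x y \<noteq> 0"
        then have "M x y \<noteq> 0 \<or> N x y \<noteq> 0" by auto
        then show "y \<in> C \<and> x \<in> C" using that by (auto simp: J_def blk_def)
      qed
      moreover have "M p p + N p p + (M q q + N q q) = 0" if "M p p + M q q = 0" "N p p + N q q = 0"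
        using that by algebra
      ultimately show ?thesis using that by (simp add: J_def)
    qed
    show "(\<lambda>c b. r * M c b) \<in> J k" if "M \<in> J k" for k M r
      using that by (auto simp: J_def blk_def distrib_left[symmetric])
    show "mat_br M N \<in> J 0" if "M \<in> symbol_space" "N \<in> J 0" for M N
      using blk_br that by (simp add: J_def)
    show "mat_br M N \<in> J (Suc k)" if G: "M \<in> symbol_space" and M: "M \<in> J k" and N: "N \<in> J k" for k M N
    proof -
      have b: "blk M" "blk N" using M N by (simp_all add: J_def)
      have 1: "mat_br M N p p + mat_br M N q q = 0"
        unfolding mbr2[OF b] by (simp add: algebra_simps)
      have 2: "mat_br M N p q = 0 \<and> mat_br M N q p = 0" if "k \<ge> 1"
      proof -
        have "M p p = M q q" "N p p = N q q" using M N that eq_of_sum by (auto simp: J_def)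
        then show ?thesis unfolding mbr2[OF b] by (simp add: algebra_simps)
      qed
      have 3: "mat_br M N = (\<lambda>c b. 0)" if "k \<ge> 2"
      proof (intro ext)
        fix c a
        have "M p q = 0" "M q p = 0" "N p q = 0" "N q p = 0" using M N that by (auto simp: J_def)
        then show "mat_br M N c a = 0"
          using blk_zero[OF blk_br[OF G b(2)], of c a] unfolding mbr2[OF b] pq
          by (cases "c \<in> {p, q} \<and> a \<in> {p, q}") (auto simp: algebra_simps)
      qed
      show ?thesis using blk_br[OF G b(2)] 1 2 3 by (simp add: J_def)
    qed
    show "\<exists>x. M = cobd x" if "M \<in> J 3" for M
      using that by (intro exI[of _ "\<lambda>_. 0"]) (simp add: J_def cobd_zero)
    show "D \<in> DerK" by (rule D)
    show "symbol D \<in> J 0" using pq by (auto simp: D J_def blk_def arrow_unit_def split: if_splits)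
  qed
  then have "arrow_unit q p q p = (0::'k)" using Inn_diagonal[of D q p] D pq by simp
  then show False by (simp add: arrow_unit_def)
qed

end
end

section \<open>Trees and coboundaries\<close>

definition adjacent :: "'a set \<Rightarrow> ('a \<Rightarrow> 'v) \<Rightarrow> ('a \<Rightarrow> 'v) \<Rightarrow> ('v \<times> 'v) set" where
  "adjacent R s t = {(s a, t a) | a. a \<in> R} \<union> {(t a, s a) | a. a \<in> R}"

text \<open>The walk is shortened while it is built: on reaching a vertex already visited, the part
  after that vertex is cut off.\<close>

lemma adjacent_simple_path:
  assumes "(u, v) \<in> (adjacent R s t)\<^sup>*" and "u \<in> Q0" and R: "s ` R \<subseteq> Q0" "t ` R \<subseteq> Q0"
  shows "\<exists>es vs. length vs = Suc (length es) \<and> vs ! 0 = u \<and> vs ! length es = v \<and> distinct vs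
    \<and> set vs \<subseteq> Q0 \<and> set es \<subseteq> R \<and> (\<forall>i<length es. {s (es ! i), t (es ! i)} = {vs ! i, vs ! Suc i})"
  using assms(1)
proof (induction rule: rtrancl_induct)
  case base
  then show ?case using assms(2) by (intro exI[of _ "[]"] exI[of _ "[u]"]) simp
next
  case (step y z)
  obtain es vs where IH: "length vs = Suc (length es)" "vs ! 0 = u" "vs ! length es = y" "distinct vs"
    "set vs \<subseteq> Q0" "set es \<subseteq> R" "\<And>i. i < length es \<Longrightarrow> {s (es ! i), t (es ! i)} = {vs ! i, vs ! Suc i}"
    using step.IH by blast
  obtain e where e: "e \<in> R" "{s e, t e} = {y, z}" using step(2) by (auto simp: adjacent_def)
  show ?case
  proof (cases "z \<in> set vs")
    case True
    then obtain k where k: "k < length vs" "vs ! k = z" by (auto simp: in_set_conv_nth)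
    have "k \<le> length es" using k IH(1) by simp
    then show ?thesis
      using IH k by (intro exI[of _ "take k es"] exI[of _ "take (Suc k) vs"])
        (auto dest: in_set_takeD)
  next
    case False
    have "z \<in> Q0" using e R by (metis doubleton_eq_iff image_subset_iff)
    then show ?thesis
      using IH e False by (intro exI[of _ "es @ [e]"] exI[of _ "vs @ [z]"]) (auto simp: nth_append less_Suc_eq)
  qed
qed

text \<open>A simple path from \<open>t e\<close> to \<open>s e\<close> inside \<open>R\<close>
  would close up with \<open>e\<close> to a cycle. For a loop the path is empty and the cycle is
  \<open>[e]\<close>.\<close>

lemma acyclic_edge_disconnects:
  assumes acyc: "\<And>es vs. \<not> unoriented_cycle Q0 (insert e R) s t es vs"
    and R: "s ` insert e R \<subseteq> Q0" "t ` insert e R \<subseteq> Q0" and e: "e \<notin> R"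
  shows "(t e, s e) \<notin> (adjacent R s t)\<^sup>*"
proof
  assume "(t e, s e) \<in> (adjacent R s t)\<^sup>*"
  from adjacent_simple_path[OF this, of Q0] R obtain es vs where P: "length vs = Suc (length es)"
    "vs ! 0 = t e" "vs ! length es = s e" "distinct vs" "set vs \<subseteq> Q0" "set es \<subseteq> R"
    "\<And>i. i < length es \<Longrightarrow> {s (es ! i), t (es ! i)} = {vs ! i, vs ! Suc i}" by auto
  \<comment> \<open>A repeated edge would join two different pairs of consecutive vertices, which
    the distinctness of \<open>vs\<close> excludes.\<close>
  have "distinct es"
    unfolding distinct_conv_nth
  proof (intro allI impI notI)
    fix i j assume ij: "i < length es" "j < length es" "i \<noteq> j" "es ! i = es ! j"
    then have "{vs ! i, vs ! Suc i} = {vs ! j, vs ! Suc j}" using P(7) by metis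
    moreover have "vs ! a = vs ! b \<longleftrightarrow> a = b" if "a \<le> length es" "b \<le> length es" for a b
      using that P(1,4) by (simp add: nth_eq_iff_index_eq)
    ultimately show False using ij by (auto simp: doubleton_eq_iff)
  qed
  moreover have "{s ((es @ [e]) ! i), t ((es @ [e]) ! i)} = {vs ! i, vs ! (Suc i mod Suc (length es))}"
    if "i < Suc (length es)" for i
  proof (cases "i = length es")
    case True
    then show ?thesis using P by (simp add: insert_commute)
  next
    case False
    then show ?thesis using P(7)[of i] that by (simp add: nth_append)
  qed
  ultimately have "unoriented_cycle Q0 (insert e R) s t (es @ [e]) vs"
    using P(1,4,5,6) e unfolding unoriented_cycle_def by auto
  then show False using acyc by blast
qed

text \<open>A new edge \<open>e\<close> joins two different components, so shifting the potential by
  a constant on the component of \<open>t e\<close> corrects the value at \<open>e\<close> and keeps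
  the others. Values lie in any abelian group, as both the field and the integers occur
  later.\<close>

lemma acyclic_cobd:
  fixes f :: "'a \<Rightarrow> 'c::ab_group_add"
  assumes "finite R" "\<And>es vs. \<not> unoriented_cycle Q0 R s t es vs" "s ` R \<subseteq> Q0" "t ` R \<subseteq> Q0"
  shows "\<exists>x. \<forall>a\<in>R. f a = x (s a) - x (t a)"
  using assms
proof (induction R rule: finite_induct)
  case (insert e R)
  have "\<not> unoriented_cycle Q0 R s t es vs" for es vs
    using insert(4)[of es vs] by (auto simp: unoriented_cycle_def)
  then obtain x where x: "\<forall>a\<in>R. f a = x (s a) - x (t a)" using insert by auto
  have nc: "(t e, s e) \<notin> (adjacent R s t)\<^sup>*"
    by (rule acyclic_edge_disconnects[OF insert(4,5,6,2)])
  define d where "d = f e - (x (s e) - x (t e))"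
  define comp where "comp = {v. (t e, v) \<in> (adjacent R s t)\<^sup>*}"
  define x' where "x' v = x v - (if v \<in> comp then d else 0)" for v
  have "s a \<in> comp \<longleftrightarrow> t a \<in> comp" if "a \<in> R" for a
  proof -
    have "(s a, t a) \<in> adjacent R s t" "(t a, s a) \<in> adjacent R s t" using that by (auto simp: adjacent_def)
    then show ?thesis by (auto simp: comp_def intro: rtrancl_into_rtrancl)
  qed
  then have "f a = x' (s a) - x' (t a)" if "a \<in> R" for a
    using that x by (auto simp: x'_def)
  moreover have "f e = x' (s e) - x' (t e)"
    using nc by (simp add: x'_def comp_def d_def)
  ultimately show ?case by (intro exI[of _ x']) auto
qed simp

context monomial_quiver begin

lemma tree_class_cobd:
  fixes f :: "'a \<Rightarrow> 'c::ab_group_add"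
  assumes tree: "Qbar_is_tree Q0 Q1 s t" and const: "\<And>a b. par a b \<Longrightarrow> f a = f b"
  obtains x where "\<And>a. a \<in> Q1 \<Longrightarrow> f a = x (s a) - x (t a)"
proof -
  obtain R where R: "R \<subseteq> Q1" "\<And>C. C \<in> par_classes Q1 s t \<Longrightarrow> card (C \<inter> R) = 1" "quiver_is_tree Q0 R s t"
    using tree by (auto simp: Qbar_is_tree_def)
  have "\<exists>x. \<forall>a\<in>R. f a = x (s a) - x (t a)"
  proof (rule acyclic_cobd)
    show "finite R" using R(1) finite_Q1 by (rule finite_subset)
    show "\<not> unoriented_cycle Q0 R s t es vs" for es vs using R(3) by (auto simp: quiver_is_tree_def)
    show "s ` R \<subseteq> Q0" "t ` R \<subseteq> Q0" using R(1) endpoints by auto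
  qed
  then obtain x where x: "\<And>a. a \<in> R \<Longrightarrow> f a = x (s a) - x (t a)" by blast
  have "f a = x (s a) - x (t a)" if a: "a \<in> Q1" for a
  proof -
    have "{b. par a b} \<inter> R \<noteq> {}" using R(2)[OF par_class_self[OF a]] by auto
    then obtain b where "par a b" "b \<in> R" by blast
    then show ?thesis using x[of b] const[of a b] by (simp add: par_def)
  qed
  then show ?thesis using that by blast
qed

lemma tree_parallel_length:
  assumes tree: "Qbar_is_tree Q0 Q1 s t" and p: "path p" and a: "a \<in> Q1" "fst p = s a" "tgt p = t a"
  shows "length (snd p) = 1"
proof -
  \<comment> \<open>Integers, because the length itself must be recovered and not its residue modulo
    the characteristic.\<close>
  obtain x :: "'v \<Rightarrow> int" where x: "\<And>a. a \<in> Q1 \<Longrightarrow> 1 = x (s a) - x (t a)"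
    using tree_class_cobd[OF tree, of "\<lambda>_. 1 :: int"] by auto
  have "path (v, as) \<Longrightarrow> int (length as) = x v - x (tgt (v, as))" for v as
  proof (induction as arbitrary: v)
    case (Cons b as)
    then show ?case using x[of b] by auto
  qed simp
  then have "int (length (snd p)) = x (fst p) - x (tgt p)" using p by (metis prod.collapse)
  then show ?thesis using x[OF a(1)] a by simp
qed

text \<open>Only paths of length one are parallel to an arrow, so a normalized derivation maps
  arrows to combinations of arrows, and the symbol records all coefficients.\<close>

lemma tree_normalized_ext:
  assumes tree: "Qbar_is_tree Q0 Q1 s t" and D: "normalized D" and E: "normalized E" and symbol: "symbol D = symbol E"
  shows "D = E"
proof (rule normalized_ext[OF D E])
  fix a assume a: "a \<in> Q1"
  have *: "F (basis (arr a)) r = 0" if F: "normalized F" and r: "r \<notin> arr ` Q1"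
    for F :: "(('v,'a) qpath \<Rightarrow> 'b) \<Rightarrow> ('v,'a) qpath \<Rightarrow> 'b" and r
  proof (rule ccontr)
    assume "F (basis (arr a)) r \<noteq> 0"
    then have "arrow_vals F (a, r) \<noteq> 0" using a by (simp add: arrow_vals_def)
    note supp = par_suppD[OF arrow_vals_par[OF F] this]
    have "length (snd r) = 1"
      using tree_parallel_length[OF tree B_path[OF supp(2)] a supp(3,4)] .
    then show False using length_one_arr[OF B_path[OF supp(2)]] r by blast
  qed
  show "D (basis (arr a)) = E (basis (arr a))"
  proof
    fix r
    show "D (basis (arr a)) r = E (basis (arr a)) r"
    proof (cases "r \<in> arr ` Q1")
      case True
      then obtain c where c: "c \<in> Q1" "r = arr c" by blast
      have "symbol D c a = symbol E c a" using symbol by simp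
      then show ?thesis using a c by (simp add: symbol_def)
    next
      case False
      then show ?thesis using *[OF D False] *[OF E False] by simp
    qed
  qed
qed

text \<open>By \<open>tree_normalized_ext\<close> it is enough to match the symbol of the normalized
  part. The vertex coefficients of \<open>y\<close> already contribute a coboundary, hence
  \<open>w\<close> carries the difference to \<open>x\<close>.\<close>

lemma tree_cobd_Inn:
  assumes tree: "Qbar_is_tree Q0 Q1 s t" and D: "D \<in> Der" and symbol: "symbol D = cobd x"
  shows "D \<in> Inn"
proof -
  interpret H: lie_algebra_ideal "Der_lie t B" Inn by (rule lie_algebra_ideal_HH1)
  obtain D0 y where D0: "normalized D0" and y: "y \<in> Lam B" and eq: "D = (\<lambda>x p. D0 x p + ad y x p)"
    using normalize[OF D] .
  define w where "w = (\<lambda>(v, as). if v \<in> Q0 \<and> as = ([] :: 'a list) then x v - y (v, []) else 0)"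
  have w: "w \<in> Lam B" by (auto simp: Lam_def w_def)
  have "ad w (basis (v, [])) r = 0" for v r
  proof -
    have "w r = 0" if "fst r \<noteq> tgt r" using that by (cases r) (auto simp: w_def)
    then show ?thesis by (simp add: ad_def mul_vertex_left[OF w] mul_vertex_right[OF w])
  qed
  then have "normalized (ad w)" using ad_der[OF w] by (auto simp: normalized_def)
  moreover have "symbol D0 = symbol (ad w)"
  proof (intro ext)
    fix c b
    have "symbol D c b = symbol D0 c b + symbol (ad y) c b" by (simp add: eq symbol_add)
    then have "symbol D0 c b = cobd x c b - cobd (\<lambda>v. y (v, [])) c b"
      by (simp add: symbol symbol_ad[OF y])
    also have "\<dots> = cobd (\<lambda>v. w (v, [])) c b" using endpoints by (auto simp: cobd_def w_def)
    finally show "symbol D0 c b = symbol (ad w) c b" by (simp add: symbol_ad[OF w])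
  qed
  ultimately have "D0 = ad w" using tree_normalized_ext[OF tree D0] by blast
  then have "D = ladd (Der_lie t B) (ad w) (ad y)" by (simp add: eq Der_lie_simps)
  moreover have "ad w \<in> Inn" "ad y \<in> Inn" using w y by (simp_all add: Inn_eq)
  ultimately show ?thesis using H.ideal_add by blast
qed

text \<open>\<open>pgl\<close> uses the indices 0, ..., n - 1, so the arrows of each class are
  numbered in an arbitrary way.\<close>

definition class_enum :: "'a set \<Rightarrow> nat \<Rightarrow> 'a" where
  "class_enum C = (SOME h. bij_betw h {..<card C} C)"

definition class_block :: "'a set \<Rightarrow> ('a \<Rightarrow> 'a \<Rightarrow> 'k::field) \<Rightarrow> nat \<Rightarrow> nat \<Rightarrow> 'k" where
  "class_block C M = (\<lambda>i j. if i < card C \<and> j < card C then M (class_enum C i) (class_enum C j) else 0)"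

lemma class_enum_bij: "C \<in> par_classes Q1 s t \<Longrightarrow> bij_betw (class_enum C) {..<card C} C"
  unfolding class_enum_def using ex_bij_betw_nat_finite[OF par_class_finite, of C]
  by (intro someI_ex[of "\<lambda>h. bij_betw h {..<card C} C"]) (simp add: atLeast0LessThan)

lemma class_enum_in: "\<lbrakk>C \<in> par_classes Q1 s t; i < card C\<rbrakk> \<Longrightarrow> class_enum C i \<in> C"
  using class_enum_bij bij_betwE by blast

lemma class_enum_ex: "\<lbrakk>C \<in> par_classes Q1 s t; a \<in> C\<rbrakk> \<Longrightarrow> \<exists>i<card C. class_enum C i = a"
  using class_enum_bij[of C] unfolding bij_betw_def by (metis imageE lessThan_iff)

lemma class_enum_inj: "\<lbrakk>C \<in> par_classes Q1 s t; i < card C; j < card C\<rbrakk> \<Longrightarrow> class_enum C i = class_enum C j \<longleftrightarrow> i = j"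
  using class_enum_bij[of C] unfolding bij_betw_def inj_on_def by blast

lemma class_block_carrier: "class_block C M \<in> lcar (gl (card C))"
  by (auto simp: class_block_def gl_simps)

text \<open>A symbol relates parallel arrows only, so the sum over all arrows is confined to the
  class.\<close>

lemma class_block_mult:
  assumes C: "C \<in> par_classes Q1 s t" and M: "M \<in> symbol_space" and ij: "i < card C"
  shows "(\<Sum>b\<in>Q1. M (class_enum C i) b * N b (class_enum C j)) = (\<Sum>l<card C. M (class_enum C i) (class_enum C l) * N (class_enum C l) (class_enum C j))"
proof -
  have CQ: "C \<subseteq> Q1" using C by (auto simp: par_classes_iff par_def)
  have z: "M (class_enum C i) b = 0" if "b \<notin> C" for b
  proof (rule ccontr)
    assume "M (class_enum C i) b \<noteq> 0"
    then have "par b (class_enum C i)" using M arrow_le_par by (auto simp: symbol_space_def)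
    moreover have "class_enum C i \<in> C" using class_enum_in[OF C ij] .
    ultimately show False using that C by (auto simp: par_classes_iff par_def)
  qed
  have "(\<Sum>b\<in>Q1. M (class_enum C i) b * N b (class_enum C j)) = (\<Sum>b\<in>C. M (class_enum C i) b * N b (class_enum C j))"
    using z CQ finite_Q1 by (intro sum.mono_neutral_right) auto
  also have "\<dots> = (\<Sum>l<card C. M (class_enum C i) (class_enum C l) * N (class_enum C l) (class_enum C j))"
    using sum.reindex_bij_betw[OF class_enum_bij[OF C], of "\<lambda>b. M (class_enum C i) b * N b (class_enum C j)"] by simp
  finally show ?thesis .
qed

lemma class_block_br:
  assumes C: "C \<in> par_classes Q1 s t" and M: "M \<in> symbol_space" and N: "N \<in> symbol_space"
  shows "class_block C (mat_br M N) = lbr (gl (card C)) (class_block C M) (class_block C N)"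
proof (intro ext)
  fix i j
  show "class_block C (mat_br M N) i j = lbr (gl (card C)) (class_block C M) (class_block C N) i j"
  proof (cases "i < card C \<and> j < card C")
    case True
    then show ?thesis
      by (simp add: gl_simps class_block_def mat_br_def class_block_mult[OF C M] class_block_mult[OF C N])
  qed (auto simp: class_block_def gl_simps)
qed

lemma class_block_add: "class_block C (\<lambda>c b. M c b + N c b) = ladd (gl (card C)) (class_block C M) (class_block C N)"
  and class_block_smult: "class_block C (\<lambda>c b. r * M c b) = lsmult (gl (card C)) r (class_block C M)"
  by (auto simp: class_block_def gl_simps intro!: ext)

lemma class_block_cobd:
  assumes C: "C \<in> par_classes Q1 s t"
  shows "class_block C (cobd x) \<in> scalar_matrices (card C)"
proof -
  obtain a where a: "a \<in> Q1" "C = {b. par a b}" using C by (auto simp: par_classes_iff)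
  have "class_enum C i \<in> Q1 \<and> s (class_enum C i) = s a \<and> t (class_enum C i) = t a" if "i < card C" for i
    using class_enum_in[OF C that] a by (auto simp: par_def)
  then have "class_block C (cobd x) = (\<lambda>i j. if i = j \<and> i < card C then x (s a) - x (t a) else 0)"
    using class_enum_inj[OF C] by (intro ext) (auto simp: class_block_def cobd_def)
  then show ?thesis by (auto simp: scalar_matrices_def)
qed

end

context monomial_algebra begin

text \<open>The blocks of the symbol modulo scalars define the map. It is onto because saturation
  admits arbitrary blocks. Symbols with equal image differ by a scalar on each class; on a tree such
  a family of scalars is a coboundary, and \<open>tree_cobd_Inn\<close> applies.\<close>

lemma tree_saturated_iso:
  assumes tree: "Qbar_is_tree Q0 Q1 s t" and sat: "\<And>a b. par a b \<Longrightarrow> arrow_le a b"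
  shows "lie_iso (HH1 t B :: (_, 'k) liealg) (lie_prod (par_classes Q1 s t) (\<lambda>C. pgl (card C)))"
proof -
  interpret H: lie_algebra_ideal "Der_lie t B :: (_, 'k) liealg" Inn by (rule lie_algebra_ideal_HH1)
  define cs where "cs C = lcoset (gl (card C) :: (_, 'k) liealg) (scalar_matrices (card C))" for C :: "'a set"
  define h where "h D = restrict (\<lambda>C. cs C (class_block C (symbol D))) (par_classes Q1 s t)"
    for D :: "(('v,'a) qpath \<Rightarrow> 'k) \<Rightarrow> ('v,'a) qpath \<Rightarrow> 'k"
  let ?P = "lie_prod (par_classes Q1 s t) (\<lambda>C. pgl (card C)) :: (_, 'k) liealg"
  have G: "lie_algebra_ideal (gl n :: (_, 'k) liealg) (scalar_matrices n)" for n
    by (rule lie_algebra_ideal_pgl)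
  note qadd = lie_algebra_ideal.quot_add[OF G class_block_carrier class_block_carrier]
    and qsm = lie_algebra_ideal.quot_smult[OF G class_block_carrier]
    and qbr = lie_algebra_ideal.quot_br[OF G class_block_carrier class_block_carrier]
    and qeq = lie_algebra_ideal.coset_eq_iff[OF G class_block_carrier class_block_carrier]
  have "lie_iso (lie_quot (Der_lie t B :: (_, 'k) liealg) Inn) ?P"
  proof (rule H.quot_iso[of h])
    show "h D \<in> lcar ?P" for D
      using class_block_carrier by (auto simp: h_def lie_prod_def pgl_def lie_quot_def cs_def)
    show "h (ladd (Der_lie t B) D E) = ladd ?P (h D) (h E)" for D E
      by (auto simp: h_def lie_prod_def pgl_def cs_def Der_lie_simps symbol_add class_block_add qadd intro!: ext)
    show "h (lsmult (Der_lie t B) c D) = lsmult ?P c (h D)" for c D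
      by (auto simp: h_def lie_prod_def pgl_def cs_def Der_lie_simps symbol_smult class_block_smult qsm intro!: ext)
    show "h (lbr (Der_lie t B) D E) = lbr ?P (h D) (h E)"
      if "D \<in> lcar (Der_lie t B)" "E \<in> lcar (Der_lie t B)" for D E
      using that symbol_symbol_space[of D] symbol_symbol_space[of E]
      by (auto simp: h_def lie_prod_def pgl_def cs_def Der_lie_simps symbol_br class_block_br qbr intro!: ext)
    show "\<exists>D\<in>lcar (Der_lie t B). h D = z" if z: "z \<in> lcar ?P" for z
    proof -
      have "\<exists>M\<in>lcar (gl (card C)). z C = cs C M" if "C \<in> par_classes Q1 s t" for C
        using z that by (auto simp: lie_prod_def pgl_def lie_quot_def cs_def)
      then obtain MM where MM: "\<And>C. C \<in> par_classes Q1 s t \<Longrightarrow> MM C \<in> lcar (gl (card C)) \<and> z C = cs C (MM C)"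
        by metis
      define ix where "ix C a = (THE i. i < card C \<and> class_enum C i = a)" for C a
      have ix: "ix C (class_enum C i) = i" if "C \<in> par_classes Q1 s t" "i < card C" for C i
        unfolding ix_def using class_enum_inj[OF that(1)] that(2) by (intro the_equality) auto
      \<comment> \<open>Glues the prescribed blocks into one matrix indexed by arrows, with zero
        entries between different classes.\<close>
      define M where "M = (\<lambda>b a. if par a b then MM {c. par a c} (ix {c. par a c} b) (ix {c. par a c} a) else 0)"
      have "M \<in> symbol_space" using sat by (auto simp: symbol_space_def M_def)
      then obtain D where D: "normalized D" "symbol D = M" by (rule symbol_surj)
      have "class_block C M = MM C" if C: "C \<in> par_classes Q1 s t" for C
      proof (intro ext)
        fix i j
        show "class_block C M i j = MM C i j"
        proof (cases "i < card C \<and> j < card C")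
          case True
          then have e: "class_enum C i \<in> C" "class_enum C j \<in> C" using class_enum_in[OF C] by auto
          have "{c. par (class_enum C j) c} = C" using par_class_eq[OF C e(2)] by simp
          moreover have "par (class_enum C j) (class_enum C i)" using calculation e(1) by blast
          ultimately show ?thesis using True ix[OF C] by (simp add: class_block_def M_def)
        next
          case False
          then show ?thesis using MM[OF C] by (auto simp: class_block_def gl_simps)
        qed
      qed
      then have "h D C = z C" for C
        using z MM[of C] by (cases "C \<in> par_classes Q1 s t")
          (auto simp: h_def D lie_prod_def PiE_def extensional_def)
      then have "h D = z" by blast
      then show ?thesis using D by (auto simp: Der_lie_simps normalized_def)
    qed
    show "h D = h E \<longleftrightarrow> (\<exists>i\<in>Inn. D = ladd (Der_lie t B) E i)"
      if "D \<in> lcar (Der_lie t B)" "E \<in> lcar (Der_lie t B)" for D E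
    proof
      have D: "D \<in> DerK" and E: "E \<in> DerK" using that by (simp_all add: Der_lie_simps)
      assume "h D = h E"
      then have "cs C (class_block C (symbol D)) = cs C (class_block C (symbol E))" if "C \<in> par_classes Q1 s t" for C
        using that by (metis (no_types, lifting) h_def restrict_apply')
      then have S: "\<exists>S\<in>scalar_matrices (card C). class_block C (symbol D) = ladd (gl (card C)) (class_block C (symbol E)) S"
        if "C \<in> par_classes Q1 s t" for C
        using that unfolding cs_def qeq by blast
      have "\<exists>k. \<forall>i<card C. \<forall>j<card C. symbol D (class_enum C i) (class_enum C j) = symbol E (class_enum C i) (class_enum C j) + (if i = j then k else 0)"
        if C: "C \<in> par_classes Q1 s t" for C
      proof -
        obtain S where S: "S \<in> scalar_matrices (card C)" "class_block C (symbol D) = ladd (gl (card C)) (class_block C (symbol E)) S"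
          using S[OF C] by blast
        obtain k where k: "S = (\<lambda>i j. if i = j \<and> i < card C then k else 0)"
          using S(1) by (auto simp: scalar_matrices_def)
        have eq: "class_block C (symbol D) i j = class_block C (symbol E) i j + S i j" for i j using S(2) by (simp add: gl_simps)
        have "symbol D (class_enum C i) (class_enum C j) = symbol E (class_enum C i) (class_enum C j) + (if i = j then k else 0)"
          if "i < card C" "j < card C" for i j
          using that eq[of i j] by (simp add: k class_block_def)
        then show ?thesis by blast
      qed
      then obtain k where k: "\<And>C i j. \<lbrakk>C \<in> par_classes Q1 s t; i < card C; j < card C\<rbrakk>
          \<Longrightarrow> symbol D (class_enum C i) (class_enum C j) = symbol E (class_enum C i) (class_enum C j) + (if i = j then k C else 0)"
        by metis
      \<comment> \<open>The scalars read as a function on the arrows, constant on parallel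
        classes.\<close>
      define f where "f a = k {b. par a b}" for a
      have "f a = f b" if "par a b" for a b
      proof -
        have "{c. par a c} = {c. par b c}" using that by (auto simp: par_def)
        then show ?thesis by (simp add: f_def)
      qed
      then obtain x where x: "\<And>a. a \<in> Q1 \<Longrightarrow> f a = x (s a) - x (t a)"
        using tree_class_cobd[OF tree, of f] by metis
      let ?F = "\<lambda>x p. D x p - E x p"
      have "symbol ?F c b = cobd x c b" for c b
      proof (cases "par b c")
        case True
        let ?C = "{c. par b c}"
        have b: "b \<in> Q1" using True by (simp add: par_def)
        have C: "?C \<in> par_classes Q1 s t" using par_class_self[OF b] .
        have "c \<in> ?C" "b \<in> ?C" using True by (auto simp: par_def)
        then obtain i j where ij: "i < card ?C" "class_enum ?C i = c" "j < card ?C" "class_enum ?C j = b"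
          using class_enum_ex[OF C] by metis
        have "symbol D c b = symbol E c b + (if i = j then k ?C else 0)" using k[OF C ij(1,3)] ij(2,4) by simp
        moreover have "i = j \<longleftrightarrow> c = b" using class_enum_inj[OF C ij(1,3)] ij(2,4) by auto
        ultimately have "symbol D c b = symbol E c b + (if c = b then f b else 0)" by (simp add: f_def)
        then show ?thesis using x[OF b] b by (simp add: symbol_diff cobd_def)
      next
        case False
        then have "\<not> arrow_le b c" using arrow_le_par by blast
        then have "symbol D c b = 0" "symbol E c b = 0" using symbol_symbol_space[OF D] symbol_symbol_space[OF E] by (auto simp: symbol_space_def)
        moreover have "c \<noteq> b \<or> b \<notin> Q1" using False by (auto simp: par_def)
        ultimately show ?thesis by (auto simp: symbol_diff cobd_def)
      qed
      then have "symbol ?F = cobd x" by blast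
      then have "?F \<in> Inn" by (rule tree_cobd_Inn[OF tree der_diff[OF D E]])
      moreover have "D = ladd (Der_lie t B) E ?F" by (simp add: Der_lie_simps)
      ultimately show "\<exists>i\<in>Inn. D = ladd (Der_lie t B) E i" by blast
    next
      assume "\<exists>i\<in>Inn. D = ladd (Der_lie t B) E i"
      then obtain F where F: "F \<in> Inn" "D = ladd (Der_lie t B) E F" by blast
      obtain x where x: "symbol F = cobd x" using Inn_cobd[OF F(1)] by blast
      have "cs C (class_block C (symbol D)) = cs C (class_block C (symbol E))" if C: "C \<in> par_classes Q1 s t" for C
      proof -
        have "class_block C (symbol D) = ladd (gl (card C)) (class_block C (symbol E)) (class_block C (cobd x))"
          by (simp add: F(2) Der_lie_simps symbol_add class_block_add x)
        then show ?thesis unfolding cs_def qeq using class_block_cobd[OF C] by blast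
      qed
      then show "h D = h E" by (auto simp: h_def intro!: ext)
    qed
  qed
  then show ?thesis by (simp add: HH1_eq)
qed

text \<open>An off-diagonal unit inside the class is the symbol of a derivation, while symbols of
  inner derivations are diagonal.\<close>

lemma big_class_nonzero:
  assumes C: "C \<in> par_classes Q1 s t" "card C \<ge> 2" and sat: "\<And>a b. par a b \<Longrightarrow> arrow_le a b"
  shows "lcar (HH1 t B :: (_, 'k) liealg) \<noteq> {lzero (HH1 t B)}"
proof -
  interpret H: lie_algebra_ideal "Der_lie t B :: (_, 'k) liealg" Inn by (rule lie_algebra_ideal_HH1)
  obtain a b where ab: "a \<in> C" "b \<in> C" "a \<noteq> b"
    using C(2) card_le_Suc0_iff_eq[OF par_class_finite[OF C(1)]] by fastforce
  then have "par a b" using C(1) by (auto simp: par_classes_iff par_def)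
  then obtain D where D: "D \<in> DerK" "symbol D = arrow_unit b a" using arrow_unit_der[OF sat] by blast
  have "D \<notin> Inn"
  proof
    assume "D \<in> Inn"
    then have "arrow_unit b a b a = (0::'k)" using Inn_diagonal[of D b a] D ab by simp
    then show False by (simp add: arrow_unit_def)
  qed
  then show ?thesis unfolding HH1_eq H.quot_trivial_iff using D by (auto simp: Der_lie_simps)
qed

end

theorem theorem3p15:
  fixes Q0 :: "'v set" and Q1 :: "'a set" and s t :: "'a \<Rightarrow> 'v"
    and Z :: "('v,'a) qpath set"
  assumes quiver: "finite_quiver Q0 Q1 s t"
    and conn: "quiver_connected Q0 Q1 s t"
    and Zmin: "minimal_relations Q0 Q1 s t Z"
    and findim: "finite (Bpaths Q0 Q1 s t Z)"
    and L0: "(L_minus1 Q0 Q1 s t Z :: ('a \<times> ('v,'a) qpath \<Rightarrow> 'k::alg_closed_field) set) = {\<lambda>_. 0}"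
  shows
    "(lie_semisimple (HH1 t (Bpaths Q0 Q1 s t Z) :: (_, 'k) liealg)
      \<longleftrightarrow> Qbar_is_tree Q0 Q1 s t
          \<and> (\<exists>C\<in>par_classes Q1 s t. card C \<ge> 2)
          \<and> completely_saturated Q0 Q1 s t Z TYPE('k)
          \<and> (CHAR('k) = 2 \<longrightarrow> (\<forall>C\<in>par_classes Q1 s t. card C \<noteq> 2)))
   \<and> (lie_semisimple (HH1 t (Bpaths Q0 Q1 s t Z) :: (_, 'k) liealg)
      \<longleftrightarrow> lcar (HH1 t (Bpaths Q0 Q1 s t Z) :: (_, 'k) liealg) \<noteq> {lzero (HH1 t (Bpaths Q0 Q1 s t Z))}
          \<and> lie_iso (HH1 t (Bpaths Q0 Q1 s t Z) :: (_, 'k) liealg)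
                    (lie_prod (par_classes Q1 s t) (\<lambda>C. pgl (card C)))
          \<and> (CHAR('k) = 2 \<longrightarrow> (\<forall>C\<in>par_classes Q1 s t. card C \<noteq> 2)))"
proof -
  interpret monomial_algebra Q0 Q1 s t Z "TYPE('k)"
    by unfold_locales (fact quiver Zmin findim L0)+
  interpret H: lie_algebra_ideal "Der_lie t B :: (_, 'k) liealg" Inn by (rule lie_algebra_ideal_HH1)
  have char2: "(2::'k) = 0 \<longleftrightarrow> CHAR('k) = 2"
  proof
    assume "(2::'k) = 0"
    then have "of_nat 2 = (0::'k)" by simp
    then have "CHAR('k) dvd 2" by (simp only: of_nat_eq_0_iff_char_dvd)
    then have "CHAR('k) \<le> 2" and "CHAR('k) \<noteq> 0"
      by (simp add: dvd_imp_le, metis dvd_0_left_iff zero_neq_numeral)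
    moreover have "CHAR('k) \<noteq> 1" by simp
    ultimately show "CHAR('k) = 2" by linarith
  next
    assume "CHAR('k) = 2"
    then show "(2::'k) = 0" using of_nat_CHAR[where ?'a = 'k] by simp
  qed
  let ?H = "HH1 t B :: (_, 'k) liealg"
  let ?ch = "CHAR('k) = 2 \<longrightarrow> (\<forall>C\<in>par_classes Q1 s t. card C \<noteq> 2)"
  let ?ii = "Qbar_is_tree Q0 Q1 s t \<and> (\<exists>C\<in>par_classes Q1 s t. card C \<ge> 2)
    \<and> completely_saturated Q0 Q1 s t Z TYPE('k) \<and> ?ch"
  let ?iii = "lcar ?H \<noteq> {lzero ?H} \<and> lie_iso ?H (lie_prod (par_classes Q1 s t) (\<lambda>C. pgl (card C))) \<and> ?ch"
  \<comment> \<open>The three implications close the cycle (i), (ii), (iii), which yields both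
    equivalences with (i).\<close>
  have 1: ?ii if ss: "lie_semisimple ?H"
    using semisimple_Qbar_tree[OF ss conn] semisimple_big_class[OF ss] semisimple_par_arrow_le[OF ss]
      semisimple_char_2[OF ss] char2 by (simp add: completely_saturated_iff)
  have 2: ?iii if ii: ?ii
  proof -
    have sat: "arrow_le a b" if "par a b" for a b using ii that by (simp add: completely_saturated_iff)
    show ?thesis using ii tree_saturated_iso[OF _ sat] big_class_nonzero[OF _ _ sat] by blast
  qed
  have 3: "lie_semisimple ?H" if iii: ?iii
  proof (rule iso_prod_pgl_semisimple[where J = "par_classes Q1 s t" and m = card])
    show "lie_algebra ?H" unfolding HH1_eq by (rule H.lie_algebra_quot)
  qed (use iii char2 in auto)
  show ?thesis unfolding B_def[symmetric] using 1 2 3 by blast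
qed

end
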